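(* Let $G = \mathbb{R}^2 \rtimes SO(2)$, and let $U = \operatorname{ind}_{\mathbb{R}^2}^G \chi$, where $\chi$ is the character on $\mathbb{R}^2$ given by $\chi(x) = \mathrm{e}^{ix_1}$ $(x=(x_1,x_2) \in \mathbb{R}^2)$. Then: (i) there exists a unit vector $\xi \in L^2(SO(2))$ such that $\mathcal{J}_{U,\xi}$ is a weak*-closed maximal left ideal of $M(G)$ that is not generated by a projection; (ii) the left ideal $\mathcal{J}_{U,1}$ of $M(G)$ is weak*-closed, and is not generated by finitely many compactly supported measures.
   Context: $M(G)$ denotes the measure algebra of complex regular Borel measures on $G$ with total variation norm and convolution; it is the dual of $C_0(G)$, and "weak*" refers to this duality. The group $G=\mathbb{R}^2\rtimes SO(2)$ has multiplication $(x,R)(y,S) = (x+Ry, RS)$. Identifying $SO(2)$ with $[0,2\pi)$ (angles modulo $2\pi$, with normalised Haar measure), the induced representation $U$ is realised as the unitary representation on $L^2(SO(2))$ given by $$[U(x,\theta)\xi](\varphi) = \exp\big(i(x_1\cos\varphi + x_2\sin\varphi)\big)\,\xi(\varphi-\theta) \qquad (x\in\mathbb{R}^2,\ \theta,\varphi\in[0,2\pi),\ \xi\in L^2(SO(2))).$$ For $\mu \in M(G)$, $U(\mu) = \int_G U(t)\,\mathrm{d}\mu(t)$ (weak integral). For $\xi\in L^2(SO(2))$, $\mathcal{J}_{U,\xi} = \{\mu\in M(G): U(\mu)\xi = 0\}$; in (ii), $1$ denotes the constant function $1\in L^2(SO(2))$. A maximal left ideal is a proper left ideal maximal among proper left ideals.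 The involution on $M(G)$ is $\mu^*(E)=\overline{\mu(E^{-1})}$; a projection is a self-adjoint idempotent; a left ideal $J$ is generated by a projection if $J = M(G)*q$ for some projection $q\in M(G)$. A left ideal $J$ is generated by measures $\mu_1,\dots,\mu_m \in J$ if $J = M(G)*\mu_1+\cdots+M(G)*\mu_m$ (no closure is taken). *)

theory Defs
  imports "HOL-Analysis.Analysis" "HOL-Algebra.Group"
begin

section \<open>Complex measures\<close>

text \<open>
  A complex measure on the measurable space \<open>M\<close> is a set function that is countably additive on
  \<open>sets M\<close>. It is required to vanish off \<open>sets M\<close>, so that equality of set functions is equality of
  measures.
\<close>

definition complex_measure :: "'a measure \<Rightarrow> ('a set \<Rightarrow> complex) \<Rightarrow> bool" where
  "complex_measure M \<mu> \<longleftrightarrow>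
     (\<forall>A :: nat \<Rightarrow> 'a set. range A \<subseteq> sets M \<longrightarrow> disjoint_family A \<longrightarrow>
        (\<lambda>n. \<mu> (A n)) sums \<mu> (\<Union>n. A n)) \<and>
     (\<forall>E. E \<notin> sets M \<longrightarrow> \<mu> E = 0)"

definition total_variation :: "'a measure \<Rightarrow> ('a set \<Rightarrow> complex) \<Rightarrow> 'a set \<Rightarrow> ennreal" where
  "total_variation M \<mu> E =
     (SUP P \<in> {P. finite P \<and> disjoint P \<and> P \<subseteq> sets M \<and> \<Union>P \<subseteq> E}. \<Sum>F\<in>P. ennreal (cmod (\<mu> F)))"

text \<open>
  The positive part of the Jordan decomposition of a finite signed measure \<open>\<nu>\<close> is
  \<open>E \<mapsto> sup {\<nu> F | F \<subseteq> E measurable}\<close>; the negative part is the positive part of \<open>- \<nu>\<close>.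
\<close>

definition jordan_pos :: "'a measure \<Rightarrow> ('a set \<Rightarrow> real) \<Rightarrow> 'a measure" where
  "jordan_pos M \<nu> =
     measure_of (space M) (sets M) (\<lambda>E. SUP F \<in> {F \<in> sets M. F \<subseteq> E}. ennreal (\<nu> F))"

definition cm_integral :: "'a measure \<Rightarrow> ('a set \<Rightarrow> complex) \<Rightarrow> ('a \<Rightarrow> complex) \<Rightarrow> complex" where
  "cm_integral M \<mu> f =
     (integral\<^sup>L (jordan_pos M (\<lambda>E. Re (\<mu> E))) f - integral\<^sup>L (jordan_pos M (\<lambda>E. - Re (\<mu> E))) f) +
     \<i> * (integral\<^sup>L (jordan_pos M (\<lambda>E. Im (\<mu> E))) f - integral\<^sup>L (jordan_pos M (\<lambda>E. - Im (\<mu> E))) f)"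


section \<open>The measure algebra\<close>

text \<open>
  Below, \<open>G\<close> is a topological group whose topology is the subspace topology of \<open>carrier G\<close> in the
  ambient type.
\<close>

definition borel_on :: "('a::topological_space) monoid \<Rightarrow> 'a measure" where
  "borel_on G = restrict_space borel (carrier G)"

definition regular_measure :: "('a::topological_space) monoid \<Rightarrow> ('a set \<Rightarrow> complex) \<Rightarrow> bool" where
  "regular_measure G \<mu> \<longleftrightarrow>
     (\<forall>E \<in> sets (borel_on G). \<forall>\<epsilon>::real. \<epsilon> > 0 \<longrightarrow>
        (\<exists>K V. compact K \<and> openin (top_of_set (carrier G)) V \<and> K \<subseteq> E \<and> E \<subseteq> V \<and>
           total_variation (borel_on G) \<mu> (V - K) < ennreal \<epsilon>))"

definition meas_alg :: "('a::topological_space) monoid \<Rightarrow> ('a set \<Rightarrow> complex) set" where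
  "meas_alg G = {\<mu>. complex_measure (borel_on G) \<mu> \<and> regular_measure G \<mu>}"

definition conv :: "('a::topological_space) monoid \<Rightarrow> ('a set \<Rightarrow> complex) \<Rightarrow> ('a set \<Rightarrow> complex) \<Rightarrow>
    'a set \<Rightarrow> complex" where
  "conv G \<mu> \<nu> E =
     (if E \<in> sets (borel_on G)
      then cm_integral (borel_on G) \<nu> (\<lambda>t. cm_integral (borel_on G) \<mu> (\<lambda>s. indicator E (s \<otimes>\<^bsub>G\<^esub> t)))
      else 0)"

definition cm_star :: "('a::topological_space) monoid \<Rightarrow> ('a set \<Rightarrow> complex) \<Rightarrow> 'a set \<Rightarrow> complex" where
  "cm_star G \<mu> E = (if E \<in> sets (borel_on G) then cnj (\<mu> (m_inv G ` E)) else 0)"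

definition cm_support :: "('a::topological_space) monoid \<Rightarrow> ('a set \<Rightarrow> complex) \<Rightarrow> 'a set" where
  "cm_support G \<mu> = {x \<in> carrier G. \<forall>V. openin (top_of_set (carrier G)) V \<longrightarrow> x \<in> V \<longrightarrow>
     total_variation (borel_on G) \<mu> V \<noteq> 0}"

definition C0 :: "('a::topological_space) monoid \<Rightarrow> ('a \<Rightarrow> complex) set" where
  "C0 G = {f. continuous_on (carrier G) f \<and>
     (\<forall>\<epsilon>>0. \<exists>K. compact K \<and> K \<subseteq> carrier G \<and> (\<forall>x \<in> carrier G - K. cmod (f x) < \<epsilon>))}"

definition weak_star :: "('a::topological_space) monoid \<Rightarrow> ('a set \<Rightarrow> complex) topology" where
  "weak_star G =
     pullback_topology (meas_alg G) (\<lambda>\<mu>. \<lambda>f\<in>C0 G. cm_integral (borel_on G) \<mu> f)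
       (product_topology (\<lambda>_. euclidean) (C0 G))"

definition left_ideal :: "('a::topological_space) monoid \<Rightarrow> ('a set \<Rightarrow> complex) set \<Rightarrow> bool" where
  "left_ideal G J \<longleftrightarrow> J \<subseteq> meas_alg G \<and> (\<lambda>_. 0) \<in> J \<and>
     (\<forall>\<mu>\<in>J. \<forall>\<nu>\<in>J. (\<lambda>E. \<mu> E + \<nu> E) \<in> J) \<and>
     (\<forall>c. \<forall>\<mu>\<in>J. (\<lambda>E. c * \<mu> E) \<in> J) \<and>
     (\<forall>\<nu>\<in>meas_alg G. \<forall>\<mu>\<in>J. conv G \<nu> \<mu> \<in> J)"

definition maximal_left_ideal ::
    "('a::topological_space) monoid \<Rightarrow> ('a set \<Rightarrow> complex) set \<Rightarrow> bool" where
  "maximal_left_ideal G J \<longleftrightarrow> left_ideal G J \<and> J \<noteq> meas_alg G \<and>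
     (\<forall>I. left_ideal G I \<longrightarrow> I \<noteq> meas_alg G \<longrightarrow> J \<subseteq> I \<longrightarrow> I = J)"

definition cm_projection :: "('a::topological_space) monoid \<Rightarrow> ('a set \<Rightarrow> complex) \<Rightarrow> bool" where
  "cm_projection G q \<longleftrightarrow> q \<in> meas_alg G \<and> cm_star G q = q \<and> conv G q q = q"

definition generated_by_projection ::
    "('a::topological_space) monoid \<Rightarrow> ('a set \<Rightarrow> complex) set \<Rightarrow> bool" where
  "generated_by_projection G J \<longleftrightarrow>
     (\<exists>q. cm_projection G q \<and> J = (\<lambda>\<nu>. conv G \<nu> q) ` meas_alg G)"

definition generated_by_measures :: "('a::topological_space) monoid \<Rightarrow> ('a set \<Rightarrow> complex) set \<Rightarrow>
    nat \<Rightarrow> (nat \<Rightarrow> 'a set \<Rightarrow> complex) \<Rightarrow> bool" where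
  "generated_by_measures G J m \<mu> \<longleftrightarrow> (\<forall>i<m. \<mu> i \<in> J) \<and>
     J = {(\<lambda>E. \<Sum>i<m. conv G (\<nu> i) (\<mu> i) E) | \<nu>. \<forall>i<m. \<nu> i \<in> meas_alg G}"


section \<open>Representations on spaces of square-integrable functions\<close>

text \<open>Vectors of \<open>L\<^sup>2\<close> are represented by functions, which are not identified when equal
  almost everywhere.\<close>

definition L2 :: "'k measure \<Rightarrow> ('k \<Rightarrow> complex) set" where
  "L2 H = {\<xi> \<in> borel_measurable H. integrable H (\<lambda>s. (cmod (\<xi> s))\<^sup>2)}"

definition L2_inner :: "'k measure \<Rightarrow> ('k \<Rightarrow> complex) \<Rightarrow> ('k \<Rightarrow> complex) \<Rightarrow> complex" where
  "L2_inner H \<xi> \<eta> = (\<integral>s. \<xi> s * cnj (\<eta> s) \<partial>H)"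

definition L2_norm :: "'k measure \<Rightarrow> ('k \<Rightarrow> complex) \<Rightarrow> real" where
  "L2_norm H \<xi> = sqrt (\<integral>s. (cmod (\<xi> s))\<^sup>2 \<partial>H)"

text \<open>\<open>has_weak_integral G H U \<mu> \<xi> \<eta>\<close> states that \<open>U(\<mu>)\<xi> = \<integral> U(t)\<xi> d\<mu>(t)\<close>, as a weak integral
  in \<open>L\<^sup>2(H)\<close>, exists and is represented by \<open>\<eta>\<close>.\<close>

definition has_weak_integral :: "('a::topological_space) monoid \<Rightarrow> 'k measure \<Rightarrow>
    ('a \<Rightarrow> ('k \<Rightarrow> complex) \<Rightarrow> 'k \<Rightarrow> complex) \<Rightarrow> ('a set \<Rightarrow> complex) \<Rightarrow> ('k \<Rightarrow> complex) \<Rightarrow>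
    ('k \<Rightarrow> complex) \<Rightarrow> bool" where
  "has_weak_integral G H U \<mu> \<xi> \<eta> \<longleftrightarrow> \<eta> \<in> L2 H \<and>
     (\<forall>\<zeta>\<in>L2 H. L2_inner H \<eta> \<zeta> = cm_integral (borel_on G) \<mu> (\<lambda>t. L2_inner H (U t \<xi>) \<zeta>))"

definition annihilator_ideal :: "('a::topological_space) monoid \<Rightarrow> 'k measure \<Rightarrow>
    ('a \<Rightarrow> ('k \<Rightarrow> complex) \<Rightarrow> 'k \<Rightarrow> complex) \<Rightarrow> ('k \<Rightarrow> complex) \<Rightarrow> ('a set \<Rightarrow> complex) set" where
  "annihilator_ideal G H U \<xi> = {\<mu> \<in> meas_alg G. has_weak_integral G H U \<mu> \<xi> (\<lambda>_. 0)}"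


section \<open>The group \<open>\<real>\<^sup>2 \<rtimes> SO(2)\<close> and the induced representation\<close>

definition SO2 :: "(real^2^2) set" where
  "SO2 = {R. rotation_matrix R}"

definition SE2 :: "((real^2) \<times> (real^2^2)) monoid" where
  "SE2 = \<lparr>carrier = UNIV \<times> SO2,
          mult = (\<lambda>(x, R) (y, S). (x + R *v y, R ** S)),
          one = (0, mat 1)\<rparr>"

definition rot :: "real \<Rightarrow> real^2^2" where
  "rot \<theta> = vector [vector [cos \<theta>, - sin \<theta>], vector [sin \<theta>, cos \<theta>]]"

definition haar_SO2 :: "(real^2^2) measure" where
  "haar_SO2 = distr (uniform_measure lborel {0..<2*pi}) (restrict_space borel SO2) rot"

definition char_e1 :: "real^2 \<Rightarrow> complex" where
  "char_e1 x = exp (\<i> * of_real (x $ 1))"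

text \<open>
  The representation induced from a character \<open>\<omega>\<close> of \<open>\<real>\<^sup>2\<close> acts by left translation on functions
  \<open>f\<close> on the group with \<open>f(g(y,I)) = \<omega>(-y) f(g)\<close>. Such an \<open>f\<close> is determined by
  \<open>\<xi>(S) = f(0,S)\<close>, and \<open>(x,R)\<^sup>-\<^sup>1(0,S) = (0, R\<^sup>-\<^sup>1S)(-S\<^sup>-\<^sup>1x, I)\<close>.
\<close>

definition ind_rep :: "(real^2 \<Rightarrow> complex) \<Rightarrow> (real^2) \<times> (real^2^2) \<Rightarrow>
    (real^2^2 \<Rightarrow> complex) \<Rightarrow> real^2^2 \<Rightarrow> complex" where
  "ind_rep \<omega> = (\<lambda>(x, R) \<xi> S. \<omega> (transpose S *v x) * \<xi> (transpose R ** S))"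

definition J_U :: "(real^2^2 \<Rightarrow> complex) \<Rightarrow> (((real^2) \<times> (real^2^2)) set \<Rightarrow> complex) set" where
  "J_U = annihilator_ideal SE2 haar_SO2 (ind_rep char_e1)"

lemma rotation_matrix_rot: "rotation_matrix (rot \<theta>)"
  by (simp add: rotation_matrix_def orthogonal_matrix_def rot_def det_2 vec_eq_iff forall_2
      matrix_matrix_mult_def transpose_def mat_def sum_2 vector_2
      flip: power2_eq_square)

lemma bij_betw_rot: "bij_betw rot {0..<2*pi} SO2"
proof -
  have "inj_on rot {0..<2*pi}"
  proof (rule inj_onI)
    fix a b assume a: "a \<in> {0..<2*pi}" and b: "b \<in> {0..<2*pi}" and "rot a = rot b"
    then have "cos a = cos b" "sin a = sin b"
      by (auto simp: rot_def vec_eq_iff forall_2 vector_2)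
    then obtain n :: int where n: "a = b + 2 * pi * n"
      using sin_cos_eq_iff by (metis mult.commute mult.left_commute)
    have "\<bar>2 * pi * n\<bar> < 2 * pi * 1"
      using a b n by auto
    then have "\<bar>real_of_int n\<bar> < 1"
      by (simp add: abs_mult)
    then show "a = b" using n by simp
  qed
  moreover have "R \<in> rot ` {0..<2*pi}" if "rotation_matrix R" for R :: "real^2^2"
  proof -
    let ?a = "R$1$1" and ?b = "R$1$2" and ?c = "R$2$1" and ?d = "R$2$2"
    have eqs: "?a * ?a + ?c * ?c = 1" "?b * ?b + ?d * ?d = 1" "?a * ?b + ?c * ?d = 0"
        "?a * ?d - ?b * ?c = 1"
      using that by (auto simp: rotation_matrix_def orthogonal_matrix_def det_2 vec_eq_iff forall_2
          matrix_matrix_mult_def transpose_def mat_def sum_2 split: if_splits)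
    have "(?a - ?d)\<^sup>2 + (?b + ?c)\<^sup>2 = 0"
      using eqs by (simp add: power2_eq_square algebra_simps)
    then have "?d = ?a" "?b = - ?c"
      by (auto simp: sum_power2_eq_zero_iff)
    moreover obtain t where "0 \<le> t" "t < 2*pi" "?a = cos t" "?c = sin t"
      using sincos_total_2pi[of ?a ?c] eqs(1) by (auto simp: power2_eq_square)
    ultimately have "R = rot t"
      by (simp add: rot_def vec_eq_iff forall_2 vector_2)
    then show ?thesis using \<open>0 \<le> t\<close> \<open>t < 2*pi\<close> by auto
  qed
  ultimately show ?thesis
    using rotation_matrix_rot by (auto simp: bij_betw_def SO2_def)
qed

lemma group_SE2: "group SE2"
proof (rule groupI)
  fix g assume "g \<in> carrier SE2"
  then obtain x R where g: "g = (x, R)" and R: "rotation_matrix R"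
    by (auto simp: SE2_def SO2_def)
  show "\<exists>h\<in>carrier SE2. h \<otimes>\<^bsub>SE2\<^esub> g = \<one>\<^bsub>SE2\<^esub>"
    by (rule bexI[of _ "(- (transpose R *v x), transpose R)"])
      (use g R in \<open>auto simp: SE2_def SO2_def rotation_matrix_def orthogonal_matrix_def det_transpose\<close>)
qed (auto simp: SE2_def SO2_def rotation_matrix_def orthogonal_matrix_mul orthogonal_matrix_id
      det_mul matrix_vector_right_distrib matrix_vector_mul_assoc matrix_mul_assoc)

text \<open>In terms of angles, the representation is given by the familiar formula.\<close>

lemma ind_rep_rot:
  "ind_rep char_e1 (x, rot \<theta>) \<xi> (rot \<phi>) =
     exp (\<i> * of_real (x $ 1 * cos \<phi> + x $ 2 * sin \<phi>)) * \<xi> (rot (\<phi> - \<theta>))"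
proof -
  have "transpose (rot \<theta>) ** rot \<phi> = rot (\<phi> - \<theta>)"
    by (simp add: rot_def vec_eq_iff forall_2 matrix_matrix_mult_def transpose_def sum_2 vector_2
        cos_diff sin_diff algebra_simps)
  moreover have "(transpose (rot \<phi>) *v x) $ 1 = x $ 1 * cos \<phi> + x $ 2 * sin \<phi>"
    by (simp add: rot_def matrix_vector_mult_def transpose_def sum_2 vector_2 mult.commute)
  ultimately show ?thesis
    by (simp add: ind_rep_def char_e1_def)
qed

end

theory Submission
  imports Defs "HOL-Probability.Probability"
begin

text \<open>
  The vector \<open>\<xi> = 1\<close> works in both parts, so everything concerns the left ideal \<open>J\<close> of the measures
  that annihilate the constant function.

  Let \<open>e\<^sub>x(S)\<close>, for \<open>x \<in> \<real>\<^sup>2\<close>, be the plane wave \<open>exp(\<i> x\<sqdot>u)\<close>, where the unit vector \<open>u\<close> is the first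
  column of the rotation \<open>S\<close>. Then \<open>U(\<mu>)1\<close> is the continuous function \<open>\<integral> e\<^sub>x d\<mu>(x, R)\<close> on the circle.
  By Stone--Weierstrass the plane waves span a dense space of continuous functions
  (\<open>plane_waves_total\<close>). Hence \<open>\<mu> \<in> J\<close> if and only if \<open>U(\<mu>)1\<close> is orthogonal to every plane wave, and
  this means that \<open>\<integral> B(x + y) d\<mu>(x, R) = 0\<close> for all \<open>y\<close>, where \<open>B(z) = J\<^sub>0(\<bar>z\<bar>)\<close> is the average of
  \<open>e\<^sub>z\<close> over the circle. As \<open>J\<^sub>0\<close> vanishes at infinity, these are conditions on integrals of functions
  in \<open>C\<^sub>0\<close>, and so \<open>J\<close> is weak* closed (\<open>weak_star_closed_J1\<close>).

  For maximality, let \<open>g = U(\<mu>)1\<close> be nonzero. Some plane wave \<open>e\<^sub>y\<close> satisfies \<open>\<integral> e\<^sub>y g \<noteq> 0\<close>.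
  Translating by \<open>y\<close> multiplies by \<open>e\<^sub>y\<close>, and averaging over \<open>SO(2)\<close> then yields a constant, so that
  \<open>U(\<nu>)g = 1\<close> for a suitable measure \<open>\<nu>\<close>. Thus \<open>\<nu> * \<mu>\<close> is a right unit modulo \<open>J\<close>, and a left ideal
  that contains \<open>J\<close> and \<open>\<mu>\<close> is everything (\<open>maximal_left_ideal_J1\<close>).

  Both negative statements compare \<open>U = U\<^sub>1\<close> with the representations \<open>U\<^sub>r\<close> induced from the characters
  \<open>x \<mapsto> exp(\<i> r x\<^sub>1)\<close>, as \<open>r\<close> tends to \<open>1\<close>.

  If \<open>J = M(G) * q\<close> with \<open>q\<close> idempotent, then \<open>U\<^sub>r(\<mu>) U\<^sub>r(q) = U\<^sub>r(\<mu>)\<close> for all \<open>\<mu> \<in> J\<close>. The ideal contains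
  measures for which \<open>U\<^sub>r(\<mu>)\<close> is a nonzero scalar when \<open>r > 1\<close>, namely a uniform measure on a circle
  minus a multiple of the unit. So \<open>U\<^sub>r(q)1 = 1\<close> for \<open>r > 1\<close>, and in the limit \<open>U\<^sub>1(q)1 = 1\<close>,
  whereas \<open>q \<in> J\<close> (\<open>not_generated_by_projection_J1\<close>).

  If \<open>\<mu> \<in> J\<close> has compact support, then \<open>U\<^sub>r(\<mu>)1\<close> is a Lipschitz function of \<open>r\<close> that vanishes at
  \<open>r = 1\<close>, so it is bounded by a multiple of \<open>\<bar>r - 1\<bar>\<close>, uniformly on the circle. This bound persists in the
  left ideal that finitely many such measures generate (\<open>generated_lipschitz\<close>). But \<open>J\<close> contains a
  measure that violates it. Its Fourier transform is a sum over \<open>k\<close>, with weights \<open>2\<^bsup>-k-1\<^esup>\<close>, of the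
  functions \<open>\<tau>(\<bar>u\<bar>\<^sup>2 - 1) exp(-(\<tau>\<^sup>2(u\<^sub>1 - 1)\<^sup>2 + \<tau> u\<^sub>2\<^sup>2) / 2)\<close> with \<open>\<tau> = 4\<^sup>k\<close>. Each of them vanishes on the unit
  circle and has slope \<open>2\<tau>\<close> at \<open>(1, 0)\<close> in the radial direction, but by their parabolic scaling they are
  transforms of measures of bounded norm. For \<open>r > 1\<close> all terms are nonnegative at \<open>(r, 0)\<close>, so the
  growing slopes cannot cancel (\<open>rough_lower_bound\<close>).
\<close>

section \<open>Functionals that are continuous under bounded pointwise convergence\<close>

definition bounded_measurable :: "'a measure \<Rightarrow> ('a \<Rightarrow> complex) set" where
  "bounded_measurable M = {f \<in> borel_measurable M. \<exists>B. \<forall>x\<in>space M. cmod (f x) \<le> B}"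

text \<open>
  Integrals against complex measures are awkward to handle through their four Jordan parts. They are
  characterised by this notion: a \<sigma>-functional is determined by its values on indicators, and those
  values form a complex measure. Linearity in the measure, the formula for convolutions and explicit
  constructions of measures all reduce to exhibiting a functional of this kind.
\<close>

definition sigma_functional :: "'a measure \<Rightarrow> (('a \<Rightarrow> complex) \<Rightarrow> complex) \<Rightarrow> bool" where
  "sigma_functional M L \<longleftrightarrow>
     (\<forall>f\<in>bounded_measurable M. \<forall>g\<in>bounded_measurable M. L (\<lambda>x. f x + g x) = L f + L g) \<and>
     (\<forall>c. \<forall>f\<in>bounded_measurable M. L (\<lambda>x. c * f x) = c * L f) \<and>
     (\<forall>F f B. (\<forall>n. F n \<in> borel_measurable M) \<longrightarrow> f \<in> borel_measurable M \<longrightarrow>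
        (\<forall>n. \<forall>x\<in>space M. cmod (F n x) \<le> B) \<longrightarrow>
        (\<forall>x\<in>space M. (\<lambda>n::nat. F n x) \<longlonglongrightarrow> f x) \<longrightarrow> (\<lambda>n. L (F n)) \<longlonglongrightarrow> L f)"

lemma sigma_functionalI:
  assumes "\<And>f g. f \<in> bounded_measurable M \<Longrightarrow> g \<in> bounded_measurable M \<Longrightarrow> L (\<lambda>x. f x + g x) = L f + L g"
    and "\<And>c f. f \<in> bounded_measurable M \<Longrightarrow> L (\<lambda>x. c * f x) = c * L f"
    and "\<And>F f B. (\<And>n. F n \<in> borel_measurable M) \<Longrightarrow> f \<in> borel_measurable M \<Longrightarrow>
      (\<And>n x. x \<in> space M \<Longrightarrow> cmod (F n x) \<le> B) \<Longrightarrow>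
      (\<And>x. x \<in> space M \<Longrightarrow> (\<lambda>n::nat. F n x) \<longlonglongrightarrow> f x) \<Longrightarrow> (\<lambda>n. L (F n)) \<longlonglongrightarrow> L f"
  shows "sigma_functional M L"
  unfolding sigma_functional_def
proof (intro conjI ballI allI impI)
  fix F f B
  assume "\<forall>n. F n \<in> borel_measurable M" "f \<in> borel_measurable M"
    "\<forall>n. \<forall>x\<in>space M. cmod (F n x) \<le> B" "\<forall>x\<in>space M. (\<lambda>n::nat. F n x) \<longlonglongrightarrow> f x"
  then show "(\<lambda>n. L (F n)) \<longlonglongrightarrow> L f"
    by (intro assms(3)[of F f B]) simp_all
qed (simp_all add: assms(1,2))

lemma sigma_functional_tendsto:
  assumes "sigma_functional M L" "\<And>n. F n \<in> borel_measurable M" "f \<in> borel_measurable M"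
    "\<And>n x. x \<in> space M \<Longrightarrow> cmod (F n x) \<le> B" "\<And>x. x \<in> space M \<Longrightarrow> (\<lambda>n::nat. F n x) \<longlonglongrightarrow> f x"
  shows "(\<lambda>n. L (F n)) \<longlonglongrightarrow> L f"
proof -
  from assms(1) have "\<forall>F f B. (\<forall>n. F n \<in> borel_measurable M) \<longrightarrow> f \<in> borel_measurable M \<longrightarrow>
        (\<forall>n. \<forall>x\<in>space M. cmod (F n x) \<le> B) \<longrightarrow>
        (\<forall>x\<in>space M. (\<lambda>n::nat. F n x) \<longlonglongrightarrow> f x) \<longrightarrow> (\<lambda>n. L (F n)) \<longlonglongrightarrow> L f"
    unfolding sigma_functional_def by (elim conjE)
  from this[rule_format, of F f B] assms(2-) show ?thesis by blast
qed

lemma bounded_measurableI: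
  "f \<in> borel_measurable M \<Longrightarrow> (\<And>x. x \<in> space M \<Longrightarrow> cmod (f x) \<le> B) \<Longrightarrow> f \<in> bounded_measurable M"
  by (auto simp: bounded_measurable_def)

lemma bounded_measurableE:
  assumes "f \<in> bounded_measurable M"
  obtains B where "\<And>x. x \<in> space M \<Longrightarrow> cmod (f x) \<le> B" "f \<in> borel_measurable M"
  using assms unfolding bounded_measurable_def by blast

lemma bounded_measurable_measurable [measurable_dest]:
  "f \<in> bounded_measurable M \<Longrightarrow> f \<in> borel_measurable M"
  by (simp add: bounded_measurable_def)

lemma bounded_measurable_add:
  assumes "f \<in> bounded_measurable M" "g \<in> bounded_measurable M"
  shows "(\<lambda>x. f x + g x) \<in> bounded_measurable M"
proof -
  obtain B C where "\<forall>x\<in>space M. cmod (f x) \<le> B" "\<forall>x\<in>space M. cmod (g x) \<le> C"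
    using assms by (auto simp: bounded_measurable_def)
  then have "\<And>x. x \<in> space M \<Longrightarrow> cmod (f x + g x) \<le> B + C"
    by (meson add_mono norm_triangle_le)
  then show ?thesis
    using assms by (auto intro!: bounded_measurableI simp: bounded_measurable_def)
qed

lemma bounded_measurable_mult:
  assumes "f \<in> bounded_measurable M" "g \<in> bounded_measurable M"
  shows "(\<lambda>x. f x * g x) \<in> bounded_measurable M"
proof -
  obtain B C where B: "\<forall>x\<in>space M. cmod (f x) \<le> B" and "\<forall>x\<in>space M. cmod (g x) \<le> C"
    using assms by (auto simp: bounded_measurable_def)
  then have "\<And>x. x \<in> space M \<Longrightarrow> cmod (f x * g x) \<le> \<bar>B\<bar> * \<bar>C\<bar>"
    unfolding norm_mult by (intro mult_mono) force+
  then show ?thesis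
    using assms by (auto intro!: bounded_measurableI simp: bounded_measurable_def)
qed

lemma bounded_measurable_const [simp, intro]: "(\<lambda>_. c) \<in> bounded_measurable M"
  by (rule bounded_measurableI[of _ _ "cmod c"]) auto

lemma bounded_measurable_cmult:
  "f \<in> bounded_measurable M \<Longrightarrow> (\<lambda>x. c * f x) \<in> bounded_measurable M"
  by (rule bounded_measurable_mult[OF bounded_measurable_const])

lemma bounded_measurable_diff:
  "f \<in> bounded_measurable M \<Longrightarrow> g \<in> bounded_measurable M \<Longrightarrow> (\<lambda>x. f x - g x) \<in> bounded_measurable M"
  using bounded_measurable_add[OF _ bounded_measurable_cmult[of g M "-1"], of f] by simp

lemma bounded_measurable_indicator [simp, intro]:
  "E \<in> sets M \<Longrightarrow> indicator E \<in> bounded_measurable M"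
  by (rule bounded_measurableI[of _ _ 1]) (auto simp: indicator_def)

lemma bounded_measurable_sum:
  assumes "\<And>i. i \<in> I \<Longrightarrow> f i \<in> bounded_measurable M"
  shows "(\<lambda>x. \<Sum>i\<in>I. f i x) \<in> bounded_measurable M"
  using assms by (induction I rule: infinite_finite_induct) (auto intro!: bounded_measurable_add)

context
  fixes M :: "'a measure" and L
  assumes L: "sigma_functional M L"
begin

lemma sigma_functional_add:
  "f \<in> bounded_measurable M \<Longrightarrow> g \<in> bounded_measurable M \<Longrightarrow> L (\<lambda>x. f x + g x) = L f + L g"
  using L by (auto simp: sigma_functional_def)

lemma sigma_functional_cmult:
  "f \<in> bounded_measurable M \<Longrightarrow> L (\<lambda>x. c * f x) = c * L f"
  using L by (auto simp: sigma_functional_def)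

lemma sigma_functional_0: "L (\<lambda>x. 0) = 0"
  using sigma_functional_cmult[of "\<lambda>_. 0" 0] by simp

lemma sigma_functional_diff:
  "f \<in> bounded_measurable M \<Longrightarrow> g \<in> bounded_measurable M \<Longrightarrow> L (\<lambda>x. f x - g x) = L f - L g"
  using sigma_functional_add[OF _ bounded_measurable_cmult[of g M "-1"], of f]
    sigma_functional_cmult[of g "-1"] by simp

lemma sigma_functional_sum:
  assumes "\<And>i. i \<in> I \<Longrightarrow> f i \<in> bounded_measurable M"
  shows "L (\<lambda>x. \<Sum>i\<in>I. f i x) = (\<Sum>i\<in>I. L (f i))"
  using assms
  by (induction I rule: infinite_finite_induct)
    (auto simp: sigma_functional_0 sigma_functional_add bounded_measurable_sum)

lemma sigma_functional_cong:
  assumes f: "f \<in> bounded_measurable M" and eq: "\<And>x. x \<in> space M \<Longrightarrow> f x = g x"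
  shows "L f = L g"
proof -
  obtain B where B: "\<And>x. x \<in> space M \<Longrightarrow> cmod (f x) \<le> B" and m: "f \<in> borel_measurable M"
    using f by (rule bounded_measurableE) (rule that)
  have g: "g \<in> borel_measurable M"
    using m eq by (simp cong: measurable_cong)
  have "(\<lambda>n::nat. L f) \<longlonglongrightarrow> L g"
  proof (rule sigma_functional_tendsto[OF L])
    show "(\<lambda>n::nat. f x) \<longlonglongrightarrow> g x" if "x \<in> space M" for x
      using eq[OF that] by simp
  qed (use m g B in blast)+
  then show ?thesis by (simp add: LIMSEQ_const_iff)
qed

lemma sigma_functional_complex_measure:
  assumes "\<And>E. E \<in> sets M \<Longrightarrow> \<mu> E = L (indicator E)" "\<And>E. E \<notin> sets M \<Longrightarrow> \<mu> E = 0"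
  shows "complex_measure M \<mu>"
  unfolding complex_measure_def
proof (intro conjI allI impI)
  fix A :: "nat \<Rightarrow> 'a set" assume A: "range A \<subseteq> sets M" "disjoint_family A"
  then have [measurable]: "A i \<in> sets M" for i by auto
  have sum_ind: "(\<Sum>i<n. indicator (A i) x) = (indicator (\<Union>i<n. A i) x :: complex)" for n x
    by (rule indicator_UN_disjoint[symmetric])
      (use A in \<open>auto simp: disjoint_family_on_def\<close>)
  have "(\<lambda>n. L (indicator (\<Union>i<n. A i))) \<longlonglongrightarrow> L (indicator (\<Union>i. A i))"
  proof (rule sigma_functional_tendsto[OF L, where B=1])
    show "(\<lambda>n. indicator (\<Union>i<n. A i) x :: complex) \<longlonglongrightarrow> indicator (\<Union>i. A i) x" for x
      by (rule LIMSEQ_indicator_UN)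
  qed (auto simp: indicator_def)
  moreover have "L (indicator (\<Union>i<n. A i)) = (\<Sum>i<n. \<mu> (A i))" for n
  proof -
    have "L (indicator (\<Union>i<n. A i)) = L (\<lambda>x. \<Sum>i<n. indicator (A i) x)"
      by (rule sigma_functional_cong) (auto simp: sum_ind)
    also have "\<dots> = (\<Sum>i<n. L (indicator (A i)))"
      by (rule sigma_functional_sum) auto
    finally show ?thesis using assms by simp
  qed
  ultimately show "(\<lambda>n. \<mu> (A n)) sums \<mu> (\<Union>n. A n)"
    using assms A by (simp add: sums_def)
qed (use assms in auto)

end

text \<open>A bounded measurable function is a bounded pointwise limit of simple functions.\<close>

lemma sigma_functional_unique:
  assumes L: "sigma_functional M L" and L': "sigma_functional M L'"
    and eq: "\<And>E. E \<in> sets M \<Longrightarrow> L (indicator E) = L' (indicator E)"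
    and f: "f \<in> bounded_measurable M"
  shows "L f = L' f"
proof -
  obtain B where B: "\<And>x. x \<in> space M \<Longrightarrow> cmod (f x) \<le> B" and m: "f \<in> borel_measurable M"
    using f by (rule bounded_measurableE) (rule that)
  obtain F where F: "\<And>i. simple_function M (F i)" "\<And>x. x \<in> space M \<Longrightarrow> (\<lambda>i. F i x) \<longlonglongrightarrow> f x"
      "\<And>i x. x \<in> space M \<Longrightarrow> cmod (F i x) \<le> 2 * cmod (f x)"
    using borel_measurable_implies_sequence_metric[OF m, of 0] unfolding dist_0_norm dist_norm diff_0_right by blast
  have Fm: "F i \<in> borel_measurable M" for i
    using F(1) by (rule borel_measurable_simple_function)
  have FB: "cmod (F i x) \<le> 2 * B" if "x \<in> space M" for i x
    using F(3)[OF that, of i] B[OF that] by linarith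
  have simple: "L g = (\<Sum>y\<in>g ` space M. y * L (indicator (g -` {y} \<inter> space M)))"
    if L: "sigma_functional M L" and g: "simple_function M g" "g \<in> bounded_measurable M"
    for g :: "'a \<Rightarrow> complex" and L
  proof -
    have s: "g -` {y} \<inter> space M \<in> sets M" for y
      using g(1) by (rule simple_functionD)
    have "L g = L (\<lambda>x. \<Sum>y\<in>g ` space M. y * indicator (g -` {y} \<inter> space M) x)"
    proof (rule sigma_functional_cong[OF L g(2)])
      fix x assume "x \<in> space M"
      from simple_function_indicator_representation_banach[OF g(1) this]
      show "g x = (\<Sum>y\<in>g ` space M. y * indicator (g -` {y} \<inter> space M) x)"
        by (simp add: scaleR_conv_of_real indicator_def mult.commute of_bool_def if_distrib[of complex_of_real] cong: if_cong)
    qed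
    also have "\<dots> = (\<Sum>y\<in>g ` space M. L (\<lambda>x. y * indicator (g -` {y} \<inter> space M) x))"
      by (rule sigma_functional_sum[OF L])
        (auto intro!: bounded_measurable_cmult bounded_measurable_indicator s)
    also have "\<dots> = (\<Sum>y\<in>g ` space M. y * L (indicator (g -` {y} \<inter> space M)))"
      by (intro sum.cong refl sigma_functional_cmult[OF L] bounded_measurable_indicator s)
    finally show ?thesis .
  qed
  have "L (F i) = L' (F i)" for i
  proof -
    have b: "F i \<in> bounded_measurable M"
      using Fm FB by (rule bounded_measurableI)
    show ?thesis
      using simple[OF L F(1) b] simple[OF L' F(1) b] eq[OF simple_functionD(2)[OF F(1)]]
      by simp
  qed
  moreover have "(\<lambda>i. L (F i)) \<longlonglongrightarrow> L f" "(\<lambda>i. L' (F i)) \<longlonglongrightarrow> L' f"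
    by (rule sigma_functional_tendsto[OF L Fm m FB F(2)], assumption+,
        rule sigma_functional_tendsto[OF L' Fm m FB F(2)], assumption+)
  ultimately show ?thesis
    by (simp add: LIMSEQ_unique)
qed

text \<open>This is the functional of the image under \<open>T\<close> of the complex measure with density \<open>h\<close>.\<close>

lemma sigma_functional_weighted_integral:
  fixes h :: "'b \<Rightarrow> complex"
  assumes h: "integrable P h" and T [measurable]: "T \<in> P \<rightarrow>\<^sub>M M"
  shows "sigma_functional M (\<lambda>f. \<integral>w. h w * f (T w) \<partial>P)"
proof -
  have sp: "T w \<in> space M" if "w \<in> space P" for w
    using T that by (rule measurable_space)
  have [measurable]: "h \<in> borel_measurable P" using h by simp
  have int: "integrable P (\<lambda>w. h w * f (T w))" if f: "f \<in> bounded_measurable M" for f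
  proof -
    obtain B where B: "\<And>x. x \<in> space M \<Longrightarrow> cmod (f x) \<le> B" and [measurable]: "f \<in> borel_measurable M"
      using f by (rule bounded_measurableE) (rule that)
    have "cmod (f (T w)) \<le> \<bar>B\<bar>" if "w \<in> space P" for w
      using B[OF sp[OF that]] by linarith
    then have le: "cmod (h w * f (T w)) \<le> cmod (h w * complex_of_real B)" if "w \<in> space P" for w
      unfolding norm_mult norm_of_real using that by (intro mult_left_mono) simp_all
    show ?thesis
    proof (rule Bochner_Integration.integrable_bound)
      show "integrable P (\<lambda>w. h w * complex_of_real B)"
        by (intro integrable_mult_left h)
      show "AE w in P. cmod (h w * f (T w)) \<le> cmod (h w * complex_of_real B)"
        by (rule AE_I2) (rule le)
    qed measurable
  qed
  show ?thesis
    unfolding sigma_functional_def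
  proof (intro conjI ballI allI impI)
    fix F f B
    assume F: "\<forall>n. F n \<in> borel_measurable M" and [measurable]: "f \<in> borel_measurable M"
      and B: "\<forall>n. \<forall>x\<in>space M. cmod (F n x) \<le> B" and lim: "\<forall>x\<in>space M. (\<lambda>n::nat. F n x) \<longlonglongrightarrow> f x"
    have [measurable]: "F n \<in> borel_measurable M" for n using F by blast
    show "(\<lambda>n. \<integral>w. h w * F n (T w) \<partial>P) \<longlonglongrightarrow> (\<integral>w. h w * f (T w) \<partial>P)"
    proof (rule integral_dominated_convergence[where w="\<lambda>w. cmod (h w) * B"])
      show "integrable P (\<lambda>w. cmod (h w) * B)"
        by (intro integrable_mult_left integrable_norm h)
      show "(\<lambda>w. h w * f (T w)) \<in> borel_measurable P" "(\<lambda>w. h w * F n (T w)) \<in> borel_measurable P" for n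
        by measurable
      show "AE w in P. (\<lambda>n. h w * F n (T w)) \<longlonglongrightarrow> h w * f (T w)"
        using lim sp by (intro AE_I2 tendsto_mult_left) blast
      show "AE w in P. cmod (h w * F n (T w)) \<le> cmod (h w) * B" for n
        unfolding norm_mult using B sp by (intro AE_I2 mult_left_mono) auto
    qed
  next
    fix f c assume f: "f \<in> bounded_measurable M"
    show "(\<integral>w. h w * (c * f (T w)) \<partial>P) = c * (\<integral>w. h w * f (T w) \<partial>P)"
      unfolding mult.left_commute[of "h _" c] by (rule integral_mult_right_zero)
  next
    fix f g assume "f \<in> bounded_measurable M" "g \<in> bounded_measurable M"
    then show "(\<integral>w. h w * (f (T w) + g (T w)) \<partial>P) = (\<integral>w. h w * f (T w) \<partial>P) + (\<integral>w. h w * g (T w) \<partial>P)"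
      unfolding distrib_left by (intro Bochner_Integration.integral_add int)
  qed
qed

lemma sigma_functional_scale:
  assumes L: "sigma_functional M L"
  shows "sigma_functional M (\<lambda>f. c * L f)"
proof (rule sigma_functionalI)
  show "(\<lambda>n. c * L (F n)) \<longlonglongrightarrow> c * L f"
    if "\<And>n. F n \<in> borel_measurable M" "f \<in> borel_measurable M"
      "\<And>n x. x \<in> space M \<Longrightarrow> cmod (F n x) \<le> B" "\<And>x. x \<in> space M \<Longrightarrow> (\<lambda>n::nat. F n x) \<longlonglongrightarrow> f x"
    for F f B
    using sigma_functional_tendsto[OF L that] by (rule tendsto_mult_left)
qed (simp_all add: sigma_functional_add[OF L] sigma_functional_cmult[OF L] distrib_left)

lemma sigma_functional_plus:
  assumes L: "sigma_functional M L" and L': "sigma_functional M L'"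
  shows "sigma_functional M (\<lambda>f. L f + L' f)"
proof (rule sigma_functionalI)
  show "(\<lambda>n. L (F n) + L' (F n)) \<longlonglongrightarrow> L f + L' f"
    if "\<And>n. F n \<in> borel_measurable M" "f \<in> borel_measurable M"
      "\<And>n x. x \<in> space M \<Longrightarrow> cmod (F n x) \<le> B" "\<And>x. x \<in> space M \<Longrightarrow> (\<lambda>n::nat. F n x) \<longlonglongrightarrow> f x"
    for F f B
    using sigma_functional_tendsto[OF L that] sigma_functional_tendsto[OF L' that] by (rule tendsto_add)
qed (simp_all add: sigma_functional_add[OF L] sigma_functional_cmult[OF L]
  sigma_functional_add[OF L'] sigma_functional_cmult[OF L'] distrib_left)

lemma sigma_functional_zero: "sigma_functional M (\<lambda>f. 0)"
  unfolding sigma_functional_def by auto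

lemma sigma_functional_Sum:
  assumes "\<And>i. i \<in> I \<Longrightarrow> sigma_functional M (L i)"
  shows "sigma_functional M (\<lambda>f. \<Sum>i\<in>I. L i f)"
  using assms
  by (induction I rule: infinite_finite_induct)
    (auto simp: sigma_functional_zero intro!: sigma_functional_plus)

lemma sigma_functional_eval:
  assumes "x \<in> space M"
  shows "sigma_functional M (\<lambda>f. f x)"
  unfolding sigma_functional_def using assms by auto

section \<open>Jordan decomposition\<close>

locale signed_measure =
  fixes M :: "'a measure" and \<nu> :: "'a set \<Rightarrow> real"
  assumes sums: "range A \<subseteq> sets M \<Longrightarrow> disjoint_family A \<Longrightarrow> (\<lambda>n::nat. \<nu> (A n)) sums \<nu> (\<Union>n. A n)"
begin

lemma empty: "\<nu> {} = 0"
proof -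
  have "(\<lambda>n::nat. \<nu> {}) sums \<nu> {}"
    using sums[of "\<lambda>_. {}"] by (simp add: disjoint_family_on_def)
  then have "(\<lambda>n::nat. \<nu> {}) \<longlonglongrightarrow> 0"
    by (intro summable_LIMSEQ_zero sums_summable)
  then show ?thesis by (simp add: LIMSEQ_const_iff)
qed

lemma Un:
  assumes "E \<in> sets M" "F \<in> sets M" "E \<inter> F = {}"
  shows "\<nu> (E \<union> F) = \<nu> E + \<nu> F"
proof -
  have "range (binaryset E F) \<subseteq> sets M" "disjoint_family (binaryset E F)"
    using assms by (auto simp: binaryset_def disjoint_family_on_def)
  from sums[OF this] have "(\<lambda>n. \<nu> (binaryset E F n)) sums \<nu> (E \<union> F)"
    by (simp add: UN_binaryset_eq)
  moreover have "(\<lambda>n. \<nu> (binaryset E F n)) sums (\<nu> E + \<nu> F)"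
    by (rule binaryset_sums) (rule empty)
  ultimately show ?thesis by (rule sums_unique2)
qed

lemma Diff:
  assumes "E \<in> sets M" "F \<in> sets M" "F \<subseteq> E"
  shows "\<nu> (E - F) = \<nu> E - \<nu> F"
proof -
  have "\<nu> (F \<union> (E - F)) = \<nu> F + \<nu> (E - F)"
    using assms by (intro Un) auto
  moreover have "F \<union> (E - F) = E" using assms by auto
  ultimately show ?thesis by simp
qed

definition pos :: "'a set \<Rightarrow> ennreal" where
  "pos E = (SUP F \<in> {F \<in> sets M. F \<subseteq> E}. ennreal (\<nu> F))"

lemma pos_upper: "F \<in> sets M \<Longrightarrow> F \<subseteq> E \<Longrightarrow> ennreal (\<nu> F) \<le> pos E"
  unfolding pos_def by (rule SUP_upper) auto

lemma pos_Un:
  assumes A: "A \<in> sets M" and B: "B \<in> sets M" and d: "A \<inter> B = {}"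
  shows "pos A + pos B \<le> pos (A \<union> B)"
proof -
  have *: "ennreal (\<nu> F) + ennreal (\<nu> G) \<le> pos (A \<union> B)"
    if FG: "F \<in> sets M" "F \<subseteq> A" "G \<in> sets M" "G \<subseteq> B" for F G
  proof -
    have "\<nu> (F \<union> G) = \<nu> F + \<nu> G"
      using FG d by (intro Un) auto
    then show ?thesis
      using FG pos_upper[of "F \<union> G" "A \<union> B"] pos_upper[of F "A \<union> B"] pos_upper[of G "A \<union> B"]
      by (cases "\<nu> F \<ge> 0"; cases "\<nu> G \<ge> 0")
        (auto simp: ennreal_plus[symmetric] ennreal_neg le_supI1 le_supI2 simp del: ennreal_plus)
  qed
  have "ennreal (\<nu> F) + pos B \<le> pos (A \<union> B)" if F: "F \<in> sets M" "F \<subseteq> A" for F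
    unfolding pos_def[of B]
    by (subst ennreal_SUP_add_right)
      (use * F in \<open>auto intro!: SUP_least\<close>)
  then show ?thesis
    unfolding pos_def[of A]
    by (subst ennreal_SUP_add_left[symmetric]) (auto intro!: SUP_least)
qed

lemma pos_countably_additive: "countably_additive (sets M) pos"
proof (rule countably_additiveI)
  fix A :: "nat \<Rightarrow> 'a set"
  assume A: "range A \<subseteq> sets M" "disjoint_family A" and UA: "\<Union> (range A) \<in> sets M"
  show "(\<Sum>i. pos (A i)) = pos (\<Union>i. A i)"
  proof (rule antisym)
    have fin: "(\<Sum>i<n. pos (A i)) \<le> pos (\<Union>i<n. A i)" for n
    proof (induction n)
      case (Suc n)
      have "(\<Sum>i<Suc n. pos (A i)) \<le> pos (\<Union>i<n. A i) + pos (A n)"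
        using Suc by (simp add: add_right_mono)
      also have "\<dots> \<le> pos ((\<Union>i<n. A i) \<union> A n)"
      proof (rule pos_Un)
        show "(\<Union>i<n. A i) \<in> sets M" "A n \<in> sets M" using A by auto
        show "(\<Union>i<n. A i) \<inter> A n = {}"
        proof -
          have "A i \<inter> A n = {}" if "i < n" for i
            using that by (intro disjoint_family_onD[OF A(2)]) auto
          then show ?thesis by blast
        qed
      qed
      also have "(\<Union>i<n. A i) \<union> A n = (\<Union>i<Suc n. A i)"
        by (auto simp: less_Suc_eq)
      finally show ?case .
    qed simp
    have "pos (\<Union>i<n. A i) \<le> pos (\<Union>i. A i)" for n
      unfolding pos_def by (rule SUP_subset_mono) auto
    with fin have "(\<Sum>i<n. pos (A i)) \<le> pos (\<Union>i. A i)" for n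
      by (rule order_trans)
    then show "(\<Sum>i. pos (A i)) \<le> pos (\<Union>i. A i)"
      by (rule suminf_le_const[OF summableI])
    show "pos (\<Union>i. A i) \<le> (\<Sum>i. pos (A i))"
      unfolding pos_def[of "\<Union>i. A i"]
    proof (rule SUP_least)
      fix F assume "F \<in> {F \<in> sets M. F \<subseteq> (\<Union>i. A i)}"
      then have F: "F \<in> sets M" "F \<subseteq> (\<Union>i. A i)" by auto
      have eq: "(\<Union>i. F \<inter> A i) = F" using F by auto
      have "(\<lambda>i. \<nu> (F \<inter> A i)) sums \<nu> (\<Union>i. F \<inter> A i)"
      proof (rule sums)
        show "range (\<lambda>i. F \<inter> A i) \<subseteq> sets M" using A F by auto
        show "disjoint_family (\<lambda>i. F \<inter> A i)"
          by (rule disjoint_family_on_bisimulation[OF A(2)]) auto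
      qed
      then have s: "(\<lambda>n. \<Sum>i<n. \<nu> (F \<inter> A i)) \<longlonglongrightarrow> \<nu> F"
        unfolding eq sums_def .
      have "ennreal (\<Sum>i<n. \<nu> (F \<inter> A i)) \<le> (\<Sum>i. pos (A i))" for n
      proof -
        have "ennreal (\<Sum>i<n. \<nu> (F \<inter> A i)) \<le> ennreal (\<Sum>i<n. max 0 (\<nu> (F \<inter> A i)))"
          by (intro ennreal_leI sum_mono) simp
        also have "\<dots> = (\<Sum>i<n. ennreal (\<nu> (F \<inter> A i)))"
          by (subst sum_ennreal[symmetric], simp, rule sum.cong) (simp_all add: max_def ennreal_neg del: sum_ennreal)
        also have "\<dots> \<le> (\<Sum>i<n. pos (A i))"
          using A F by (intro sum_mono pos_upper) auto
        also have "\<dots> \<le> (\<Sum>i. pos (A i))"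
          by (rule sum_le_suminf) auto
        finally show ?thesis .
      qed
      then show "ennreal (\<nu> F) \<le> (\<Sum>i. pos (A i))"
        by (intro LIMSEQ_le_const2[OF tendsto_ennrealI[OF s]]) blast
    qed
  qed
qed

lemma sets_jordan_pos [simp]: "sets (jordan_pos M \<nu>) = sets M"
  and space_jordan_pos [simp]: "space (jordan_pos M \<nu>) = space M"
  by (simp_all add: jordan_pos_def)

lemma emeasure_jordan_pos: "E \<in> sets M \<Longrightarrow> emeasure (jordan_pos M \<nu>) E = pos E"
  unfolding jordan_pos_def pos_def[symmetric]
proof (subst emeasure_measure_of_sigma)
  show "positive (sets M) pos"
    using pos_upper by (auto simp: positive_def pos_def empty)
qed (auto intro: sets.sigma_algebra_axioms pos_countably_additive)

text \<open>If \<open>\<nu>\<close> were unbounded above on the subsets of \<open>E\<close>, then \<open>E\<close> could be split into two parts on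
  both of which \<open>\<bar>\<nu>\<bar> \<ge> 1\<close>, with \<open>\<nu>\<close> again unbounded above on the subsets of one of them. Iterating
  gives disjoint sets whose \<open>\<nu>\<close>-values do not tend to \<open>0\<close>.\<close>

lemma pos_finite: "pos (space M) < \<infinity>"
proof (rule ccontr)
  assume inf: "\<not> pos (space M) < \<infinity>"
  define bad where "bad E \<longleftrightarrow> E \<in> sets M \<and> pos E = \<infinity>" for E
  have step: "\<exists>E'. bad E' \<and> E' \<subseteq> E \<and> \<bar>\<nu> (E - E')\<bar> \<ge> 1" if "bad E" for E
  proof -
    have E: "E \<in> sets M" "pos E = \<infinity>" using that by (auto simp: bad_def)
    have "ennreal (1 + \<bar>\<nu> E\<bar>) < pos E" using E by simp
    then obtain F where F: "F \<in> sets M" "F \<subseteq> E" "ennreal (1 + \<bar>\<nu> E\<bar>) < ennreal (\<nu> F)"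
      unfolding pos_def less_SUP_iff by auto
    then have ge: "1 + \<bar>\<nu> E\<bar> < \<nu> F" by (subst (asm) ennreal_less_iff) auto
    have "emeasure (jordan_pos M \<nu>) F + emeasure (jordan_pos M \<nu>) (E - F) =
        emeasure (jordan_pos M \<nu>) (F \<union> (E - F))"
      using E F by (intro plus_emeasure) auto
    moreover have "F \<union> (E - F) = E" using F by auto
    ultimately have "pos F + pos (E - F) = pos E"
      using E F by (simp add: emeasure_jordan_pos)
    then have "pos F = \<infinity> \<or> pos (E - F) = \<infinity>"
      using E by (auto simp: ennreal_add_eq_top)
    moreover have "E - (E - F) = F" using F by auto
    ultimately show ?thesis
      using E F ge Diff[of E F] unfolding bad_def
      by (elim disjE) (rule exI[of _ F], force, rule exI[of _ "E - F"], force)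
  qed
  have "bad (space M)" using inf by (simp add: bad_def less_top[symmetric])
  then obtain E where E: "\<And>n. bad (E n)" "\<And>n. E (Suc n) \<subseteq> E n \<and> \<bar>\<nu> (E n - E (Suc n))\<bar> \<ge> 1"
    using dependent_nat_choice[of "\<lambda>n. bad" "\<lambda>n E E'. E' \<subseteq> E \<and> \<bar>\<nu> (E - E')\<bar> \<ge> 1"] step by metis
  have "decseq E" using E by (intro decseq_SucI) auto
  have "disjoint_family (\<lambda>n. E n - E (Suc n))"
    unfolding disjoint_family_on_def
  proof (intro ballI impI)
    have "(E m - E (Suc m)) \<inter> (E n - E (Suc n)) = {}" if "m < n" for m n
      using decseqD[OF \<open>decseq E\<close>, of "Suc m" n] that by auto
    then show "(E m - E (Suc m)) \<inter> (E n - E (Suc n)) = {}" if "m \<noteq> n" for m n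
      using that by (metis Int_commute linorder_neqE_nat)
  qed
  moreover have "range (\<lambda>n. E n - E (Suc n)) \<subseteq> sets M"
    using E by (auto simp: bad_def)
  ultimately have "(\<lambda>n. \<nu> (E n - E (Suc n))) \<longlonglongrightarrow> 0"
    using sums by (intro summable_LIMSEQ_zero sums_summable) blast
  then have "\<forall>\<^sub>F n in sequentially. \<bar>\<nu> (E n - E (Suc n))\<bar> < 1"
    using order_tendstoD(2)[OF tendsto_rabs_zero, of _ _ 1] by force
  then show False
    using E(2) by (auto simp: eventually_sequentially not_less) (metis le_refl not_less)
qed

lemma finite_measure_jordan_pos: "finite_measure (jordan_pos M \<nu>)"
  using pos_finite by (intro finite_measureI) (auto simp: emeasure_jordan_pos)

lemma neg: "signed_measure M (\<lambda>E. - \<nu> E)"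
  using sums by unfold_locales (auto intro: sums_minus)

end

text \<open>
  The complement in \<open>E\<close> of a set with large \<open>\<nu>\<close> has small \<open>\<nu>\<close>. So the suprema of \<open>\<nu>\<close> and of \<open>- \<nu>\<close> over
  the measurable subsets of \<open>E\<close> differ by exactly \<open>\<nu>(E)\<close>; both are finite.
\<close>

lemma (in signed_measure) jordan_decomposition:
  assumes E: "E \<in> sets M"
  shows "\<nu> E = measure (jordan_pos M \<nu>) E - measure (jordan_pos M (\<lambda>E. - \<nu> E)) E"
proof -
  interpret N: signed_measure M "\<lambda>E. - \<nu> E" by (rule neg)
  interpret P: finite_measure "jordan_pos M \<nu>" by (rule finite_measure_jordan_pos)
  interpret Q: finite_measure "jordan_pos M (\<lambda>E. - \<nu> E)" by (rule N.finite_measure_jordan_pos)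
  let ?p = "measure (jordan_pos M \<nu>) E" and ?n = "measure (jordan_pos M (\<lambda>E. - \<nu> E)) E"
  have p: "pos E = ennreal ?p" and n: "N.pos E = ennreal ?n"
    using E by (auto simp: emeasure_jordan_pos[symmetric] N.emeasure_jordan_pos[symmetric]
        P.emeasure_eq_measure Q.emeasure_eq_measure)
  have up: "\<nu> F \<le> ?p" and un: "- \<nu> F \<le> ?n" if "F \<in> sets M" "F \<subseteq> E" for F
    using pos_upper[OF that] N.pos_upper[OF that] by (simp_all add: p n)
  have "ennreal ?p \<le> ennreal (\<nu> E + ?n)"
    unfolding p[symmetric] pos_def
  proof (rule SUP_least)
    fix F assume "F \<in> {F \<in> sets M. F \<subseteq> E}"
    then have "F \<in> sets M" "F \<subseteq> E" by auto
    then show "ennreal (\<nu> F) \<le> ennreal (\<nu> E + ?n)"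
      using un[of "E - F"] Diff[OF E] E by (intro ennreal_leI) auto
  qed
  moreover have "ennreal ?n \<le> ennreal (?p - \<nu> E)"
    unfolding n[symmetric] N.pos_def
  proof (rule SUP_least)
    fix F assume "F \<in> {F \<in> sets M. F \<subseteq> E}"
    then have "F \<in> sets M" "F \<subseteq> E" by auto
    then show "ennreal (- \<nu> F) \<le> ennreal (?p - \<nu> E)"
      using up[of "E - F"] Diff[OF E] E by (intro ennreal_leI) auto
  qed
  moreover have "0 \<le> \<nu> E + ?n" "0 \<le> ?p - \<nu> E"
    using up[of E] un[of E] E by auto
  ultimately show ?thesis
    by (simp add: ennreal_le_iff)
qed

section \<open>The integral as a functional of the integrand\<close>

lemma signed_measure_ReIm:
  assumes "complex_measure M \<mu>"
  shows "signed_measure M (\<lambda>E. Re (\<mu> E))" "signed_measure M (\<lambda>E. Im (\<mu> E))"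
  using assms by (auto simp: complex_measure_def signed_measure_def intro: sums_Re sums_Im)

lemma cm_integral_decomposition:
  assumes "complex_measure M \<mu>"
  obtains N c where "\<And>k. finite_measure (N k)" "\<And>k. sets (N k) = sets M"
    "\<And>f. cm_integral M \<mu> f = (\<Sum>k<4::nat. c k * (integral\<^sup>L (N k) f :: complex))"
    "\<And>E. E \<in> sets M \<Longrightarrow> \<mu> E = (\<Sum>k<4. c k * measure (N k) E)" "\<And>k. cmod (c k) = 1"
proof
  interpret R: signed_measure M "\<lambda>E. Re (\<mu> E)" using assms by (rule signed_measure_ReIm)
  interpret I: signed_measure M "\<lambda>E. Im (\<mu> E)" using assms by (rule signed_measure_ReIm)
  let ?N = "\<lambda>k::nat. if k = 0 then jordan_pos M (\<lambda>E. Re (\<mu> E))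
    else if k = 1 then jordan_pos M (\<lambda>E. - Re (\<mu> E))
    else if k = 2 then jordan_pos M (\<lambda>E. Im (\<mu> E)) else jordan_pos M (\<lambda>E. - Im (\<mu> E))"
  let ?c = "\<lambda>k::nat. if k = 0 then 1 else if k = 1 then -1 else if k = 2 then \<i> else - \<i>"
  show "finite_measure (?N k)" for k
    using R.finite_measure_jordan_pos I.finite_measure_jordan_pos
      signed_measure.finite_measure_jordan_pos[OF R.neg]
      signed_measure.finite_measure_jordan_pos[OF I.neg] by auto
  show "sets (?N k) = sets M" for k
    by (simp add: jordan_pos_def)
  show "cm_integral M \<mu> f = (\<Sum>k<4::nat. ?c k * (integral\<^sup>L (?N k) f :: complex))" for f
    by (simp add: cm_integral_def eval_nat_numeral algebra_simps)
  show "\<mu> E = (\<Sum>k<4. ?c k * measure (?N k) E)" if "E \<in> sets M" for E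
    using R.jordan_decomposition[OF that] I.jordan_decomposition[OF that]
    by (intro complex_eqI) (simp_all add: eval_nat_numeral)
  show "cmod (?c k) = 1" for k by simp
qed

lemma sigma_functional_cm_integral:
  assumes "complex_measure M \<mu>"
  shows "sigma_functional M (cm_integral M \<mu>)"
proof -
  obtain N c where N: "\<And>k. finite_measure (N k)" "\<And>k. sets (N k) = sets M"
    "\<And>f. cm_integral M \<mu> f = (\<Sum>k<4::nat. c k * (integral\<^sup>L (N k) f :: complex))"
    using assms by (rule cm_integral_decomposition) (rule that)
  have "sigma_functional M (\<lambda>f. integral\<^sup>L (N k) f)" for k
    using sigma_functional_weighted_integral[of "N k" "\<lambda>_. 1" "\<lambda>x. x" M] N(1,2)
    by (simp add: finite_measure.integrable_const measurable_ident_sets)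
  then show ?thesis
    unfolding N(3)[abs_def] by (intro sigma_functional_Sum sigma_functional_scale)
qed

lemma cm_integral_indicator:
  assumes "complex_measure M \<mu>" "E \<in> sets M"
  shows "cm_integral M \<mu> (indicator E) = \<mu> E"
proof -
  obtain N c where N: "\<And>k. finite_measure (N k)" "\<And>k. sets (N k) = sets M"
    "\<And>f. cm_integral M \<mu> f = (\<Sum>k<4::nat. c k * (integral\<^sup>L (N k) f :: complex))"
    "\<And>E. E \<in> sets M \<Longrightarrow> \<mu> E = (\<Sum>k<4. c k * measure (N k) E)"
    using assms(1) by (rule cm_integral_decomposition) (rule that)
  have "integral\<^sup>L (N k) (indicator E) = complex_of_real (measure (N k) E)" for k
  proof -
    have "(\<integral>x. complex_of_real (indicator E x) \<partial>N k) = complex_of_real (\<integral>x. indicator E x \<partial>N k)"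
      by (rule integral_complex_of_real)
    moreover have "(\<integral>x. indicator E x \<partial>N k) = measure (N k) E"
      using N(2) assms(2) finite_measure.emeasure_finite[OF N(1)]
      by (subst Bochner_Integration.integral_indicator) (auto simp: sets.Int_space_eq2)
    moreover have "(\<lambda>x. complex_of_real (indicator E x)) = indicator E"
      by (auto simp: indicator_def)
    ultimately show ?thesis by simp
  qed
  then show ?thesis using N assms by simp
qed

text \<open>This identifies integrals against a measure that is only known on sets, such as a convolution.\<close>

lemma cm_integral_eqI:
  assumes "sigma_functional M L"
    and "\<And>E. E \<in> sets M \<Longrightarrow> \<mu> E = L (indicator E)" "\<And>E. E \<notin> sets M \<Longrightarrow> \<mu> E = 0"
    and "f \<in> bounded_measurable M"
  shows "cm_integral M \<mu> f = L f"
proof -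
  have \<mu>: "complex_measure M \<mu>"
    using assms(1-3) by (rule sigma_functional_complex_measure)
  show ?thesis
    by (rule sigma_functional_unique[OF sigma_functional_cm_integral[OF \<mu>] assms(1) _ assms(4)])
      (simp add: assms(2) cm_integral_indicator[OF \<mu>])
qed

text \<open>The inverse of the passage from a measure to its integral.\<close>

definition measure_of_functional :: "'a measure \<Rightarrow> (('a \<Rightarrow> complex) \<Rightarrow> complex) \<Rightarrow> 'a set \<Rightarrow> complex" where
  "measure_of_functional M L E = (if E \<in> sets M then L (indicator E) else 0)"

lemma
  assumes "sigma_functional M L"
  shows complex_measure_measure_of_functional: "complex_measure M (measure_of_functional M L)"
    and cm_integral_measure_of_functional:
      "f \<in> bounded_measurable M \<Longrightarrow> cm_integral M (measure_of_functional M L) f = L f"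
  using sigma_functional_complex_measure[OF assms, of "measure_of_functional M L"]
    cm_integral_eqI[OF assms, of "measure_of_functional M L"]
  by (auto simp: measure_of_functional_def)

lemma complex_measure_notin: "complex_measure M \<mu> \<Longrightarrow> E \<notin> sets M \<Longrightarrow> \<mu> E = 0"
  by (auto simp: complex_measure_def)

lemma
  assumes "\<And>i. i \<in> I \<Longrightarrow> complex_measure M (\<mu> i)"
  shows complex_measure_sum: "complex_measure M (\<lambda>E. \<Sum>i\<in>I. c i * \<mu> i E)"
    and cm_integral_sum: "f \<in> bounded_measurable M \<Longrightarrow>
      cm_integral M (\<lambda>E. \<Sum>i\<in>I. c i * \<mu> i E) f = (\<Sum>i\<in>I. c i * cm_integral M (\<mu> i) f)"
proof -
  have L: "sigma_functional M (\<lambda>f. \<Sum>i\<in>I. c i * cm_integral M (\<mu> i) f)"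
    using assms by (intro sigma_functional_Sum sigma_functional_scale sigma_functional_cm_integral)
  have eq: "(\<Sum>i\<in>I. c i * \<mu> i E) = (\<Sum>i\<in>I. c i * cm_integral M (\<mu> i) (indicator E))"
    if "E \<in> sets M" for E
    using that cm_integral_indicator[OF assms] by (intro sum.cong) auto
  have 0: "(\<Sum>i\<in>I. c i * \<mu> i E) = 0" if "E \<notin> sets M" for E
    using that complex_measure_notin[OF assms] by (intro sum.neutral) auto
  show "complex_measure M (\<lambda>E. \<Sum>i\<in>I. c i * \<mu> i E)"
    by (rule sigma_functional_complex_measure[OF L eq 0])
  show "cm_integral M (\<lambda>E. \<Sum>i\<in>I. c i * \<mu> i E) f = (\<Sum>i\<in>I. c i * cm_integral M (\<mu> i) f)"
    if "f \<in> bounded_measurable M"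
    by (rule cm_integral_eqI[OF L eq 0 that])
qed

text \<open>The constant is the sum of the masses of the four Jordan parts.\<close>

lemma cm_integral_bound:
  assumes "complex_measure M \<mu>"
  shows "\<exists>C\<ge>0. \<forall>f\<in>borel_measurable M. \<forall>B. (\<forall>x\<in>space M. cmod (f x) \<le> B) \<longrightarrow>
    cmod (cm_integral M \<mu> f) \<le> C * B"
proof -
  obtain N c where N: "\<And>k. finite_measure (N k)" "\<And>k. sets (N k) = sets M"
    "\<And>f. cm_integral M \<mu> f = (\<Sum>k<4::nat. c k * (integral\<^sup>L (N k) f :: complex))"
    "\<And>k. cmod (c k) = 1"
    using assms by (rule cm_integral_decomposition) (rule that)
  show ?thesis
  proof (rule exI[of _ "\<Sum>k<4. measure (N k) (space M)"], intro conjI ballI allI impI)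
    show "0 \<le> (\<Sum>k<4. measure (N k) (space M))" by (intro sum_nonneg) simp
    fix f B assume f: "f \<in> borel_measurable M" "\<forall>x\<in>space M. cmod (f x) \<le> B"
    have sp: "space (N k) = space M" for k by (rule sets_eq_imp_space_eq) (rule N(2))
    have "cmod (integral\<^sup>L (N k) f) \<le> measure (N k) (space M) * B" for k
    proof -
      interpret finite_measure "N k" by (rule N)
      have "cmod (integral\<^sup>L (N k) f) \<le> (\<integral>x. cmod (f x) \<partial>N k)" by simp
      also have "\<dots> \<le> (\<integral>x. B \<partial>N k)"
      proof (rule integral_mono)
        show "integrable (N k) (\<lambda>x. cmod (f x))"
          using f by (intro integrable_const_bound[of _ B] AE_I2)
            (auto simp: sp measurable_cong_sets[OF N(2) refl])
      qed (auto simp: sp f)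
      finally show ?thesis by (simp add: sp)
    qed
    then show "cmod (cm_integral M \<mu> f) \<le> (\<Sum>k<4. measure (N k) (space M)) * B"
      unfolding N(3) sum_distrib_right
      by (intro order_trans[OF norm_sum] sum_mono) (auto simp: norm_mult N(4))
  qed
qed

lemma cm_integral_swap:
  assumes \<mu>: "complex_measure M \<mu>" and H: "sigma_finite_measure H"
    and k [measurable]: "(\<lambda>(t, s). k t s) \<in> borel_measurable (M \<Otimes>\<^sub>M H)"
    and w: "integrable H w" and bound: "\<And>t s. t \<in> space M \<Longrightarrow> s \<in> space H \<Longrightarrow> cmod (k t s) \<le> w s"
  shows "cm_integral M \<mu> (\<lambda>t. \<integral>s. k t s \<partial>H) = (\<integral>s. cm_integral M \<mu> (\<lambda>t. k t s) \<partial>H)"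
proof -
  obtain N c where N: "\<And>k. finite_measure (N k)" "\<And>k. sets (N k) = sets M"
    "\<And>f. cm_integral M \<mu> f = (\<Sum>k<4::nat. c k * (integral\<^sup>L (N k) f :: complex))"
    using \<mu> by (rule cm_integral_decomposition) (rule that)
  have *: "(\<integral>t. (\<integral>s. k t s \<partial>H) \<partial>N i) = (\<integral>s. (\<integral>t. k t s \<partial>N i) \<partial>H)"
      "integrable H (\<lambda>s. \<integral>t. k t s \<partial>N i)" for i
  proof -
    interpret Ni: finite_measure "N i" by (rule N)
    interpret H: sigma_finite_measure H by (rule H)
    interpret pair_sigma_finite H "N i" by unfold_locales
    interpret Q: pair_sigma_finite "N i" H by unfold_locales
    have sp: "space (N i) = space M" by (rule sets_eq_imp_space_eq) (rule N(2))
    have [measurable_cong]: "sets (N i) = sets M" by (rule N)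
    have [measurable]: "w \<in> borel_measurable H" using w by simp
    have int: "integrable (H \<Otimes>\<^sub>M N i) (\<lambda>(s, t). k t s)"
    proof (rule Bochner_Integration.integrable_bound)
      have "integrable (N i \<Otimes>\<^sub>M H) (\<lambda>(t, s). w s * 1)"
        by (rule Q.Fubini_integrable) (use w in auto)
      then show "integrable (H \<Otimes>\<^sub>M N i) (\<lambda>(s, t). w s * 1)"
        by (simp add: Q.integrable_product_swap_iff[symmetric] split_beta)
      show "(\<lambda>(s, t). k t s) \<in> borel_measurable (H \<Otimes>\<^sub>M N i)"
        by measurable
      show "AE x in H \<Otimes>\<^sub>M N i. cmod (case x of (s, t) \<Rightarrow> k t s) \<le> norm (case x of (s, t) \<Rightarrow> w s * 1)"
        using bound by (intro AE_I2) (force simp: space_pair_measure sp intro: order_trans)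
    qed
    show "(\<integral>t. (\<integral>s. k t s \<partial>H) \<partial>N i) = (\<integral>s. (\<integral>t. k t s \<partial>N i) \<partial>H)"
      by (rule Fubini_integral[OF int])
    show "integrable H (\<lambda>s. \<integral>t. k t s \<partial>N i)"
      by (rule integrable_fst'[OF int, simplified])
  qed
  show "cm_integral M \<mu> (\<lambda>t. \<integral>s. k t s \<partial>H) = (\<integral>s. cm_integral M \<mu> (\<lambda>t. k t s) \<partial>H)"
    unfolding N(3) * using *(2) by (subst Bochner_Integration.integral_sum) auto
qed

lemma bounded_measurable_cm_integral:
  assumes \<mu>: "complex_measure M \<mu>"
    and k [measurable]: "(\<lambda>(t, s). k t s) \<in> borel_measurable (M \<Otimes>\<^sub>M H)"
    and bound: "\<And>t s. t \<in> space M \<Longrightarrow> s \<in> space H \<Longrightarrow> cmod (k t s) \<le> B"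
  shows "(\<lambda>s. cm_integral M \<mu> (\<lambda>t. k t s)) \<in> bounded_measurable H"
proof -
  obtain N c where N: "\<And>k. finite_measure (N k)" "\<And>k. sets (N k) = sets M"
    "\<And>f. cm_integral M \<mu> f = (\<Sum>k<4::nat. c k * (integral\<^sup>L (N k) f :: complex))"
    using \<mu> by (rule cm_integral_decomposition) (rule that)
  obtain C where C: "\<forall>f\<in>borel_measurable M. \<forall>B. (\<forall>x\<in>space M. cmod (f x) \<le> B) \<longrightarrow>
    cmod (cm_integral M \<mu> f) \<le> C * B"
    using cm_integral_bound[OF \<mu>] by blast
  show ?thesis
  proof (rule bounded_measurableI)
    fix s assume s: "s \<in> space H"
    show "cmod (cm_integral M \<mu> (\<lambda>t. k t s)) \<le> C * B"
      by (rule C[rule_format]) (use s bound in auto)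
  next
    have "(\<lambda>s. \<integral>t. k t s \<partial>N i) \<in> borel_measurable H" for i
    proof -
      interpret Ni: finite_measure "N i" by (rule N)
      have [measurable_cong]: "sets (N i) = sets M" by (rule N)
      show ?thesis by measurable
    qed
    then show "(\<lambda>s. cm_integral M \<mu> (\<lambda>t. k t s)) \<in> borel_measurable H"
      unfolding N(3) by measurable
  qed
qed

lemma cm_integral_cm_integral_swap:
  assumes \<mu>: "complex_measure M \<mu>" and \<nu>: "complex_measure H \<nu>"
    and k [measurable]: "(\<lambda>(t, s). k t s) \<in> borel_measurable (M \<Otimes>\<^sub>M H)"
    and bound: "\<And>t s. t \<in> space M \<Longrightarrow> s \<in> space H \<Longrightarrow> cmod (k t s) \<le> B"
  shows "cm_integral M \<mu> (\<lambda>t. cm_integral H \<nu> (k t)) = cm_integral H \<nu> (\<lambda>s. cm_integral M \<mu> (\<lambda>t. k t s))"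
proof -
  obtain N c where N: "\<And>k. finite_measure (N k)" "\<And>k. sets (N k) = sets H"
    "\<And>f. cm_integral H \<nu> f = (\<Sum>k<4::nat. c k * (integral\<^sup>L (N k) f :: complex))"
    using \<nu> by (rule cm_integral_decomposition) (rule that)
  have swap: "cm_integral M \<mu> (\<lambda>t. \<integral>s. k t s \<partial>N i) = (\<integral>s. cm_integral M \<mu> (\<lambda>t. k t s) \<partial>N i)"
    and bm: "(\<lambda>t. \<integral>s. k t s \<partial>N i) \<in> bounded_measurable M" for i
  proof -
    interpret Ni: finite_measure "N i" by (rule N)
    have [measurable_cong]: "sets (N i) = sets H" by (rule N)
    have sp: "space (N i) = space H" by (rule sets_eq_imp_space_eq) (rule N(2))
    show "cm_integral M \<mu> (\<lambda>t. \<integral>s. k t s \<partial>N i) = (\<integral>s. cm_integral M \<mu> (\<lambda>t. k t s) \<partial>N i)"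
      by (rule cm_integral_swap[OF \<mu>, where w="\<lambda>_. B"])
        (use bound in \<open>auto simp: sp intro: Ni.sigma_finite_measure_axioms\<close>)
    show "(\<lambda>t. \<integral>s. k t s \<partial>N i) \<in> bounded_measurable M"
    proof (rule bounded_measurableI)
      fix t assume t: "t \<in> space M"
      have "cmod (\<integral>s. k t s \<partial>N i) \<le> (\<integral>s. cmod (k t s) \<partial>N i)" by simp
      also have "\<dots> \<le> (\<integral>s. \<bar>B\<bar> \<partial>N i)"
        by (rule integral_mono') (use bound t in \<open>force simp: sp\<close>)+
      finally show "cmod (\<integral>s. k t s \<partial>N i) \<le> measure (N i) (space (N i)) * \<bar>B\<bar>" by simp
    qed measurable
  qed
  note sf = sigma_functional_cm_integral[OF \<mu>]
  show ?thesis
    unfolding N(3)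
    by (subst sigma_functional_sum[OF sf])
      (auto simp: sigma_functional_cmult[OF sf bm] swap intro!: bounded_measurable_cmult bm)
qed

section \<open>Complex measures on a topological group\<close>

lemma conv_eq_measure_of_functional:
  "conv G \<mu> \<nu> = measure_of_functional (borel_on G)
     (\<lambda>f. cm_integral (borel_on G) \<nu> (\<lambda>t. cm_integral (borel_on G) \<mu> (\<lambda>s. f (s \<otimes>\<^bsub>G\<^esub> t))))"
  by (rule ext) (simp add: conv_def measure_of_functional_def)

lemma sigma_functional_conv:
  fixes G (structure)
  assumes \<mu>: "complex_measure (borel_on G) \<mu>" and \<nu>: "complex_measure (borel_on G) \<nu>"
    and mult [measurable]: "(\<lambda>(s, t). s \<otimes> t) \<in> borel_on G \<Otimes>\<^sub>M borel_on G \<rightarrow>\<^sub>M borel_on G"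
  shows "sigma_functional (borel_on G)
    (\<lambda>f. cm_integral (borel_on G) \<nu> (\<lambda>t. cm_integral (borel_on G) \<mu> (\<lambda>s. f (s \<otimes> t))))"
proof (rule sigma_functionalI)
  note sf\<mu> = sigma_functional_cm_integral[OF \<mu>] and sf\<nu> = sigma_functional_cm_integral[OF \<nu>]
  let ?M = "borel_on G"
  have mult_space: "s \<otimes> t \<in> space ?M" if "s \<in> space ?M" "t \<in> space ?M" for s t
    using measurable_space[OF mult, of "(s, t)"] that by (simp add: space_pair_measure)
  have shift: "(\<lambda>s. f (s \<otimes> t)) \<in> bounded_measurable ?M"
    if "f \<in> bounded_measurable ?M" "t \<in> space ?M" for f t
  proof -
    obtain B where "\<And>x. x \<in> space ?M \<Longrightarrow> cmod (f x) \<le> B" and [measurable]: "f \<in> borel_measurable ?M"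
      using \<open>f \<in> bounded_measurable ?M\<close> by (rule bounded_measurableE) (rule that)
    then have "cmod (f (s \<otimes> t)) \<le> B" if "s \<in> space ?M" for s
      using mult_space[OF that \<open>t \<in> space ?M\<close>] by blast
    moreover have "(\<lambda>s. f (s \<otimes> t)) \<in> borel_measurable ?M"
      using \<open>t \<in> space ?M\<close> by measurable
    ultimately show ?thesis by (intro bounded_measurableI) auto
  qed
  have inner: "(\<lambda>t. cm_integral ?M \<mu> (\<lambda>s. f (s \<otimes> t))) \<in> bounded_measurable ?M"
    if "f \<in> bounded_measurable ?M" for f
  proof -
    obtain B where B: "\<And>x. x \<in> space ?M \<Longrightarrow> cmod (f x) \<le> B" and [measurable]: "f \<in> borel_measurable ?M"
      using \<open>f \<in> bounded_measurable ?M\<close> by (rule bounded_measurableE) (rule that)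
    show ?thesis
    proof (rule bounded_measurable_cm_integral[OF \<mu>])
      show "cmod (f (s \<otimes> t)) \<le> B" if "s \<in> space ?M" "t \<in> space ?M" for s t
        using that by (intro B mult_space)
    qed measurable
  qed
  show "cm_integral ?M \<nu> (\<lambda>t. cm_integral ?M \<mu> (\<lambda>s. f (s \<otimes> t) + g (s \<otimes> t))) =
      cm_integral ?M \<nu> (\<lambda>t. cm_integral ?M \<mu> (\<lambda>s. f (s \<otimes> t))) +
      cm_integral ?M \<nu> (\<lambda>t. cm_integral ?M \<mu> (\<lambda>s. g (s \<otimes> t)))"
    if "f \<in> bounded_measurable ?M" "g \<in> bounded_measurable ?M" for f g
    unfolding sigma_functional_add[OF sf\<nu> inner inner, OF that, symmetric]
    using that
    by (intro sigma_functional_cong[OF sf\<nu> inner] bounded_measurable_add)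
      (simp_all add: sigma_functional_add[OF sf\<mu> shift shift])
  show "cm_integral ?M \<nu> (\<lambda>t. cm_integral ?M \<mu> (\<lambda>s. c * f (s \<otimes> t))) =
      c * cm_integral ?M \<nu> (\<lambda>t. cm_integral ?M \<mu> (\<lambda>s. f (s \<otimes> t)))"
    if "f \<in> bounded_measurable ?M" for f c
    unfolding sigma_functional_cmult[OF sf\<nu> inner, OF that, symmetric]
    using that
    by (intro sigma_functional_cong[OF sf\<nu> inner] bounded_measurable_cmult)
      (simp_all add: sigma_functional_cmult[OF sf\<mu> shift])
  show "(\<lambda>n. cm_integral ?M \<nu> (\<lambda>t. cm_integral ?M \<mu> (\<lambda>s. F n (s \<otimes> t)))) \<longlonglongrightarrow>
      cm_integral ?M \<nu> (\<lambda>t. cm_integral ?M \<mu> (\<lambda>s. f (s \<otimes> t)))"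
    if F: "\<And>n. F n \<in> borel_measurable ?M" and f: "f \<in> borel_measurable ?M"
      and B: "\<And>n x. x \<in> space ?M \<Longrightarrow> cmod (F n x) \<le> B"
      and lim: "\<And>x. x \<in> space ?M \<Longrightarrow> (\<lambda>n::nat. F n x) \<longlonglongrightarrow> f x"
    for F f B
  proof -
    obtain C where C: "\<forall>f\<in>borel_measurable ?M. \<forall>B. (\<forall>x\<in>space ?M. cmod (f x) \<le> B) \<longrightarrow>
        cmod (cm_integral ?M \<mu> f) \<le> C * B"
      using cm_integral_bound[OF \<mu>] by blast
    have Fb: "F n \<in> bounded_measurable ?M" for n
      using F B by (rule bounded_measurableI)
    have fb: "f \<in> bounded_measurable ?M"
    proof (rule bounded_measurableI[OF f])
      show "cmod (f x) \<le> B" if "x \<in> space ?M" for x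
        using tendsto_norm[OF lim[OF that]] B[OF that] by (intro LIMSEQ_le_const2) auto
    qed
    show ?thesis
    proof (rule sigma_functional_tendsto[OF sf\<nu>])
      show "(\<lambda>t. cm_integral ?M \<mu> (\<lambda>s. F n (s \<otimes> t))) \<in> borel_measurable ?M" for n
        by (rule bounded_measurable_measurable[OF inner[OF Fb]])
      show "(\<lambda>t. cm_integral ?M \<mu> (\<lambda>s. f (s \<otimes> t))) \<in> borel_measurable ?M"
        by (rule bounded_measurable_measurable[OF inner[OF fb]])
      fix t assume t: "t \<in> space ?M"
      have m: "(\<lambda>s. F n (s \<otimes> t)) \<in> borel_measurable ?M" for n
        by (rule bounded_measurable_measurable[OF shift[OF Fb t]])
      have m': "(\<lambda>s. f (s \<otimes> t)) \<in> borel_measurable ?M"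
        by (rule bounded_measurable_measurable[OF shift[OF fb t]])
      have B': "cmod (F n (s \<otimes> t)) \<le> B" if "s \<in> space ?M" for n s
        by (rule B) (rule mult_space[OF that t])
      show "cmod (cm_integral ?M \<mu> (\<lambda>s. F n (s \<otimes> t))) \<le> C * B" for n
        using C m[of n] B'[of _ n] by simp
      show "(\<lambda>n. cm_integral ?M \<mu> (\<lambda>s. F n (s \<otimes> t))) \<longlonglongrightarrow> cm_integral ?M \<mu> (\<lambda>s. f (s \<otimes> t))"
        by (rule sigma_functional_tendsto[OF sf\<mu> m m' B' lim[OF mult_space[OF _ t]]])
    qed
  qed
qed

text \<open>Inner and outer regularity of finite Borel measures on a Polish space.\<close>

lemma finite_measure_compact_open_approx:
  fixes N :: "'a::{second_countable_topology,complete_space} measure"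
  assumes N: "finite_measure N" "sets N = sets borel" and E: "E \<in> sets borel" and "\<delta> > 0"
  shows "\<exists>K U. compact K \<and> open U \<and> K \<subseteq> E \<and> E \<subseteq> U \<and> measure N (U - K) < \<delta>"
proof -
  interpret finite_measure N by (rule N)
  have fin: "emeasure N X \<noteq> \<infinity>" for X by simp
  have "\<exists>K\<in>{K. K \<subseteq> E \<and> compact K}. emeasure N E < emeasure N K + ennreal (\<delta>/2)"
    using inner_regular[OF N(2) fin E] \<open>\<delta> > 0\<close>
    by (intro SUP_approx_ennreal fin) auto
  then obtain K where K: "K \<subseteq> E" "compact K" "emeasure N E < emeasure N K + ennreal (\<delta>/2)"
    by auto
  have "\<exists>U\<in>{U. E \<subseteq> U \<and> open U}. emeasure N U < emeasure N E + ennreal (\<delta>/2)"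
    using outer_regular[OF N(2) fin E] \<open>\<delta> > 0\<close>
    by (intro INF_approx_ennreal fin) auto
  then obtain U where U: "E \<subseteq> U" "open U" "emeasure N U < emeasure N E + ennreal (\<delta>/2)"
    by auto
  have "measure N E < measure N K + \<delta>/2" "measure N U < measure N E + \<delta>/2"
    using K(3) U(3) \<open>\<delta> > 0\<close>
    by (simp_all add: emeasure_eq_measure ennreal_less_iff del: ennreal_plus flip: ennreal_plus)
  moreover have "measure N (U - K) = measure N U - measure N K"
    using K U N(2) by (intro finite_measure_Diff) (auto intro: borel_compact)
  ultimately show ?thesis using K U by (intro exI[of _ K] exI[of _ U]) auto
qed

lemma total_variation_le:
  fixes c :: "nat \<Rightarrow> complex" and \<mu> :: "'a set \<Rightarrow> complex"
  assumes N: "\<And>k. sets (N k) = sets M" "\<And>k. finite_measure (N k)"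
    and \<mu>: "\<And>E. E \<in> sets M \<Longrightarrow> \<mu> E = (\<Sum>k<n. c k * measure (N k) E)" "\<And>k. cmod (c k) = 1"
    and E: "E \<in> sets M"
  shows "total_variation M \<mu> E \<le> ennreal (\<Sum>k<(n::nat). measure (N k) E)"
  unfolding total_variation_def
proof (rule SUP_least)
  fix P assume "P \<in> {P. finite P \<and> disjoint P \<and> P \<subseteq> sets M \<and> \<Union>P \<subseteq> E}"
  then have P: "finite P" "disjoint P" "P \<subseteq> sets M" "\<Union>P \<subseteq> E" by auto
  have fm: "finite_measure (N k)" for k by (rule N)
  have "(\<Sum>F\<in>P. ennreal (cmod (\<mu> F))) = ennreal (\<Sum>F\<in>P. cmod (\<mu> F))"
    by simp
  also have "\<dots> \<le> ennreal (\<Sum>k<n. measure (N k) E)"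
  proof (rule ennreal_leI)
    have "(\<Sum>F\<in>P. cmod (\<mu> F)) \<le> (\<Sum>F\<in>P. \<Sum>k<n. measure (N k) F)"
    proof (rule sum_mono)
      fix F assume "F \<in> P"
      then have "\<mu> F = (\<Sum>k<n. c k * measure (N k) F)"
        using P by (intro \<mu>(1)) auto
      then have "cmod (\<mu> F) \<le> (\<Sum>k<n. cmod (c k * measure (N k) F))"
        by (simp add: norm_sum)
      then show "cmod (\<mu> F) \<le> (\<Sum>k<n. measure (N k) F)"
        by (simp add: norm_mult \<mu>(2))
    qed
    also have "\<dots> = (\<Sum>k<n. \<Sum>F\<in>P. measure (N k) F)"
      by (rule sum.swap)
    also have "\<dots> \<le> (\<Sum>k<n. measure (N k) E)"
    proof (rule sum_mono)
      fix k
      have "(\<Sum>F\<in>P. measure (N k) F) = measure (N k) (\<Union>F\<in>P. F)"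
        using P N fm[THEN finite_measure.emeasure_finite]
        by (intro measure_finite_Union[symmetric])
          (auto simp: disjoint_def disjoint_family_on_def)
      also have "\<dots> \<le> measure (N k) E"
        using P E N by (intro finite_measure.finite_measure_mono[OF fm]) auto
      finally show "(\<Sum>F\<in>P. measure (N k) F) \<le> measure (N k) E" .
    qed
    finally show "(\<Sum>F\<in>P. cmod (\<mu> F)) \<le> (\<Sum>k<n. measure (N k) E)" .
  qed
  finally show "(\<Sum>F\<in>P. ennreal (cmod (\<mu> F))) \<le> ennreal (\<Sum>k<n. measure (N k) E)" .
qed

lemma sets_borel_on:
  assumes "closed (carrier G)"
  shows "E \<in> sets (borel_on G) \<longleftrightarrow> E \<in> sets borel \<and> E \<subseteq> carrier G"
  using assms by (auto simp: borel_on_def sets_restrict_space_iff)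

lemma space_borel_on [simp]: "space (borel_on G) = carrier G"
  by (simp add: borel_on_def space_restrict_space)

text \<open>
  Each Jordan part is a finite Borel measure, hence regular. The union of the four compact sets and the
  intersection of the four open sets serve all parts at once. So on these groups regularity is automatic.
\<close>

lemma regular_measure_complex_measure:
  fixes G :: "('a::{second_countable_topology,complete_space}) monoid"
  assumes G: "closed (carrier G)" and \<mu>: "complex_measure (borel_on G) \<mu>"
  shows "regular_measure G \<mu>"
  unfolding regular_measure_def
proof (intro ballI allI impI)
  fix E and \<epsilon> :: real assume E: "E \<in> sets (borel_on G)" and "\<epsilon> > 0"
  obtain N and c :: "nat \<Rightarrow> complex"
    where N: "\<And>k. finite_measure (N k)" "\<And>k. sets (N k) = sets (borel_on G)"
    and \<mu>N: "\<And>E. E \<in> sets (borel_on G) \<Longrightarrow> \<mu> E = (\<Sum>k<4. c k * measure (N k) E)" "\<And>k. cmod (c k) = 1"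
    using \<mu> by (rule cm_integral_decomposition) (rule that)
  have sp: "space (N k) = carrier G" for k
    using sets_eq_imp_space_eq[OF N(2), of k] by simp
  define N' where "N' k = distr (N k) borel (\<lambda>x. x)" for k
  have id: "(\<lambda>x. x) \<in> N k \<rightarrow>\<^sub>M borel" for k
    unfolding measurable_cong_sets[OF N(2) refl] borel_on_def by (rule measurable_restrict_space1) simp
  have "finite_measure (N' k)" "sets (N' k) = sets borel" for k
    unfolding N'_def by (simp_all add: finite_measure.finite_measure_distr[OF N(1) id])
  then have "\<exists>K U. compact K \<and> open U \<and> K \<subseteq> E \<and> E \<subseteq> U \<and> measure (N' k) (U - K) < \<epsilon>/4" for k
    using E G \<open>\<epsilon> > 0\<close> by (intro finite_measure_compact_open_approx) (auto simp: sets_borel_on)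
  then obtain K U where KU: "\<And>k. compact (K k)" "\<And>k. open (U k)" "\<And>k. K k \<subseteq> E" "\<And>k. E \<subseteq> U k"
      "\<And>k. measure (N' k) (U k - K k) < \<epsilon>/4"
    by metis
  have Kc: "closed (K k)" for k using KU(1) by (rule compact_imp_closed)
  let ?K = "\<Union>k<4. K k" and ?V = "carrier G \<inter> (\<Inter>k<4. U k)"
  have K: "compact ?K" using KU(1) by (intro compact_UN) auto
  have oV: "open (\<Inter>k<4. U k)" using KU(2) by (intro open_INT) auto
  have UK: "U k - K k \<in> sets borel" for k
    using borel_open[OF KU(2)] borel_closed[OF Kc] by (rule sets.Diff)
  have meas: "measure (N k) (?V - ?K) < \<epsilon>/4" if "k < 4" for k
  proof -
    have "measure (N k) (?V - ?K) \<le> measure (N k) ((\<lambda>x. x) -` (U k - K k) \<inter> space (N k))"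
    proof (rule finite_measure.finite_measure_mono[OF N(1)])
      show "?V - ?K \<subseteq> (\<lambda>x. x) -` (U k - K k) \<inter> space (N k)"
        using that unfolding sp by blast
      show "(\<lambda>x. x) -` (U k - K k) \<inter> space (N k) \<in> sets (N k)"
        by (rule measurable_sets[OF id UK])
    qed
    also have "\<dots> = measure (N' k) (U k - K k)"
      unfolding N'_def by (rule measure_distr[OF id UK, symmetric])
    finally show ?thesis using KU(5)[of k] by simp
  qed
  have "?V - ?K \<in> sets borel"
    using borel_closed[OF G] borel_open[OF oV] borel_compact[OF K] by (intro sets.Diff sets.Int)
  then have "?V - ?K \<in> sets (borel_on G)"
    unfolding sets_borel_on[OF G] by blast
  then have "total_variation (borel_on G) \<mu> (?V - ?K) \<le> ennreal (\<Sum>k<4::nat. measure (N k) (?V - ?K))"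
    by (intro total_variation_le[OF N(2,1) \<mu>N])
  also have "\<dots> < ennreal \<epsilon>"
  proof (rule ennreal_lessI)
    have "(\<Sum>k<4::nat. measure (N k) (?V - ?K)) < (\<Sum>k<4::nat. \<epsilon>/4)"
    proof (rule sum_strict_mono)
      show "{..<4::nat} \<noteq> {}" by (metis empty_iff lessThan_iff zero_less_numeral)
    qed (use meas in auto)
    then show "(\<Sum>k<4::nat. measure (N k) (?V - ?K)) < \<epsilon>" by simp
  qed (use \<open>\<epsilon> > 0\<close> in simp)
  finally have tv: "total_variation (borel_on G) \<mu> (?V - ?K) < ennreal \<epsilon>" .
  show "\<exists>K V. compact K \<and> openin (top_of_set (carrier G)) V \<and> K \<subseteq> E \<and> E \<subseteq> V \<and>
      total_variation (borel_on G) \<mu> (V - K) < ennreal \<epsilon>"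
  proof (rule exI[of _ ?K], rule exI[of _ ?V], intro conjI)
    show "openin (top_of_set (carrier G)) ?V" using oV by (rule openin_open_Int)
    show "?K \<subseteq> E" using KU(3) by blast
    show "E \<subseteq> ?V" using KU(4) E unfolding sets_borel_on[OF G] by blast
  qed (rule K, rule tv)
qed

lemma meas_alg_eq:
  fixes G :: "('a::{second_countable_topology,complete_space}) monoid"
  assumes "closed (carrier G)"
  shows "meas_alg G = {\<mu>. complex_measure (borel_on G) \<mu>}"
  using regular_measure_complex_measure[OF assms] by (auto simp: meas_alg_def)

lemma total_variation_0_imp:
  assumes "total_variation M \<mu> V = 0" "E \<in> sets M" "E \<subseteq> V"
  shows "\<mu> E = 0"
proof -
  have "(\<Sum>F\<in>{E}. ennreal (cmod (\<mu> F))) \<le> total_variation M \<mu> V"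
    unfolding total_variation_def using assms by (intro SUP_upper) auto
  then show ?thesis using assms by simp
qed

lemma complex_measure_sums:
  assumes "complex_measure M \<mu>" "range A \<subseteq> sets M" "disjoint_family A"
  shows "(\<lambda>n::nat. \<mu> (A n)) sums \<mu> (\<Union>n. A n)"
proof -
  have "\<forall>A :: nat \<Rightarrow> _. range A \<subseteq> sets M \<longrightarrow> disjoint_family A \<longrightarrow> (\<lambda>n. \<mu> (A n)) sums \<mu> (\<Union>n. A n)"
    using assms(1) unfolding complex_measure_def by (rule conjunct1)
  then show ?thesis using assms(2,3) by simp
qed

text \<open>
  The complement of the support is a union of relatively open null sets. As this union may be
  uncountable, the Lindelof property is needed to cover by countably many of them.
\<close>

lemma complex_measure_off_support:
  fixes G :: "('a::second_countable_topology) monoid"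
  assumes \<mu>: "complex_measure (borel_on G) \<mu>" and E: "E \<in> sets (borel_on G)"
    and disj: "E \<inter> cm_support G \<mu> = {}"
  shows "\<mu> E = 0"
proof -
  let ?F = "{V. openin (top_of_set (carrier G)) V \<and> total_variation (borel_on G) \<mu> V = 0}"
  have sub: "E \<subseteq> carrier G" using sets.sets_into_space[OF E] by simp
  obtain F' where F': "F' \<subseteq> ?F" "countable F'" "\<Union>F' = \<Union>?F"
    using Lindelof_openin[of ?F "carrier G"] by blast
  have "E \<subseteq> \<Union>?F"
    using disj sub by (auto simp: cm_support_def)
  then have EF: "E \<subseteq> \<Union>F'" using F' by simp
  show ?thesis
  proof (cases "F' = {}")
    case True
    then have "E = {}" using EF by simp
    then show ?thesis
      using signed_measure.empty[OF signed_measure_ReIm(1)[OF \<mu>]]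
        signed_measure.empty[OF signed_measure_ReIm(2)[OF \<mu>]] by (simp add: complex_eq_iff)
  next
    case False
    then obtain A where A: "F' = range (A :: nat \<Rightarrow> _)"
      using uncountable_def F'(2) by metis
    have A_sets: "A i \<in> sets (borel_on G)" for i
    proof -
      have "openin (top_of_set (carrier G)) (A i)" using F'(1) A by blast
      then obtain O' where "open O'" "A i = carrier G \<inter> O'" by (auto simp: openin_open)
      then show ?thesis by (auto simp: borel_on_def sets_restrict_space)
    qed
    have D: "disjointed (\<lambda>i. E \<inter> A i) i \<in> sets (borel_on G)" for i
    proof -
      have "range (\<lambda>i. E \<inter> A i) \<subseteq> sets (borel_on G)"
        using E A_sets by auto
      then have "range (disjointed (\<lambda>i. E \<inter> A i)) \<subseteq> sets (borel_on G)"
        by (rule sets.range_disjointed_sets)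
      then show ?thesis by (rule subsetD) (rule rangeI)
    qed
    have "(\<lambda>i. \<mu> (disjointed (\<lambda>i. E \<inter> A i) i)) sums \<mu> (\<Union>i. disjointed (\<lambda>i. E \<inter> A i) i)"
    proof (rule complex_measure_sums[OF \<mu> _ disjoint_family_disjointed])
      show "range (\<lambda>i. disjointed (\<lambda>i. E \<inter> A i) i) \<subseteq> sets (borel_on G)"
        using D by (rule image_subsetI)
    qed
    moreover have "(\<Union>i. disjointed (\<lambda>i. E \<inter> A i) i) = E"
      unfolding UN_disjointed_eq using EF A by auto
    moreover have "\<mu> (disjointed (\<lambda>i. E \<inter> A i) i) = 0" for i
    proof (rule total_variation_0_imp[OF _ D])
      show "total_variation (borel_on G) \<mu> (A i) = 0" using F'(1) A by blast
      show "disjointed (\<lambda>i. E \<inter> A i) i \<subseteq> A i"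
        using disjointed_subset[of "\<lambda>i. E \<inter> A i" i] by blast
    qed
    ultimately show ?thesis by (simp add: sums_iff)
  qed
qed

lemma cm_integral_restrict_support:
  fixes G :: "('a::{second_countable_topology,t2_space}) monoid"
  assumes \<mu>: "complex_measure (borel_on G) \<mu>" and K: "compact (cm_support G \<mu>)"
    and f: "f \<in> bounded_measurable (borel_on G)"
  shows "cm_integral (borel_on G) \<mu> f = cm_integral (borel_on G) \<mu> (\<lambda>x. indicator (cm_support G \<mu>) x * f x)"
proof (rule cm_integral_eqI[OF _ _ _ f])
  let ?M = "borel_on G" and ?K = "cm_support G \<mu>"
  note sf = sigma_functional_cm_integral[OF \<mu>]
  have Km [measurable]: "?K \<in> sets ?M"
    using borel_compact[OF K] by (auto simp: borel_on_def sets_restrict_space cm_support_def)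
  have ind: "(\<lambda>x. indicator ?K x * g x) \<in> bounded_measurable ?M" if "g \<in> bounded_measurable ?M" for g
    by (rule bounded_measurable_mult[OF bounded_measurable_indicator[OF Km] that])
  show "sigma_functional ?M (\<lambda>f. cm_integral ?M \<mu> (\<lambda>x. indicator ?K x * f x))"
  proof (rule sigma_functionalI)
    fix F f B
    assume F: "\<And>n. F n \<in> borel_measurable ?M" and f: "f \<in> borel_measurable ?M"
      and B: "\<And>n x. x \<in> space ?M \<Longrightarrow> cmod (F n x) \<le> B"
      and lim: "\<And>x. x \<in> space ?M \<Longrightarrow> (\<lambda>n::nat. F n x) \<longlonglongrightarrow> f x"
    show "(\<lambda>n. cm_integral ?M \<mu> (\<lambda>x. indicator ?K x * F n x)) \<longlonglongrightarrow>
        cm_integral ?M \<mu> (\<lambda>x. indicator ?K x * f x)"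
    proof (rule sigma_functional_tendsto[OF sf])
      show "cmod (indicator ?K x * F n x) \<le> \<bar>B\<bar>" if "x \<in> space ?M" for n x
        using B[OF that, of n] by (auto simp: indicator_def)
      show "(\<lambda>n. indicator ?K x * F n x) \<longlonglongrightarrow> indicator ?K x * f x" if "x \<in> space ?M" for x
        using lim[OF that] by (rule tendsto_mult_left)
      show "(\<lambda>x. indicator ?K x * f x) \<in> borel_measurable ?M" "(\<lambda>x. indicator ?K x * F n x) \<in> borel_measurable ?M" for n
        using F[of n] f by measurable
    qed
  next
    fix f g assume "f \<in> bounded_measurable ?M" "g \<in> bounded_measurable ?M"
    then show "cm_integral ?M \<mu> (\<lambda>x. indicator ?K x * (f x + g x)) =
        cm_integral ?M \<mu> (\<lambda>x. indicator ?K x * f x) + cm_integral ?M \<mu> (\<lambda>x. indicator ?K x * g x)"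
      unfolding distrib_left by (intro sigma_functional_add[OF sf] ind)
  next
    fix f c assume "f \<in> bounded_measurable ?M"
    then show "cm_integral ?M \<mu> (\<lambda>x. indicator ?K x * (c * f x)) = c * cm_integral ?M \<mu> (\<lambda>x. indicator ?K x * f x)"
      unfolding mult.left_commute[of "indicator ?K _" c] by (intro sigma_functional_cmult[OF sf] ind)
  qed
  fix E assume E: "E \<in> sets ?M"
  have "(\<lambda>x. indicator ?K x * indicator E x) = (indicator (E \<inter> ?K) :: _ \<Rightarrow> complex)"
    by (auto simp: indicator_def)
  then have "cm_integral ?M \<mu> (\<lambda>x. indicator ?K x * indicator E x) = \<mu> (E \<inter> ?K)"
    using E by (simp add: cm_integral_indicator[OF \<mu>])
  moreover have "\<mu> E = \<mu> (E \<inter> ?K)"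
  proof -
    have "\<mu> (E - E \<inter> ?K) = 0"
      using E by (intro complex_measure_off_support[OF \<mu>]) auto
    then show ?thesis
      using signed_measure.Diff[OF signed_measure_ReIm(1)[OF \<mu>], of E "E \<inter> ?K"]
        signed_measure.Diff[OF signed_measure_ReIm(2)[OF \<mu>], of E "E \<inter> ?K"] E
      by (simp add: complex_eq_iff)
  qed
  ultimately show "\<mu> E = cm_integral ?M \<mu> (\<lambda>x. indicator ?K x * indicator E x)" by simp
qed (rule complex_measure_notin[OF \<mu>])

section \<open>Haar measure on \<open>SO(2)\<close>\<close>

lemma continuous_on_transpose [continuous_intros]:
  fixes f :: "'a::topological_space \<Rightarrow> real^'n^'m"
  shows "continuous_on S f \<Longrightarrow> continuous_on S (\<lambda>x. transpose (f x))"
  unfolding transpose_def by (intro continuous_intros)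

lemma continuous_on_matrix_vector_mult [continuous_intros]:
  fixes f :: "'a::topological_space \<Rightarrow> real^'n^'m"
  shows "continuous_on S f \<Longrightarrow> continuous_on S g \<Longrightarrow> continuous_on S (\<lambda>x. f x *v g x)"
  unfolding matrix_vector_mult_def by (intro continuous_intros)

lemma continuous_on_matrix_matrix_mult [continuous_intros]:
  fixes f :: "'a::topological_space \<Rightarrow> real^'n^'m" and g :: "'a \<Rightarrow> real^'k^'n"
  shows "continuous_on S f \<Longrightarrow> continuous_on S g \<Longrightarrow> continuous_on S (\<lambda>x. f x ** g x)"
  unfolding matrix_matrix_mult_def by (intro continuous_intros)

lemma rot_nth [simp]: "rot \<theta> $ 1 $ 1 = cos \<theta>" "rot \<theta> $ 1 $ 2 = - sin \<theta>"
    "rot \<theta> $ 2 $ 1 = sin \<theta>" "rot \<theta> $ 2 $ 2 = cos \<theta>"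
  by (simp_all add: rot_def vector_2)

lemma continuous_on_rot [continuous_intros]:
  fixes f :: "real \<Rightarrow> real"
  assumes "continuous_on S f"
  shows "continuous_on S (\<lambda>x. rot (f x))"
proof -
  have eq: "rot \<theta> = (\<chi> i j. if i = 1 then if j = 1 then cos \<theta> else - sin \<theta> else if j = 1 then sin \<theta> else cos \<theta>)" for \<theta>
    by (simp add: vec_eq_iff forall_2)
  have "continuous_on S (\<lambda>x. if i = 1 then if j = 1 then cos (f x) else - sin (f x)
      else if j = 1 then sin (f x) else cos (f x))" for i j :: 2
    using assms by (cases "i = 1"; cases "j = 1") (simp_all add: continuous_on_cos continuous_on_sin continuous_on_minus)
  then show ?thesis
    unfolding eq by (intro continuous_on_vec_lambda)
qed

lemma rot_add: "rot a ** rot b = rot (a + b)"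
  by (simp add: vec_eq_iff forall_2 matrix_matrix_mult_def sum_2 cos_add sin_add)

lemma transpose_rot: "transpose (rot a) = rot (- a)"
  by (simp add: vec_eq_iff forall_2 transpose_def)

lemma rot_periodic: "rot (\<theta> + 2 * pi) = rot \<theta>"
  by (simp add: vec_eq_iff forall_2)

lemma rot_in_SO2 [simp]: "rot \<theta> \<in> SO2"
  by (simp add: SO2_def rotation_matrix_rot)

lemma SO2_cases:
  assumes "R \<in> SO2"
  obtains \<theta> where "0 \<le> \<theta>" "\<theta> < 2 * pi" "R = rot \<theta>"
proof -
  have "R \<in> rot ` {0..<2 * pi}"
    using assms bij_betw_imp_surj_on[OF bij_betw_rot] by simp
  then show ?thesis using that by auto
qed

lemma SO2_mult [simp]: "R \<in> SO2 \<Longrightarrow> S \<in> SO2 \<Longrightarrow> R ** S \<in> SO2"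
  by (elim SO2_cases) (simp add: rot_add)

lemma SO2_transpose [simp]: "R \<in> SO2 \<Longrightarrow> transpose R \<in> SO2"
  by (elim SO2_cases) (simp add: transpose_rot)

lemma SO2_mat_1 [simp]: "mat 1 \<in> SO2"
proof -
  have "mat 1 = rot 0" by (simp add: vec_eq_iff forall_2 mat_def)
  then show ?thesis by simp
qed

lemma SO2_commute: "R \<in> SO2 \<Longrightarrow> S \<in> SO2 \<Longrightarrow> R ** S = S ** R"
  by (elim SO2_cases) (simp add: rot_add add.commute)

lemma compact_SO2: "compact SO2"
proof -
  have "SO2 = rot ` {0..2 * pi}"
  proof
    show "SO2 \<subseteq> rot ` {0..2 * pi}"
    proof
      fix R assume "R \<in> SO2"
      then obtain \<theta> where "0 \<le> \<theta>" "\<theta> < 2 * pi" "R = rot \<theta>" by (rule SO2_cases)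
      then show "R \<in> rot ` {0..2 * pi}" by (intro image_eqI[of _ _ \<theta>]) auto
    qed
  qed auto
  also have "compact \<dots>" by (intro compact_continuous_image continuous_intros) simp
  finally show ?thesis .
qed

lemma sets_haar_SO2 [measurable_cong]: "sets haar_SO2 = sets (restrict_space borel SO2)"
  and space_haar_SO2 [simp]: "space haar_SO2 = SO2"
  by (simp_all add: haar_SO2_def space_restrict_space)

lemma measurable_rot [measurable]: "rot \<in> borel \<rightarrow>\<^sub>M restrict_space borel SO2"
  by (intro measurable_restrict_space2 borel_measurable_continuous_onI continuous_intros) auto

lemma prob_space_haar_SO2: "prob_space haar_SO2"
  unfolding haar_SO2_def
  by (rule prob_space.prob_space_distr) (auto intro!: prob_space_uniform_measure)

lemma borel_measurable_haar_SO2: "continuous_on SO2 f \<Longrightarrow> f \<in> borel_measurable haar_SO2"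
  unfolding measurable_cong_sets[OF sets_haar_SO2 refl] by (rule borel_measurable_continuous_on_restrict)

lemma continuous_on_comp_rot: "continuous_on SO2 f \<Longrightarrow> continuous_on A (\<lambda>\<phi>. f (rot \<phi>))"
  by (rule continuous_on_compose2[of SO2 f]) (auto intro!: continuous_intros)

text \<open>
  For continuous integrands the half-open interval of angles may be closed, and calculus on \<open>[0, 2\<pi>]\<close>
  becomes available.
\<close>

lemma haar_integral:
  fixes f :: "real^2^2 \<Rightarrow> 'b::euclidean_space"
  assumes f: "continuous_on SO2 f"
  shows "(\<integral>S. f S \<partial>haar_SO2) = (1 / (2 * pi)) *\<^sub>R integral {0..2*pi} (\<lambda>\<phi>. f (rot \<phi>))"
proof -
  have c: "continuous_on A (\<lambda>\<phi>. f (rot \<phi>))" for A by (rule continuous_on_comp_rot[OF f])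
  have [measurable]: "f \<in> borel_measurable (restrict_space borel SO2)"
    using f by (rule borel_measurable_continuous_on_restrict)
  have [measurable]: "(\<lambda>\<phi>. f (rot \<phi>)) \<in> borel_measurable borel"
    by (intro borel_measurable_continuous_onI c)
  have "(\<integral>S. f S \<partial>haar_SO2) = (\<integral>\<phi>. f (rot \<phi>) \<partial>uniform_measure lborel {0..<2*pi})"
    unfolding haar_SO2_def by (rule integral_distr) auto
  also have "uniform_measure lborel {0..<2*pi} =
      density lborel (\<lambda>x. ennreal (indicator {0..<2*pi} x / (2 * pi)))"
    unfolding uniform_measure_def
    by (intro density_cong) (auto simp: divide_ennreal indicator_def simp flip: ennreal_1 ennreal_0)
  also have "(\<integral>\<phi>. f (rot \<phi>) \<partial>\<dots>) = (\<integral>\<phi>. (indicator {0..<2*pi} \<phi> / (2 * pi)) *\<^sub>R f (rot \<phi>) \<partial>lborel)"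
    by (rule integral_density) auto
  also have "\<dots> = (\<integral>\<phi>. (1 / (2 * pi)) *\<^sub>R (indicator {0..2*pi} \<phi> *\<^sub>R f (rot \<phi>)) \<partial>lborel)"
  proof (rule integral_cong_AE)
    show "AE \<phi> in lborel. (indicator {0..<2*pi} \<phi> / (2 * pi)) *\<^sub>R f (rot \<phi>) =
        (1 / (2 * pi)) *\<^sub>R (indicator {0..2*pi} \<phi> *\<^sub>R f (rot \<phi>))"
      using AE_lborel_singleton[of "2*pi"] by eventually_elim (auto simp: indicator_def)
  qed measurable
  also have "\<dots> = (1 / (2 * pi)) *\<^sub>R (LINT \<phi>:{0..2*pi}|lborel. f (rot \<phi>))"
    unfolding set_lebesgue_integral_def by (rule integral_scaleR_right)
  also have "(LINT \<phi>:{0..2*pi}|lborel. f (rot \<phi>)) = integral {0..2*pi} (\<lambda>\<phi>. f (rot \<phi>))"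
    by (intro set_borel_integral_eq_integral borel_integrable_atLeastAtMost' c)
  finally show ?thesis .
qed

lemma periodic_integral_shift:
  fixes h :: "real \<Rightarrow> 'b::euclidean_space"
  assumes h: "\<And>A. continuous_on A h" and per: "\<And>x. h (x + p) = h x" and a: "0 \<le> a" "a \<le> p"
  shows "integral {0..p} (\<lambda>x. h (a + x)) = integral {0..p} h"
proof -
  have int: "h integrable_on {c..d}" for c d by (rule integrable_continuous_interval[OF h])
  have "integral {0..p} (\<lambda>x. h (a + x)) = integral {a..p+a} h"
    using integral_shift_Icc_real[of 0 p h a] by (simp add: o_def)
  also have "\<dots> = integral {a..p} h + integral {p..p+a} h"
    using a int by (intro Henstock_Kurzweil_Integration.integral_combine[symmetric]) auto
  also have "integral {p..p+a} h = integral {0..a} h"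
    using integral_shift_Icc_real[of 0 a h p] per by (simp add: o_def add.commute)
  also have "integral {a..p} h + integral {0..a} h = integral {0..p} h"
    using a int by (subst add.commute) (intro Henstock_Kurzweil_Integration.integral_combine, auto)
  finally show ?thesis .
qed

lemma haar_left_invariant:
  fixes f :: "real^2^2 \<Rightarrow> 'b::euclidean_space"
  assumes f: "continuous_on SO2 f" and R: "R \<in> SO2"
  shows "(\<integral>S. f (R ** S) \<partial>haar_SO2) = (\<integral>S. f S \<partial>haar_SO2)"
proof -
  obtain \<theta> where \<theta>: "0 \<le> \<theta>" "\<theta> < 2 * pi" "R = rot \<theta>" using R by (rule SO2_cases)
  have "continuous_on SO2 (\<lambda>S. f (R ** S))"
    using R by (intro continuous_on_compose2[OF f] continuous_intros) auto
  then have "(\<integral>S. f (R ** S) \<partial>haar_SO2) = (1 / (2 * pi)) *\<^sub>R integral {0..2*pi} (\<lambda>\<phi>. f (rot (\<theta> + \<phi>)))"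
    by (simp add: haar_integral \<theta> rot_add)
  also have "integral {0..2*pi} (\<lambda>\<phi>. f (rot (\<theta> + \<phi>))) = integral {0..2*pi} (\<lambda>\<phi>. f (rot \<phi>))"
    using \<theta> by (intro periodic_integral_shift continuous_on_comp_rot[OF f]) (auto simp: rot_periodic)
  finally show ?thesis by (simp add: haar_integral f)
qed

lemma haar_transpose_invariant:
  fixes f :: "real^2^2 \<Rightarrow> 'b::euclidean_space"
  assumes f: "continuous_on SO2 f"
  shows "(\<integral>S. f (transpose S) \<partial>haar_SO2) = (\<integral>S. f S \<partial>haar_SO2)"
proof -
  have "continuous_on SO2 (\<lambda>S. f (transpose S))"
    by (intro continuous_on_compose2[OF f] continuous_intros) auto
  then have "(\<integral>S. f (transpose S) \<partial>haar_SO2) = (1 / (2 * pi)) *\<^sub>R integral {0..2*pi} (\<lambda>\<phi>. f (rot (- \<phi>)))"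
    by (simp add: haar_integral transpose_rot)
  also have "integral {0..2*pi} (\<lambda>\<phi>. f (rot (- \<phi>))) = integral {-(2*pi)..0} (\<lambda>\<phi>. f (rot \<phi>))"
    using Henstock_Kurzweil_Integration.integral_reflect_real[of 0 "-(2*pi)" "\<lambda>\<phi>. f (rot \<phi>)"] by simp
  also have "\<dots> = integral {-(2*pi)..0} ((\<lambda>\<phi>. f (rot \<phi>)) \<circ> (+) (2*pi))"
    by (simp add: o_def rot_periodic add.commute[of "2*pi"])
  also have "\<dots> = integral {0..2*pi} (\<lambda>\<phi>. f (rot \<phi>))"
    by (simp add: integral_shift_Icc_real)
  finally show ?thesis by (simp add: haar_integral f)
qed

lemma haar_inversion_invariant:
  fixes f :: "real^2^2 \<Rightarrow> 'b::euclidean_space"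
  assumes f: "continuous_on SO2 f" and R: "R \<in> SO2"
  shows "(\<integral>S. f (transpose S ** R) \<partial>haar_SO2) = (\<integral>S. f S \<partial>haar_SO2)"
proof -
  have c: "continuous_on SO2 (\<lambda>S. f (S ** R))"
    using R by (intro continuous_on_compose2[OF f] continuous_intros) auto
  have "(\<integral>S. f (transpose S ** R) \<partial>haar_SO2) = (\<integral>S. f (S ** R) \<partial>haar_SO2)"
    by (rule haar_transpose_invariant[OF c])
  also have "\<dots> = (\<integral>S. f (R ** S) \<partial>haar_SO2)"
    using R by (intro Bochner_Integration.integral_cong) (auto simp: SO2_commute)
  also have "\<dots> = (\<integral>S. f S \<partial>haar_SO2)" by (rule haar_left_invariant[OF f R])
  finally show ?thesis .
qed

text \<open>Haar measure charges every nonempty open set.\<close>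

lemma haar_nonneg_integral_0:
  fixes f :: "real^2^2 \<Rightarrow> real"
  assumes f: "continuous_on SO2 f" "\<And>S. S \<in> SO2 \<Longrightarrow> 0 \<le> f S"
    and "(\<integral>S. f S \<partial>haar_SO2) = 0" and S: "S \<in> SO2"
  shows "f S = 0"
proof -
  have "integral {0..2*pi} (\<lambda>\<phi>. f (rot \<phi>)) = 0"
    using assms(3) by (simp add: haar_integral f)
  then have "\<forall>\<phi>\<in>{0..2*pi}. f (rot \<phi>) = 0"
    using f by (subst (asm) integral_eq_0_iff) (auto intro!: continuous_on_comp_rot)
  moreover obtain \<theta> where "0 \<le> \<theta>" "\<theta> < 2 * pi" "S = rot \<theta>" using S by (rule SO2_cases)
  ultimately show ?thesis by auto
qed

section \<open>Plane waves on the circle\<close>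

text \<open>
  The pointwise value at \<open>S\<close> of the vector \<open>U(x, I)1\<close>: a plane wave on \<open>\<real>\<^sup>2\<close>, restricted to the unit
  circle that the first column of \<open>S\<close> runs through.
\<close>

definition plane_wave :: "real^2 \<Rightarrow> real^2^2 \<Rightarrow> complex" where
  "plane_wave x S = char_e1 (transpose S *v x)"

lemma plane_wave_eq: "plane_wave x S = exp (\<i> * of_real (S $ 1 $ 1 * x $ 1 + S $ 2 $ 1 * x $ 2))"
  by (simp add: plane_wave_def char_e1_def matrix_vector_mult_def transpose_def sum_2)

lemma cmod_plane_wave [simp]: "cmod (plane_wave x S) = 1"
  unfolding plane_wave_eq by (rule norm_exp_i_times)

lemma plane_wave_add: "plane_wave (x + y) S = plane_wave x S * plane_wave y S"
  unfolding plane_wave_eq exp_add[symmetric] by (simp add: algebra_simps)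

lemma plane_wave_0 [simp]: "plane_wave 0 S = 1"
  by (simp add: plane_wave_eq)

lemma cnj_plane_wave: "cnj (plane_wave x S) = plane_wave (- x) S"
  unfolding plane_wave_eq exp_cnj by (simp add: algebra_simps)

lemma plane_wave_mult_right: "plane_wave x (transpose R ** S) = plane_wave (R *v x) S"
  by (simp add: plane_wave_def matrix_transpose_mul matrix_vector_mul_assoc)

lemma continuous_on_plane_wave [continuous_intros]:
  "continuous_on A f \<Longrightarrow> continuous_on A g \<Longrightarrow> continuous_on A (\<lambda>z. plane_wave (f z) (g z))"
  unfolding plane_wave_eq by (intro continuous_intros)

lemma continuous_on_plane_wave_right: "continuous_on A (plane_wave x)"
  by (rule continuous_on_plane_wave[OF continuous_on_const continuous_on_id])

text \<open>The Fourier transform of the uniform measure on the unit circle, that is, \<open>J\<^sub>0(\<bar>x\<bar>)\<close>.\<close>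

definition bessel :: "real^2 \<Rightarrow> complex" where
  "bessel x = (\<integral>S. plane_wave x S \<partial>haar_SO2)"

lemma bessel_rotate: "R \<in> SO2 \<Longrightarrow> bessel (R *v x) = bessel x"
  unfolding bessel_def plane_wave_mult_right[symmetric]
  by (rule haar_left_invariant[OF continuous_on_plane_wave_right SO2_transpose])

lemma bessel_0 [simp]: "bessel 0 = 1"
  using prob_space.prob_space[OF prob_space_haar_SO2] by (simp add: bessel_def)

lemma tendsto_bessel:
  assumes z: "z \<longlonglongrightarrow> x"
  shows "(\<lambda>n. bessel (z n)) \<longlonglongrightarrow> bessel x"
  unfolding bessel_def
proof (rule integral_dominated_convergence[where w="\<lambda>_. 1"])
  interpret prob_space haar_SO2 by (rule prob_space_haar_SO2)
  show "plane_wave x \<in> borel_measurable haar_SO2" "plane_wave (z n) \<in> borel_measurable haar_SO2" for n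
    by (rule borel_measurable_haar_SO2[OF continuous_on_plane_wave_right])+
  show "integrable haar_SO2 (\<lambda>_. 1::real)" by simp
  have "(\<lambda>n. plane_wave (z n) S) \<longlonglongrightarrow> plane_wave x S" for S
    using continuous_on_tendsto_compose[of UNIV "\<lambda>x. plane_wave x S", OF _ z]
    by (simp add: continuous_on_plane_wave)
  then show "AE S in haar_SO2. (\<lambda>n. plane_wave (z n) S) \<longlonglongrightarrow> plane_wave x S" by simp
qed simp

lemma polar_SO2:
  fixes z :: "real^2"
  obtains R where "R \<in> SO2" "z = R *v vector [norm z, 0]"
proof -
  have n: "norm z ^ 2 = (z $ 1)\<^sup>2 + (z $ 2)\<^sup>2"
    by (simp add: norm_vec_def L2_set_def sum_2)
  obtain \<theta> where \<theta>: "z $ 1 = norm z * cos \<theta>" "z $ 2 = norm z * sin \<theta>"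
  proof (cases "z = 0")
    case False
    then have nz: "norm z \<noteq> 0" by simp
    have "(z $ 1 / norm z)\<^sup>2 + (z $ 2 / norm z)\<^sup>2 = ((z $ 1)\<^sup>2 + (z $ 2)\<^sup>2) / (norm z)\<^sup>2"
      by (simp only: power_divide add_divide_distrib)
    also have "\<dots> = 1" using nz unfolding n[symmetric] by simp
    finally obtain t where "z $ 1 / norm z = cos t" "z $ 2 / norm z = sin t"
      using sincos_total_2pi[of "z $ 1 / norm z" "z $ 2 / norm z"] by auto
    then have "z $ 1 = norm z * cos t" "z $ 2 = norm z * sin t"
      using nz by (simp_all add: nonzero_divide_eq_eq mult.commute)
    then show ?thesis by (rule that)
  next
    case True
    show ?thesis by (rule that[of 0]) (simp_all add: True)
  qed
  then have "z = rot \<theta> *v vector [norm z, 0]"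
    unfolding vec_eq_iff forall_2 matrix_vector_mult_def by (simp add: sum_2 vector_2 mult.commute)
  with rot_in_SO2 show ?thesis by (rule that)
qed

text \<open>
  The pointwise limit is the indicator of the zeros of \<open>sin\<close>, which are the stationary points of the
  phase \<open>cos\<close>; they form a null set.
\<close>

lemma resonant_part_tendsto_0:
  "(\<lambda>n. integral {0..2*pi} (\<lambda>\<phi>. inverse (real (Suc n)) / ((sin \<phi>)\<^sup>2 + inverse (real (Suc n))))) \<longlonglongrightarrow> 0"
proof -
  define g :: "real \<Rightarrow> real" where "g \<phi> = (if sin \<phi> = 0 then 1 else 0)" for \<phi>
  have pos: "0 < (sin \<phi>)\<^sup>2 + inverse (real (Suc n))" for \<phi> n
    by (intro add_nonneg_pos) auto
  have "(\<lambda>n. integral {0..2*pi} (\<lambda>\<phi>. inverse (real (Suc n)) / ((sin \<phi>)\<^sup>2 + inverse (real (Suc n)))))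
      \<longlonglongrightarrow> integral {0..2*pi} g"
  proof (rule dominated_convergence(2)[where h="\<lambda>_. 1"])
    show "(\<lambda>\<phi>. inverse (real (Suc n)) / ((sin \<phi>)\<^sup>2 + inverse (real (Suc n)))) integrable_on {0..2*pi}" for n
      by (intro integrable_continuous_interval continuous_intros) (use pos in \<open>simp add: less_imp_neq[symmetric]\<close>)
    show "norm (inverse (real (Suc n)) / ((sin \<phi>)\<^sup>2 + inverse (real (Suc n)))) \<le> 1" for n \<phi>
      using pos[of \<phi> n] by (simp add: divide_le_eq abs_of_pos)
    show "(\<lambda>n. inverse (real (Suc n)) / ((sin \<phi>)\<^sup>2 + inverse (real (Suc n)))) \<longlonglongrightarrow> g \<phi>" for \<phi>
    proof (cases "sin \<phi> = 0")
      case False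
      have "(\<lambda>n. inverse (real (Suc n)) / ((sin \<phi>)\<^sup>2 + inverse (real (Suc n)))) \<longlonglongrightarrow> 0 / ((sin \<phi>)\<^sup>2 + 0)"
        using False by (intro tendsto_intros LIMSEQ_inverse_real_of_nat) auto
      then show ?thesis using False by (simp add: g_def)
    qed (simp add: g_def)
  qed auto
  moreover have "integral {0..2*pi} g = 0"
  proof -
    have "{\<phi>::real. sin \<phi> = 0} = range (\<lambda>i::int. of_int i * pi)"
      by (auto simp: sin_zero_iff_int2)
    then have "{\<phi>::real. sin \<phi> = 0} \<in> null_sets lborel"
      by (intro countable_imp_null_set_lborel) simp
    then have "negligible {\<phi>::real. sin \<phi> = 0}"
      by (simp add: negligible_iff_null_sets null_sets_completionI)
    then have "integral {0..2*pi} g = integral {0..2*pi} (\<lambda>_. 0::real)"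
      by (rule integral_spike) (auto simp: g_def)
    then show ?thesis by simp
  qed
  ultimately show ?thesis by simp
qed

text \<open>
  Away from the zeros of \<open>sin\<close> the integrand \<open>exp(\<i>\<rho> cos \<phi>)\<close> oscillates and can be integrated by
  parts. Instead of cutting the interval, the integrand is split smoothly: the summand
  \<open>\<delta> / (sin\<^sup>2 \<phi> + \<delta>)\<close> of \<open>1\<close> is concentrated at the stationary points, and the remaining one contains
  the factor \<open>sin \<phi>\<close> that integration by parts requires.
\<close>

lemma oscillatory_integral_bound:
  fixes \<rho> \<delta> :: real
  assumes \<rho>: "0 < \<rho>" and \<delta>: "0 < \<delta>"
  shows "cmod (integral {0..2*pi} (\<lambda>\<phi>. exp (\<i> * of_real (\<rho> * cos \<phi>)))) \<le>
    integral {0..2*pi} (\<lambda>\<phi>. \<delta> / ((sin \<phi>)\<^sup>2 + \<delta>)) + 2 * pi / (\<delta> * \<rho>)"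
proof -
  have pos: "0 < (sin \<phi>)\<^sup>2 + \<delta>" for \<phi> using \<delta> by (intro add_nonneg_pos) auto
  have ne: "(sin \<phi>)\<^sup>2 + \<delta> \<noteq> 0" for \<phi> using pos[of \<phi>] by simp
  define e where "e \<phi> = exp (\<i> * of_real (\<rho> * cos \<phi>))" for \<phi> :: real
  \<comment> \<open>a regularisation of \<open>1 / sin \<phi>\<close>, the reciprocal of the derivative of the phase\<close>
  define A where "A \<phi> = sin \<phi> / ((sin \<phi>)\<^sup>2 + \<delta>)" for \<phi>
  define A' where "A' \<phi> = cos \<phi> * (\<delta> - (sin \<phi>)\<^sup>2) / ((sin \<phi>)\<^sup>2 + \<delta>)\<^sup>2" for \<phi>
  define D where "D \<phi> = \<delta> / ((sin \<phi>)\<^sup>2 + \<delta>)" for \<phi>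
  have ce: "continuous_on X e" and cA': "continuous_on X A'" and cD: "continuous_on X D" for X
    unfolding e_def A'_def D_def by (intro continuous_intros; simp add: ne)+
  have dA: "(A has_real_derivative A' \<phi>) (at \<phi> within X)" for \<phi> X
    unfolding A_def A'_def using ne[of \<phi>]
    by (auto intro!: derivative_eq_intros simp: field_simps power2_eq_square)
  have de: "(e has_vector_derivative (- \<i> * of_real (\<rho> * sin \<phi>)) * e \<phi>) (at \<phi> within X)" for \<phi> X
  proof -
    have "((\<lambda>x. \<rho> * cos x) has_real_derivative - (\<rho> * sin \<phi>)) (at \<phi> within X)"
      by (auto intro!: derivative_eq_intros)
    then have "((\<lambda>x. of_real (\<rho> * cos x)) has_vector_derivative complex_of_real (- (\<rho> * sin \<phi>))) (at \<phi> within X)"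
      by (rule has_vector_derivative_of_real)
    then have "((\<lambda>x. \<i> * of_real (\<rho> * cos x)) has_vector_derivative \<i> * complex_of_real (- (\<rho> * sin \<phi>))) (at \<phi> within X)"
      by (rule has_vector_derivative_mult_right)
    then have "((exp \<circ> (\<lambda>x. \<i> * of_real (\<rho> * cos x))) has_vector_derivative
        \<i> * complex_of_real (- (\<rho> * sin \<phi>)) * exp (\<i> * of_real (\<rho> * cos \<phi>))) (at \<phi> within X)"
      by (rule field_vector_diff_chain_within) (auto intro: DERIV_subset DERIV_exp)
    then show ?thesis unfolding e_def[abs_def] o_def by simp
  qed
  have "((\<lambda>\<phi>. e \<phi> * of_real (A' \<phi>) + (- \<i> * of_real (\<rho> * sin \<phi>)) * e \<phi> * of_real (A \<phi>)) has_integral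
      (e (2*pi) * of_real (A (2*pi)) - e 0 * of_real (A 0))) {0..2*pi}"
  proof (rule fundamental_theorem_of_calculus)
    fix \<phi>
    have "((\<lambda>x. complex_of_real (A x)) has_vector_derivative of_real (A' \<phi>)) (at \<phi> within {0..2*pi})"
      using dA by (intro has_vector_derivative_of_real) (simp add: has_real_derivative_iff_has_vector_derivative)
    from has_vector_derivative_mult[OF de this]
    show "((\<lambda>x. e x * of_real (A x)) has_vector_derivative
        e \<phi> * of_real (A' \<phi>) + (- \<i> * of_real (\<rho> * sin \<phi>)) * e \<phi> * of_real (A \<phi>)) (at \<phi> within {0..2*pi})" .
  qed simp
  then have int0: "integral {0..2*pi} (\<lambda>\<phi>. e \<phi> * of_real (A' \<phi>) + (- \<i> * of_real (\<rho> * sin \<phi>)) * e \<phi> * of_real (A \<phi>)) = 0"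
    by (intro integral_unique) (simp add: A_def)
  have split: "e \<phi> * of_real (A' \<phi>) + (- \<i> * of_real (\<rho> * sin \<phi>)) * e \<phi> * of_real (A \<phi>) =
      e \<phi> * of_real (A' \<phi>) - (\<i> * \<rho>) * (e \<phi> - e \<phi> * of_real (D \<phi>))" for \<phi>
  proof -
    have "sin \<phi> * A \<phi> = 1 - D \<phi>"
      using ne[of \<phi>] by (simp add: A_def D_def field_simps power2_eq_square)
    then have "of_real (sin \<phi>) * of_real (A \<phi>) = 1 - complex_of_real (D \<phi>)"
      by (metis of_real_mult of_real_diff of_real_1)
    moreover have "e \<phi> * of_real (A' \<phi>) + (- \<i> * of_real (\<rho> * sin \<phi>)) * e \<phi> * of_real (A \<phi>) =
        e \<phi> * of_real (A' \<phi>) - (\<i> * \<rho>) * (e \<phi> * (of_real (sin \<phi>) * of_real (A \<phi>)))"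
      by (simp add: algebra_simps)
    ultimately show ?thesis by (simp add: right_diff_distrib)
  qed
  have eq0: "integral {0..2*pi} (\<lambda>\<phi>. e \<phi> * of_real (A' \<phi>) - (\<i> * \<rho>) * (e \<phi> - e \<phi> * of_real (D \<phi>))) = 0"
    using int0 unfolding split .
  have eq1: "integral {0..2*pi} (\<lambda>\<phi>. e \<phi> * of_real (A' \<phi>) - (\<i> * \<rho>) * (e \<phi> - e \<phi> * of_real (D \<phi>))) =
      integral {0..2*pi} (\<lambda>\<phi>. e \<phi> * of_real (A' \<phi>)) -
      (\<i> * \<rho>) * (integral {0..2*pi} e - integral {0..2*pi} (\<lambda>\<phi>. e \<phi> * of_real (D \<phi>)))"
  proof -
    have i1: "(\<lambda>\<phi>. e \<phi> * of_real (A' \<phi>)) integrable_on {0..2*pi}"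
      and i2: "e integrable_on {0..2*pi}" and i3: "(\<lambda>\<phi>. e \<phi> * of_real (D \<phi>)) integrable_on {0..2*pi}"
      by (intro integrable_continuous_interval continuous_intros ce cA' cD)+
    have i4: "(\<lambda>\<phi>. (\<i> * \<rho>) * (e \<phi> - e \<phi> * of_real (D \<phi>))) integrable_on {0..2*pi}"
      by (intro integrable_continuous_interval continuous_intros ce cD)
    show ?thesis
      by (simp only: Henstock_Kurzweil_Integration.integral_diff[OF i1 i4]
          Henstock_Kurzweil_Integration.integral_mult_right
          Henstock_Kurzweil_Integration.integral_diff[OF i2 i3])
  qed
  have eq: "integral {0..2*pi} e =
      integral {0..2*pi} (\<lambda>\<phi>. e \<phi> * of_real (D \<phi>)) + integral {0..2*pi} (\<lambda>\<phi>. e \<phi> * of_real (A' \<phi>)) / (\<i> * \<rho>)"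
    using eq0 \<rho> unfolding eq1 by (simp add: field_simps)
  have e1: "cmod (e \<phi>) = 1" for \<phi> unfolding e_def by (rule norm_exp_i_times)
  have "0 \<le> D \<phi>" for \<phi> using pos[of \<phi>] \<delta> by (simp add: D_def)
  with e1 have 1: "cmod (integral {0..2*pi} (\<lambda>\<phi>. e \<phi> * of_real (D \<phi>))) \<le> integral {0..2*pi} D"
    by (intro integral_norm_bound_integral integrable_continuous_interval continuous_intros ce cD)
      (auto simp: norm_mult)
  have A'_le: "\<bar>A' \<phi>\<bar> \<le> 1 / \<delta>" for \<phi>
  proof -
    have "\<bar>A' \<phi>\<bar> = \<bar>cos \<phi>\<bar> * \<bar>\<delta> - (sin \<phi>)\<^sup>2\<bar> / ((sin \<phi>)\<^sup>2 + \<delta>)\<^sup>2"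
      by (simp add: A'_def abs_mult)
    also have "\<dots> \<le> 1 * ((sin \<phi>)\<^sup>2 + \<delta>) / ((sin \<phi>)\<^sup>2 + \<delta>)\<^sup>2"
      using \<delta> by (intro divide_right_mono mult_mono) (auto simp: abs_le_iff)
    also have "\<dots> = 1 / ((sin \<phi>)\<^sup>2 + \<delta>)" using ne[of \<phi>] by (simp add: power2_eq_square)
    also have "\<dots> \<le> 1 / \<delta>" using \<delta> by (intro divide_left_mono mult_pos_pos pos) auto
    finally show ?thesis .
  qed
  have "cmod (integral {0..2*pi} (\<lambda>\<phi>. e \<phi> * of_real (A' \<phi>))) \<le> integral {0..2*pi} (\<lambda>\<phi>. 1 / \<delta>)"
    using A'_le e1
    by (intro integral_norm_bound_integral integrable_continuous_interval continuous_intros ce cA')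
      (auto simp: norm_mult)
  then have "cmod (integral {0..2*pi} (\<lambda>\<phi>. e \<phi> * of_real (A' \<phi>))) / \<rho> \<le> (2 * pi / \<delta>) / \<rho>"
    using \<rho> by (intro divide_right_mono) simp_all
  then have 2: "cmod (integral {0..2*pi} (\<lambda>\<phi>. e \<phi> * of_real (A' \<phi>)) / (\<i> * \<rho>)) \<le> 2 * pi / (\<delta> * \<rho>)"
    using \<rho> by (simp add: norm_divide norm_mult)
  show ?thesis
    using norm_triangle_mono[OF 1 2] unfolding e_def[symmetric] eq D_def[abs_def] .
qed

text \<open>
  By rotation invariance only \<open>z = (\<rho>, 0)\<close> matters. First \<open>\<delta>\<close> is chosen to make the part near the
  stationary points small, and then \<open>\<rho>\<close> large relative to \<open>1 / \<delta>\<close>.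
\<close>

lemma bessel_decay:
  assumes "\<epsilon> > 0"
  shows "\<exists>K. \<forall>z. norm z > K \<longrightarrow> cmod (bessel z) < \<epsilon>"
proof -
  obtain n where n: "integral {0..2*pi} (\<lambda>\<phi>. inverse (real (Suc n)) / ((sin \<phi>)\<^sup>2 + inverse (real (Suc n)))) < \<epsilon>"
    using eventually_happens'[OF sequentially_bot order_tendstoD(2)[OF resonant_part_tendsto_0 assms]] by blast
  define \<delta> where "\<delta> = inverse (real (Suc n))"
  have \<delta>: "\<delta> > 0" by (simp add: \<delta>_def)
  show ?thesis
  proof (intro exI allI impI)
    fix z :: "real^2" assume z: "norm z > max 0 (2 * pi / (\<delta> * \<epsilon>))"
    obtain R where R: "R \<in> SO2" "z = R *v vector [norm z, 0]" by (rule polar_SO2)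
    let ?v = "vector [norm z, 0] :: real^2"
    have "bessel z = bessel ?v" using bessel_rotate[OF R(1), of ?v] R(2) by simp
    also have "\<dots> = (1 / (2 * pi)) *\<^sub>R integral {0..2*pi} (\<lambda>\<phi>. exp (\<i> * of_real (norm z * cos \<phi>)))"
      unfolding bessel_def haar_integral[OF continuous_on_plane_wave_right]
      by (simp add: plane_wave_eq vector_2 mult.commute)
    finally have "cmod (bessel z) * (2 * pi) = cmod (integral {0..2*pi} (\<lambda>\<phi>. exp (\<i> * of_real (norm z * cos \<phi>))))"
      by simp
    also have "\<dots> \<le> integral {0..2*pi} (\<lambda>\<phi>. \<delta> / ((sin \<phi>)\<^sup>2 + \<delta>)) + 2 * pi / (\<delta> * norm z)"
      using z \<delta> by (intro oscillatory_integral_bound) auto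
    also have "2 * pi / (\<delta> * norm z) < \<epsilon>"
    proof -
      have "0 < norm z" "2 * pi / (\<delta> * \<epsilon>) < norm z" using z by (simp_all only: max_less_iff_conj)
      then have "2 * pi < norm z * (\<delta> * \<epsilon>)" using \<delta> assms by (simp add: pos_divide_less_eq)
      then show ?thesis using \<delta> \<open>0 < norm z\<close> by (simp add: pos_divide_less_eq mult_ac)
    qed
    also have "integral {0..2*pi} (\<lambda>\<phi>. \<delta> / ((sin \<phi>)\<^sup>2 + \<delta>)) + \<epsilon> < 2 * \<epsilon>"
      using n by (simp add: \<delta>_def)
    also have "2 * \<epsilon> \<le> \<epsilon> * (2 * pi)"
      using assms pi_gt3 by simp
    finally show "cmod (bessel z) < \<epsilon>" by simp
  qed
qed

section \<open>Totality of the plane waves\<close>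

inductive_set plane_wave_span :: "(real^2^2 \<Rightarrow> complex) set" where
  wave: "plane_wave x \<in> plane_wave_span"
| add: "f \<in> plane_wave_span \<Longrightarrow> g \<in> plane_wave_span \<Longrightarrow> (\<lambda>S. f S + g S) \<in> plane_wave_span"
| scale: "f \<in> plane_wave_span \<Longrightarrow> (\<lambda>S. c * f S) \<in> plane_wave_span"

lemma continuous_on_plane_wave_span: "f \<in> plane_wave_span \<Longrightarrow> continuous_on A f"
proof (induction rule: plane_wave_span.induct)
  case (wave x)
  show ?case by (rule continuous_on_plane_wave_right)
next
  case (add f g)
  then show ?case by (intro continuous_on_add)
next
  case (scale f c)
  then show ?case by (intro continuous_on_mult_left)
qed

lemma plane_wave_span_cnj: "f \<in> plane_wave_span \<Longrightarrow> (\<lambda>S. cnj (f S)) \<in> plane_wave_span"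
proof (induction rule: plane_wave_span.induct)
  case (wave x)
  show ?case unfolding cnj_plane_wave by (rule plane_wave_span.wave)
next
  case (add f g)
  show ?case unfolding complex_cnj_add by (rule plane_wave_span.add[OF add.IH])
next
  case (scale f c)
  show ?case unfolding complex_cnj_mult by (rule plane_wave_span.scale[OF scale.IH])
qed

lemma plane_wave_span_wave_mult:
  "f \<in> plane_wave_span \<Longrightarrow> (\<lambda>S. plane_wave x S * f S) \<in> plane_wave_span"
proof (induction rule: plane_wave_span.induct)
  case (scale f c)
  show ?case
    unfolding mult.left_commute[of "plane_wave x _" c] by (rule plane_wave_span.scale[OF scale.IH])
next
  case (wave y)
  show ?case unfolding plane_wave_add[symmetric] by (rule plane_wave_span.wave)
next
  case (add f g)
  show ?case unfolding distrib_left by (rule plane_wave_span.add[OF add.IH])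
qed

lemma plane_wave_span_mult:
  "f \<in> plane_wave_span \<Longrightarrow> g \<in> plane_wave_span \<Longrightarrow> (\<lambda>S. f S * g S) \<in> plane_wave_span"
proof (induction rule: plane_wave_span.induct)
  case (scale f c)
  show ?case
    unfolding mult.assoc by (rule plane_wave_span.scale[OF scale.IH[OF scale.prems]])
next
  case (wave y)
  then show ?case by (rule plane_wave_span_wave_mult)
next
  case (add f h)
  show ?case
    unfolding distrib_right by (rule plane_wave_span.add[OF add.IH(1)[OF add.prems] add.IH(2)[OF add.prems]])
qed

text \<open>
  The real parts of the span form an algebra, because \<open>e\<^sub>x e\<^sub>y = e\<^bsub>x+y\<^esub>\<close> and the span is closed under
  conjugation. The functions \<open>sin(u\<^sub>1)\<close> and \<open>sin(u\<^sub>2)\<close> separate the points \<open>u\<close> of the circle, since \<open>sin\<close>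
  is injective on \<open>[-1, 1]\<close>. The approximants can be taken real, so that they are themselves in the span
  and not only real parts of its elements.
\<close>

lemma plane_wave_span_approx:
  assumes g: "continuous_on SO2 g" and "\<epsilon> > 0"
  shows "\<exists>f\<in>plane_wave_span. \<forall>S\<in>SO2. \<bar>g S - Re (f S)\<bar> < \<epsilon> \<and> Im (f S) = 0"
proof -
  let ?R = "{\<lambda>S. Re (f S) | f. f \<in> plane_wave_span}"
  have real: "\<exists>f'\<in>plane_wave_span. (\<forall>S. f' S = of_real (Re (f S)))" if "f \<in> plane_wave_span" for f
    using plane_wave_span.scale[OF plane_wave_span.add[OF that plane_wave_span_cnj[OF that]], of "1/2"]
    unfolding complex_add_cnj by (rule rev_bexI) simp
  have const: "(\<lambda>S. c) \<in> plane_wave_span" for c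
    using plane_wave_span.scale[OF plane_wave_span.wave[of 0], of c] by simp
  interpret function_ring_on ?R SO2
  proof
    show "compact SO2" by (rule compact_SO2)
    show "continuous_on SO2 f" if "f \<in> ?R" for f
      using that continuous_on_Re[OF continuous_on_plane_wave_span] by blast
    show "(\<lambda>S. f S + h S) \<in> ?R" if fh: "f \<in> ?R" "h \<in> ?R" for f h
    proof -
      obtain f' h' where f': "f' \<in> plane_wave_span" "f = (\<lambda>S. Re (f' S))"
          and h': "h' \<in> plane_wave_span" "h = (\<lambda>S. Re (h' S))" using fh by blast
      show ?thesis
        by (intro CollectI exI[of _ "\<lambda>S. f' S + h' S"])
          (simp add: f' h' plane_wave_span.add)
    qed
    show "(\<lambda>_. c) \<in> ?R" for c
      using const[of "of_real c"] by (intro CollectI exI[of _ "\<lambda>_. complex_of_real c"]) simp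
    show "(\<lambda>S. f S * h S) \<in> ?R" if fh: "f \<in> ?R" "h \<in> ?R" for f h
    proof -
      obtain f' h' where f': "f' \<in> plane_wave_span" "f = (\<lambda>S. Re (f' S))"
          and h': "h' \<in> plane_wave_span" "h = (\<lambda>S. Re (h' S))" using fh by blast
      obtain f'' where f'': "f'' \<in> plane_wave_span" "\<forall>S. f'' S = of_real (Re (f' S))"
        using real[OF f'(1)] by (rule bexE)
      have "(\<lambda>S. f'' S * h' S) \<in> plane_wave_span"
        by (rule plane_wave_span_mult[OF f''(1) h'(1)])
      then show ?thesis
        by (intro CollectI exI[of _ "\<lambda>S. f'' S * h' S"]) (simp add: f'' f'(2) h'(2))
    qed
    show "\<exists>f\<in>?R. f S \<noteq> f S'" if S: "S \<in> SO2" "S' \<in> SO2" "S \<noteq> S'" for S S'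
    proof (rule ccontr)
      assume "\<not> (\<exists>f\<in>?R. f S \<noteq> f S')"
      then have eq: "Re (f S) = Re (f S')" if "f \<in> plane_wave_span" for f
      proof -
        have "(\<lambda>S. Re (f S)) \<in> ?R" using that by blast
        with \<open>\<not> (\<exists>f\<in>?R. f S \<noteq> f S')\<close> show ?thesis by meson
      qed
      have sin_eq: "sin (T $ i $ 1) = Re (- \<i> * plane_wave (axis i 1) T)" for T :: "real^2^2" and i :: 2
      proof -
        have "T $ 1 $ 1 * axis i 1 $ 1 + T $ 2 $ 1 * axis i 1 $ 2 = T $ i $ 1"
          using exhaust_2[of i] by (auto simp: axis_def)
        then have "plane_wave (axis i 1) T = cis (T $ i $ 1)"
          unfolding plane_wave_eq by (simp only: cis_conv_exp)
        then show ?thesis by simp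
      qed
      have sin_SS': "sin (S $ i $ 1) = sin (S' $ i $ 1)" for i
        unfolding sin_eq
        by (rule eq[of "\<lambda>T. - \<i> * plane_wave (axis i 1) T"], rule plane_wave_span.scale, rule plane_wave_span.wave)
      have small: "- (pi / 2) \<le> T $ i $ 1" "T $ i $ 1 \<le> pi / 2" if T: "T \<in> SO2" for T i
      proof -
        obtain \<theta> where "0 \<le> \<theta>" "\<theta> < 2 * pi" "T = rot \<theta>" using T by (rule SO2_cases)
        then have "\<bar>T $ i $ 1\<bar> \<le> 1" using exhaust_2[of i] by auto
        then show "- (pi / 2) \<le> T $ i $ 1" "T $ i $ 1 \<le> pi / 2" using pi_gt3 by linarith+
      qed
      have eq1: "S $ i $ 1 = S' $ i $ 1" for i
        by (rule sin_inj_pi[OF small[OF S(1)] small[OF S(2)] sin_SS'])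
      obtain a where a: "0 \<le> a" "a < 2 * pi" "S = rot a" using S(1) by (rule SO2_cases)
      obtain b where b: "0 \<le> b" "b < 2 * pi" "S' = rot b" using S(2) by (rule SO2_cases)
      have "S = S'" using eq1[of 1] eq1[of 2] a(3) b(3) by (simp add: vec_eq_iff forall_2)
      then show False using S(3) by simp
    qed
  qed
  obtain h where h: "h \<in> ?R" "\<forall>S\<in>SO2. \<bar>g S - h S\<bar> < \<epsilon>"
    using Stone_Weierstrass_basic[OF g \<open>\<epsilon> > 0\<close>] by (rule bexE)
  obtain f where f: "f \<in> plane_wave_span" "h = (\<lambda>S. Re (f S))" using h(1) by blast
  obtain f' where f': "f' \<in> plane_wave_span" "\<forall>S. f' S = of_real (Re (f S))" using real[OF f(1)] by (rule bexE)
  show ?thesis using h(2) by (intro bexI[OF _ f'(1)]) (simp add: f'(2) f(2))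
qed

text \<open>
  Approximating the complex conjugate of \<open>g\<close> uniformly by the span shows that \<open>\<integral> \<bar>g\<bar>\<^sup>2\<close> is
  arbitrarily small.
\<close>

lemma plane_waves_total:
  assumes g: "continuous_on SO2 g" and orth: "\<And>y. (\<integral>S. g S * plane_wave y S \<partial>haar_SO2) = 0"
    and S: "S \<in> SO2"
  shows "g S = 0"
proof -
  interpret prob_space haar_SO2 by (rule prob_space_haar_SO2)
  obtain B where B: "\<And>S. S \<in> SO2 \<Longrightarrow> cmod (g S) \<le> B" "B > 0"
    using compact_imp_bounded[OF compact_continuous_image[OF g compact_SO2]]
    by (auto simp: bounded_pos)
  have int: "integrable haar_SO2 f" if f: "continuous_on SO2 f" for f :: "real^2^2 \<Rightarrow> complex"
  proof -
    obtain C where C: "\<forall>S\<in>SO2. cmod (f S) \<le> C"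
      using compact_imp_bounded[OF compact_continuous_image[OF f compact_SO2]]
      by (auto simp: bounded_pos)
    show ?thesis
      by (rule integrable_const_bound[of _ C])
        (use C in \<open>auto intro!: borel_measurable_haar_SO2 f\<close>)
  qed
  have orth': "(\<integral>S. g S * f S \<partial>haar_SO2) = 0" if "f \<in> plane_wave_span" for f
    using that
  proof (induction rule: plane_wave_span.induct)
    case (add f h)
    have "integrable haar_SO2 (\<lambda>S. g S * f S)" "integrable haar_SO2 (\<lambda>S. g S * h S)"
      by (rule int[OF continuous_on_mult[OF g continuous_on_plane_wave_span]], rule add.hyps)+
    then show ?case unfolding distrib_left by (simp add: add.IH)
  next
    case (scale f c)
    show ?case unfolding mult.left_commute[of "g _" c] by (simp add: scale.IH)
  qed (rule orth)
  have small: "cmod (\<integral>S. g S * cnj (g S) \<partial>haar_SO2) \<le> B * (2 * \<epsilon>)" if \<epsilon>: "\<epsilon> > 0" for \<epsilon>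
  proof -
    obtain p where p: "p \<in> plane_wave_span" "\<And>S. S \<in> SO2 \<Longrightarrow> \<bar>Re (g S) - Re (p S)\<bar> < \<epsilon> \<and> Im (p S) = 0"
      using plane_wave_span_approx[OF continuous_on_Re[OF g] \<epsilon>] by blast
    obtain q where q: "q \<in> plane_wave_span" "\<And>S. S \<in> SO2 \<Longrightarrow> \<bar>Im (g S) - Re (q S)\<bar> < \<epsilon> \<and> Im (q S) = 0"
      using plane_wave_span_approx[OF continuous_on_Im[OF g] \<epsilon>] by blast
    let ?f = "\<lambda>S. p S + (- \<i>) * q S"
    have f: "?f \<in> plane_wave_span" by (intro plane_wave_span.intros p q)
    have cf: "continuous_on SO2 ?f" by (rule continuous_on_plane_wave_span[OF f])
    have close: "cmod (cnj (g S) - ?f S) \<le> 2 * \<epsilon>" if "S \<in> SO2" for S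
    proof -
      have "cmod (cnj (g S) - ?f S) \<le> \<bar>Re (cnj (g S) - ?f S)\<bar> + \<bar>Im (cnj (g S) - ?f S)\<bar>"
        by (rule cmod_le)
      also have "\<dots> \<le> 2 * \<epsilon>"
        using p(2)[OF that] q(2)[OF that] abs_minus_commute[of "Re (q S)" "Im (g S)"] by simp
      finally show ?thesis .
    qed
    have "(\<integral>S. g S * cnj (g S) \<partial>haar_SO2) = (\<integral>S. g S * cnj (g S) \<partial>haar_SO2) - (\<integral>S. g S * ?f S \<partial>haar_SO2)"
      using orth'[OF f] by simp
    also have "\<dots> = (\<integral>S. g S * cnj (g S) - g S * ?f S \<partial>haar_SO2)"
      by (intro Bochner_Integration.integral_diff[symmetric] int continuous_intros g cf)
    also have "cmod \<dots> \<le> (\<integral>S. cmod (g S * cnj (g S) - g S * ?f S) \<partial>haar_SO2)"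
      by simp
    also have "\<dots> \<le> (\<integral>S. B * (2 * \<epsilon>) \<partial>haar_SO2)"
    proof (rule integral_mono)
      show "integrable haar_SO2 (\<lambda>S. cmod (g S * cnj (g S) - g S * ?f S))"
        by (intro integrable_norm int continuous_intros g cf)
      show "cmod (g S * cnj (g S) - g S * ?f S) \<le> B * (2 * \<epsilon>)" if "S \<in> space haar_SO2" for S
        unfolding right_diff_distrib[symmetric] norm_mult
        using that B close \<open>\<epsilon> > 0\<close> by (intro mult_mono) auto
    qed simp
    finally show ?thesis using prob_space by simp
  qed
  have "(\<integral>S. g S * cnj (g S) \<partial>haar_SO2) = 0"
  proof (rule ccontr)
    assume "(\<integral>S. g S * cnj (g S) \<partial>haar_SO2) \<noteq> 0"
    then have "cmod (\<integral>S. g S * cnj (g S) \<partial>haar_SO2) > 0" by simp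
    with small[of "cmod (\<integral>S. g S * cnj (g S) \<partial>haar_SO2) / (4 * B)"] \<open>B > 0\<close> show False
      by simp
  qed
  moreover have "(\<integral>S. g S * cnj (g S) \<partial>haar_SO2) = of_real (\<integral>S. (cmod (g S))\<^sup>2 \<partial>haar_SO2)"
    by (simp only: complex_norm_square[symmetric] integral_complex_of_real of_real_power[symmetric])
  ultimately have "(\<integral>S. (cmod (g S))\<^sup>2 \<partial>haar_SO2) = 0" by (simp del: of_real_power)
  then have "(cmod (g S))\<^sup>2 = 0"
    using S by (intro haar_nonneg_integral_0[of "\<lambda>S. (cmod (g S))\<^sup>2"]) (auto intro!: continuous_intros g)
  then show ?thesis by simp
qed

section \<open>The representations \<open>U\<^sub>r\<close> of the measure algebra\<close>

lemma carrier_SE2: "carrier SE2 = UNIV \<times> SO2"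
  by (simp add: SE2_def)

lemma mult_SE2: "s \<otimes>\<^bsub>SE2\<^esub> t = (fst s + snd s *v fst t, snd s ** snd t)"
  by (simp add: SE2_def case_prod_unfold)

lemma closed_carrier_SE2: "closed (carrier SE2)"
  unfolding carrier_SE2 by (rule closed_Times[OF closed_UNIV compact_imp_closed[OF compact_SO2]])

lemma meas_alg_SE2: "meas_alg SE2 = {\<mu>. complex_measure (borel_on SE2) \<mu>}"
  by (rule meas_alg_eq[OF closed_carrier_SE2])

lemma borel_on_SE2: "borel_on SE2 = restrict_space borel (UNIV \<times> SO2)"
  by (simp add: borel_on_def carrier_SE2)

lemma measurable_continuous_pair:
  fixes F :: "'a::second_countable_topology \<times> 'b::second_countable_topology \<Rightarrow> 'c::topological_space"
  assumes M: "sets M = sets (restrict_space borel A)" and N: "sets N = sets (restrict_space borel B)"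
    and F: "continuous_on UNIV F"
  shows "F \<in> M \<Otimes>\<^sub>M N \<rightarrow>\<^sub>M borel"
proof -
  have [measurable]: "(\<lambda>x. x) \<in> M \<rightarrow>\<^sub>M borel" "(\<lambda>x. x) \<in> N \<rightarrow>\<^sub>M borel"
    unfolding measurable_cong_sets[OF M refl] measurable_cong_sets[OF N refl]
    by (auto intro: measurable_restrict_space1)
  have "(\<lambda>p. (fst p, snd p)) \<in> M \<Otimes>\<^sub>M N \<rightarrow>\<^sub>M borel \<Otimes>\<^sub>M borel"
    by (intro measurable_Pair measurable_compose[OF measurable_fst] measurable_compose[OF measurable_snd])
      measurable
  then have "(\<lambda>p. p) \<in> M \<Otimes>\<^sub>M N \<rightarrow>\<^sub>M borel"
    by (simp add: borel_prod)
  from measurable_compose[OF this borel_measurable_continuous_onI[OF F]] show ?thesis .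
qed

lemmas sets_SE2 = arg_cong[OF borel_on_SE2, of sets]

lemma measurable_mult_SE2 [measurable]:
  "(\<lambda>(s, t). s \<otimes>\<^bsub>SE2\<^esub> t) \<in> borel_on SE2 \<Otimes>\<^sub>M borel_on SE2 \<rightarrow>\<^sub>M borel_on SE2"
proof -
  have c: "continuous_on UNIV (\<lambda>p :: ((real^2) \<times> (real^2^2)) \<times> (real^2) \<times> (real^2^2).
      (fst (fst p) + snd (fst p) *v fst (snd p), snd (fst p) ** snd (snd p)))"
    by (intro continuous_intros)
  have "(\<lambda>(s, t). s \<otimes>\<^bsub>SE2\<^esub> t) \<in> borel_on SE2 \<Otimes>\<^sub>M borel_on SE2 \<rightarrow>\<^sub>M restrict_space borel (UNIV \<times> SO2)"
  proof (rule measurable_restrict_space2)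
    show "(\<lambda>(s, t). s \<otimes>\<^bsub>SE2\<^esub> t) \<in> space (borel_on SE2 \<Otimes>\<^sub>M borel_on SE2) \<rightarrow> UNIV \<times> SO2"
      by (auto simp: space_pair_measure carrier_SE2 mult_SE2)
    show "(\<lambda>(s, t). s \<otimes>\<^bsub>SE2\<^esub> t) \<in> borel_on SE2 \<Otimes>\<^sub>M borel_on SE2 \<rightarrow>\<^sub>M borel"
      using measurable_continuous_pair[OF sets_SE2 sets_SE2 c] by (simp add: mult_SE2 split_beta')
  qed
  then show ?thesis by (simp only: borel_on_SE2[symmetric])
qed

lemma measurable_action_SO2:
  "(\<lambda>(t, S). transpose (snd t) ** S) \<in> borel_on SE2 \<Otimes>\<^sub>M haar_SO2 \<rightarrow>\<^sub>M haar_SO2"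
proof -
  have c: "continuous_on UNIV (\<lambda>p :: ((real^2) \<times> (real^2^2)) \<times> (real^2^2). transpose (snd (fst p)) ** snd p)"
    by (intro continuous_intros)
  have "(\<lambda>(t, S). transpose (snd t) ** S) \<in> borel_on SE2 \<Otimes>\<^sub>M haar_SO2 \<rightarrow>\<^sub>M restrict_space borel SO2"
  proof (rule measurable_restrict_space2)
    show "(\<lambda>(t, S). transpose (snd t) ** S) \<in> space (borel_on SE2 \<Otimes>\<^sub>M haar_SO2) \<rightarrow> SO2"
      by (auto simp: space_pair_measure carrier_SE2)
    show "(\<lambda>(t, S). transpose (snd t) ** S) \<in> borel_on SE2 \<Otimes>\<^sub>M haar_SO2 \<rightarrow>\<^sub>M borel"
      using measurable_continuous_pair[OF sets_SE2 sets_haar_SO2 c] by (simp add: split_beta')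
  qed
  then show ?thesis unfolding measurable_cong_sets[OF refl sets_haar_SO2] .
qed

text \<open>
  The value at \<open>S\<close> of \<open>U\<^sub>r(t)g\<close>, where \<open>U\<^sub>r\<close> is induced from the character \<open>x \<mapsto> exp(\<i> r x\<^sub>1)\<close>.
\<close>

definition rep_kernel :: "real \<Rightarrow> (real^2^2 \<Rightarrow> complex) \<Rightarrow> (real^2) \<times> (real^2^2) \<Rightarrow> real^2^2 \<Rightarrow> complex" where
  "rep_kernel r g t S = plane_wave (r *\<^sub>R fst t) S * g (transpose (snd t) ** S)"

text \<open>
  The operator \<open>U\<^sub>r(\<mu>)\<close>, applied pointwise to bounded functions. Working with functions instead of classes
  in \<open>L\<^sup>2\<close> makes suprema and values at single points meaningful.
\<close>

definition rep_op :: "real \<Rightarrow> (((real^2) \<times> (real^2^2)) set \<Rightarrow> complex) \<Rightarrow> (real^2^2 \<Rightarrow> complex) \<Rightarrow> real^2^2 \<Rightarrow> complex" where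
  "rep_op r \<mu> g S = cm_integral (borel_on SE2) \<mu> (\<lambda>t. rep_kernel r g t S)"

lemma rep_kernel_measurable:
  assumes g: "g \<in> borel_measurable haar_SO2"
  shows "(\<lambda>(t, S). rep_kernel r g t S) \<in> borel_measurable (borel_on SE2 \<Otimes>\<^sub>M haar_SO2)"
proof -
  have c: "continuous_on UNIV (\<lambda>p :: ((real^2) \<times> (real^2^2)) \<times> (real^2^2). plane_wave (r *\<^sub>R fst (fst p)) (snd p))"
    by (intro continuous_intros)
  have "(\<lambda>p. plane_wave (r *\<^sub>R fst (fst p)) (snd p)) \<in> borel_measurable (borel_on SE2 \<Otimes>\<^sub>M haar_SO2)"
    by (rule measurable_continuous_pair[OF sets_SE2 sets_haar_SO2 c])
  moreover have "(\<lambda>p. g (case p of (t, S) \<Rightarrow> transpose (snd t) ** S)) \<in> borel_measurable (borel_on SE2 \<Otimes>\<^sub>M haar_SO2)"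
    by (rule measurable_compose[OF measurable_action_SO2 g])
  ultimately show ?thesis
    unfolding rep_kernel_def split_beta' by (rule borel_measurable_times)
qed

lemma cmod_rep_kernel: "cmod (rep_kernel r g t S) = cmod (g (transpose (snd t) ** S))"
  by (simp add: rep_kernel_def norm_mult)

lemma action_in_SO2: "t \<in> carrier SE2 \<Longrightarrow> S \<in> SO2 \<Longrightarrow> transpose (snd t) ** S \<in> SO2"
  by (auto simp: carrier_SE2)

lemma rep_kernel_bounded_measurable:
  assumes g: "g \<in> bounded_measurable haar_SO2" and S: "S \<in> SO2"
  shows "(\<lambda>t. rep_kernel r g t S) \<in> bounded_measurable (borel_on SE2)"
proof -
  obtain B where B: "\<And>S. S \<in> space haar_SO2 \<Longrightarrow> cmod (g S) \<le> B" and m: "g \<in> borel_measurable haar_SO2"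
    using g by (rule bounded_measurableE) (rule that)
  show ?thesis
  proof (rule bounded_measurableI)
    have "(\<lambda>t. (t, S)) \<in> borel_on SE2 \<rightarrow>\<^sub>M borel_on SE2 \<Otimes>\<^sub>M haar_SO2"
      using S by (intro measurable_Pair2') simp
    from measurable_compose[OF this rep_kernel_measurable[OF m]]
    show "(\<lambda>t. rep_kernel r g t S) \<in> borel_measurable (borel_on SE2)" by simp
    show "cmod (rep_kernel r g t S) \<le> B" if "t \<in> space (borel_on SE2)" for t
      unfolding cmod_rep_kernel using that S by (intro B) (simp add: action_in_SO2)
  qed
qed

lemma rep_op_bounded_measurable:
  assumes \<mu>: "complex_measure (borel_on SE2) \<mu>" and g: "g \<in> bounded_measurable haar_SO2"
  shows "rep_op r \<mu> g \<in> bounded_measurable haar_SO2"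
proof -
  obtain B where B: "\<And>S. S \<in> space haar_SO2 \<Longrightarrow> cmod (g S) \<le> B" and m: "g \<in> borel_measurable haar_SO2"
    using g by (rule bounded_measurableE) (rule that)
  have "(\<lambda>S. cm_integral (borel_on SE2) \<mu> (\<lambda>t. rep_kernel r g t S)) \<in> bounded_measurable haar_SO2"
  proof (rule bounded_measurable_cm_integral[OF \<mu> rep_kernel_measurable[OF m]])
    show "cmod (rep_kernel r g t S) \<le> B" if "t \<in> space (borel_on SE2)" "S \<in> space haar_SO2" for t S
      unfolding cmod_rep_kernel using that by (intro B) (simp add: action_in_SO2)
  qed
  then show ?thesis unfolding rep_op_def[abs_def] .
qed

lemma rep_op_bound:
  assumes \<mu>: "complex_measure (borel_on SE2) \<mu>"
  shows "\<exists>C\<ge>0. \<forall>r. \<forall>g\<in>bounded_measurable haar_SO2. \<forall>B. (\<forall>S\<in>SO2. cmod (g S) \<le> B) \<longrightarrow>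
    (\<forall>S\<in>SO2. cmod (rep_op r \<mu> g S) \<le> C * B)"
proof -
  obtain C where "C \<ge> 0" and C: "\<forall>f\<in>borel_measurable (borel_on SE2). \<forall>B.
      (\<forall>x\<in>space (borel_on SE2). cmod (f x) \<le> B) \<longrightarrow> cmod (cm_integral (borel_on SE2) \<mu> f) \<le> C * B"
    using cm_integral_bound[OF \<mu>] by blast
  have "cmod (rep_op r \<mu> g S) \<le> C * B"
    if g: "g \<in> bounded_measurable haar_SO2" and B: "\<forall>S\<in>SO2. cmod (g S) \<le> B" and S: "S \<in> SO2" for r g B S
    unfolding rep_op_def
  proof (rule C[rule_format])
    show "(\<lambda>t. rep_kernel r g t S) \<in> borel_measurable (borel_on SE2)"
      by (rule bounded_measurable_measurable[OF rep_kernel_bounded_measurable[OF g S]])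
    show "cmod (rep_kernel r g t S) \<le> B" if "t \<in> space (borel_on SE2)" for t
      unfolding cmod_rep_kernel using that S B by (simp add: action_in_SO2)
  qed
  with \<open>C \<ge> 0\<close> show ?thesis by blast
qed

lemma rep_op_cong:
  assumes \<mu>: "complex_measure (borel_on SE2) \<mu>" and g: "g \<in> bounded_measurable haar_SO2"
    and eq: "\<And>S. S \<in> SO2 \<Longrightarrow> g S = h S" and S: "S \<in> SO2"
  shows "rep_op r \<mu> g S = rep_op r \<mu> h S"
  unfolding rep_op_def
  by (rule sigma_functional_cong[OF sigma_functional_cm_integral[OF \<mu>] rep_kernel_bounded_measurable[OF g S]])
    (simp add: rep_kernel_def eq action_in_SO2 S)

lemma rep_kernel_mult:
  "rep_kernel r g (s \<otimes>\<^bsub>SE2\<^esub> t) S =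
    plane_wave (r *\<^sub>R fst s) S * rep_kernel r g t (transpose (snd s) ** S)"
proof -
  have "r *\<^sub>R (fst s + snd s *v fst t) = r *\<^sub>R fst s + snd s *v (r *\<^sub>R fst t)"
    by (simp add: matrix_vector_mult_scaleR scaleR_add_right)
  then have "plane_wave (r *\<^sub>R fst (s \<otimes>\<^bsub>SE2\<^esub> t)) S =
      plane_wave (r *\<^sub>R fst s) S * plane_wave (r *\<^sub>R fst t) (transpose (snd s) ** S)"
    by (simp add: mult_SE2 plane_wave_add plane_wave_mult_right)
  moreover have "transpose (snd (s \<otimes>\<^bsub>SE2\<^esub> t)) ** S = transpose (snd t) ** (transpose (snd s) ** S)"
    by (simp add: mult_SE2 matrix_transpose_mul matrix_mul_assoc)
  ultimately show ?thesis by (simp add: rep_kernel_def)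
qed

lemma complex_measure_conv_SE2:
  assumes "complex_measure (borel_on SE2) \<mu>" "complex_measure (borel_on SE2) \<nu>"
  shows "complex_measure (borel_on SE2) (conv SE2 \<mu> \<nu>)"
  unfolding conv_eq_measure_of_functional
  by (rule complex_measure_measure_of_functional[OF sigma_functional_conv[OF assms measurable_mult_SE2]])

text \<open>Multiplicativity of \<open>U\<^sub>r\<close>. The two integrations occur in opposite orders, whence Fubini.\<close>

lemma rep_op_conv:
  assumes \<mu>: "complex_measure (borel_on SE2) \<mu>" and \<nu>: "complex_measure (borel_on SE2) \<nu>"
    and g: "g \<in> bounded_measurable haar_SO2" and S: "S \<in> SO2"
  shows "rep_op r (conv SE2 \<mu> \<nu>) g S = rep_op r \<mu> (rep_op r \<nu> g) S"
proof -
  let ?M = "borel_on SE2"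
  let ?k = "\<lambda>t s. rep_kernel r g (s \<otimes>\<^bsub>SE2\<^esub> t) S"
  obtain B where B: "\<And>t. t \<in> space ?M \<Longrightarrow> cmod (rep_kernel r g t S) \<le> B"
      and m: "(\<lambda>t. rep_kernel r g t S) \<in> borel_measurable ?M"
    using rep_kernel_bounded_measurable[OF g S] by (rule bounded_measurableE) (rule that)
  have mult_space: "s \<otimes>\<^bsub>SE2\<^esub> t \<in> space ?M" if "s \<in> space ?M" "t \<in> space ?M" for s t
    using that by (auto simp: carrier_SE2 mult_SE2)
  have "rep_op r (conv SE2 \<mu> \<nu>) g S = cm_integral ?M \<nu> (\<lambda>t. cm_integral ?M \<mu> (?k t))"
    unfolding rep_op_def conv_eq_measure_of_functional
    by (rule cm_integral_measure_of_functional[OF sigma_functional_conv[OF \<mu> \<nu> measurable_mult_SE2]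
          rep_kernel_bounded_measurable[OF g S]])
  also have "\<dots> = cm_integral ?M \<mu> (\<lambda>s. cm_integral ?M \<nu> (\<lambda>t. ?k t s))"
  proof (rule cm_integral_cm_integral_swap[OF \<nu> \<mu>])
    have "(\<lambda>(t, s). s \<otimes>\<^bsub>SE2\<^esub> t) \<in> ?M \<Otimes>\<^sub>M ?M \<rightarrow>\<^sub>M ?M"
      using measurable_compose[OF measurable_pair_swap' measurable_mult_SE2] by (simp add: split_beta')
    from measurable_compose[OF this m]
    show "(\<lambda>(t, s). ?k t s) \<in> borel_measurable (?M \<Otimes>\<^sub>M ?M)" by (simp add: split_beta')
    show "cmod (?k t s) \<le> B" if "t \<in> space ?M" "s \<in> space ?M" for t s
      using that by (intro B mult_space)
  qed
  also have "\<dots> = rep_op r \<mu> (rep_op r \<nu> g) S"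
    unfolding rep_op_def[of r \<mu>]
  proof (rule sigma_functional_cong[OF sigma_functional_cm_integral[OF \<mu>], symmetric])
    show "(\<lambda>t. rep_kernel r (rep_op r \<nu> g) t S) \<in> bounded_measurable ?M"
      by (rule rep_kernel_bounded_measurable[OF rep_op_bounded_measurable[OF \<nu> g] S])
    fix s assume "s \<in> space ?M"
    then have "transpose (snd s) ** S \<in> SO2" using S by (simp add: action_in_SO2)
    then show "rep_kernel r (rep_op r \<nu> g) s S = cm_integral ?M \<nu> (\<lambda>t. ?k t s)"
      unfolding rep_kernel_mult
      by (simp add: sigma_functional_cmult[OF sigma_functional_cm_integral[OF \<nu>]
            rep_kernel_bounded_measurable[OF g]] rep_op_def rep_kernel_def[of r "rep_op r \<nu> g"])
  qed
  finally show ?thesis .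
qed

lemma bounded_measurable_1: "(\<lambda>_. 1) \<in> bounded_measurable H"
  by (rule bounded_measurable_const)

lemma rep_op_sum:
  assumes \<mu>: "\<And>i. i \<in> I \<Longrightarrow> complex_measure (borel_on SE2) (\<mu> i)"
    and g: "g \<in> bounded_measurable haar_SO2" and S: "S \<in> SO2"
  shows "rep_op r (\<lambda>E. \<Sum>i\<in>I. c i * \<mu> i E) g S = (\<Sum>i\<in>I. c i * rep_op r (\<mu> i) g S)"
  unfolding rep_op_def by (rule cm_integral_sum[OF \<mu> rep_kernel_bounded_measurable[OF g S]])

lemma
  assumes \<mu>: "complex_measure (borel_on SE2) \<mu>" and \<nu>: "complex_measure (borel_on SE2) \<nu>"
  shows complex_measure_lincomb: "complex_measure (borel_on SE2) (\<lambda>E. a * \<mu> E + b * \<nu> E)"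
    and rep_op_lincomb: "g \<in> bounded_measurable haar_SO2 \<Longrightarrow> S \<in> SO2 \<Longrightarrow>
      rep_op r (\<lambda>E. a * \<mu> E + b * \<nu> E) g S = a * rep_op r \<mu> g S + b * rep_op r \<nu> g S"
proof -
  let ?\<mu> = "\<lambda>i::bool. if i then \<mu> else \<nu>" and ?c = "\<lambda>i. if i then a else b"
  have \<mu>': "complex_measure (borel_on SE2) (?\<mu> i)" for i using \<mu> \<nu> by simp
  have eq: "(\<lambda>E. a * \<mu> E + b * \<nu> E) = (\<lambda>E. \<Sum>i\<in>UNIV. ?c i * ?\<mu> i E)"
    by (simp add: UNIV_bool add.commute)
  show "complex_measure (borel_on SE2) (\<lambda>E. a * \<mu> E + b * \<nu> E)"
    unfolding eq by (rule complex_measure_sum[OF \<mu>'])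
  show "rep_op r (\<lambda>E. a * \<mu> E + b * \<nu> E) g S = a * rep_op r \<mu> g S + b * rep_op r \<nu> g S"
    if "g \<in> bounded_measurable haar_SO2" "S \<in> SO2"
    unfolding eq rep_op_sum[OF \<mu>' that] by (simp add: UNIV_bool add.commute)
qed

lemma rep_op_measure_of_functional:
  assumes "sigma_functional (borel_on SE2) L" "g \<in> bounded_measurable haar_SO2" "S \<in> SO2"
  shows "rep_op r (measure_of_functional (borel_on SE2) L) g S = L (\<lambda>t. rep_kernel r g t S)"
  unfolding rep_op_def
  by (rule cm_integral_measure_of_functional[OF assms(1) rep_kernel_bounded_measurable[OF assms(2,3)]])

lemma rep_kernel_1: "rep_kernel r (\<lambda>_. 1) t S = plane_wave (r *\<^sub>R fst t) S"
  by (simp add: rep_kernel_def)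

lemma continuous_on_rep_op_1:
  assumes \<mu>: "complex_measure (borel_on SE2) \<mu>"
  shows "continuous_on SO2 (rep_op r \<mu> (\<lambda>_. 1))"
  unfolding continuous_on_sequentially
proof (intro allI ballI impI)
  fix X S assume "S \<in> SO2" and X: "(\<forall>n. X n \<in> SO2) \<and> X \<longlonglongrightarrow> S"
  show "(rep_op r \<mu> (\<lambda>_. 1) \<circ> X) \<longlonglongrightarrow> rep_op r \<mu> (\<lambda>_. 1) S"
    unfolding o_def rep_op_def
  proof (rule sigma_functional_tendsto[OF sigma_functional_cm_integral[OF \<mu>]])
    show "(\<lambda>t. rep_kernel r (\<lambda>_. 1) t (X n)) \<in> borel_measurable (borel_on SE2)" for n
      using X by (intro bounded_measurable_measurable[OF rep_kernel_bounded_measurable[OF bounded_measurable_1]]) simp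
    show "(\<lambda>t. rep_kernel r (\<lambda>_. 1) t S) \<in> borel_measurable (borel_on SE2)"
      by (rule bounded_measurable_measurable[OF rep_kernel_bounded_measurable[OF bounded_measurable_1 \<open>S \<in> SO2\<close>]])
    show "cmod (rep_kernel r (\<lambda>_. 1) t (X n)) \<le> 1" for n t by (simp add: rep_kernel_1)
    show "(\<lambda>n. rep_kernel r (\<lambda>_. 1) t (X n)) \<longlonglongrightarrow> rep_kernel r (\<lambda>_. 1) t S" for t
      unfolding rep_kernel_1
      using X by (intro continuous_on_tendsto_compose[where s=UNIV, OF continuous_on_plane_wave_right]) auto
  qed
qed

lemma tendsto_rep_op:
  assumes \<mu>: "complex_measure (borel_on SE2) \<mu>" and r: "r \<longlonglongrightarrow> l" and S: "S \<in> SO2"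
  shows "(\<lambda>n. rep_op (r n) \<mu> (\<lambda>_. 1) S) \<longlonglongrightarrow> rep_op l \<mu> (\<lambda>_. 1) S"
  unfolding rep_op_def
proof (rule sigma_functional_tendsto[OF sigma_functional_cm_integral[OF \<mu>]])
  show "(\<lambda>t. rep_kernel (r n) (\<lambda>_. 1) t S) \<in> borel_measurable (borel_on SE2)"
      "(\<lambda>t. rep_kernel l (\<lambda>_. 1) t S) \<in> borel_measurable (borel_on SE2)" for n
    by (rule bounded_measurable_measurable[OF rep_kernel_bounded_measurable[OF bounded_measurable_1 S]])+
  show "cmod (rep_kernel (r n) (\<lambda>_. 1) t S) \<le> 1" for n t by (simp add: rep_kernel_1)
  show "(\<lambda>n. rep_kernel (r n) (\<lambda>_. 1) t S) \<longlonglongrightarrow> rep_kernel l (\<lambda>_. 1) t S" for t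
  proof -
    have "continuous_on UNIV (\<lambda>a. plane_wave (a *\<^sub>R fst t) S)"
      by (intro continuous_on_plane_wave continuous_on_scaleR continuous_on_id continuous_on_const)
    from continuous_on_tendsto_compose[OF this r] show ?thesis by (simp add: rep_kernel_1)
  qed
qed

section \<open>The annihilator of the constant function\<close>

text \<open>The ideal of both parts of the theorem.\<close>

abbreviation "J1 \<equiv> J_U (\<lambda>_. 1)"

lemma ind_rep_1: "ind_rep char_e1 t (\<lambda>_. 1) S = plane_wave (fst t) S"
  by (simp add: ind_rep_def plane_wave_def split_beta)

lemma plane_wave_L2: "plane_wave y \<in> L2 haar_SO2"
proof -
  interpret prob_space haar_SO2 by (rule prob_space_haar_SO2)
  show ?thesis
    unfolding L2_def by (simp add: borel_measurable_haar_SO2[OF continuous_on_plane_wave_right])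
qed

lemma L2_integrable:
  assumes "\<zeta> \<in> L2 haar_SO2"
  shows "integrable haar_SO2 (\<lambda>S. cmod (\<zeta> S))"
proof -
  interpret prob_space haar_SO2 by (rule prob_space_haar_SO2)
  have m [measurable]: "\<zeta> \<in> borel_measurable haar_SO2" and i: "integrable haar_SO2 (\<lambda>S. (cmod (\<zeta> S))\<^sup>2)"
    using assms by (simp_all add: L2_def)
  show ?thesis
  proof (rule Bochner_Integration.integrable_bound)
    show "integrable haar_SO2 (\<lambda>S. 1 + (cmod (\<zeta> S))\<^sup>2)"
      using i by (intro Bochner_Integration.integrable_add) simp_all
    show "AE S in haar_SO2. norm (cmod (\<zeta> S)) \<le> norm (1 + (cmod (\<zeta> S))\<^sup>2)"
    proof (rule AE_I2)
      fix S
      have "cmod (\<zeta> S) \<le> 1 + (cmod (\<zeta> S))\<^sup>2"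
        using sum_squares_bound[of 1 "cmod (\<zeta> S)"] by (simp add: power2_eq_square) (smt (verit) norm_ge_zero)
      then show "norm (cmod (\<zeta> S)) \<le> norm (1 + (cmod (\<zeta> S))\<^sup>2)" by simp
    qed
  qed measurable
qed

text \<open>The weak integral is tested against the plane wave \<open>e\<^bsub>-y\<^esub>\<close>.\<close>

lemma annihilator_imp_bessel:
  assumes "\<mu> \<in> J1"
  shows "cm_integral (borel_on SE2) \<mu> (\<lambda>t. bessel (fst t + y)) = 0"
proof -
  have "has_weak_integral SE2 haar_SO2 (ind_rep char_e1) \<mu> (\<lambda>_. 1) (\<lambda>_. 0)"
    using assms by (simp add: J_U_def annihilator_ideal_def)
  then have "L2_inner haar_SO2 (\<lambda>_. 0) (plane_wave (- y)) =
      cm_integral (borel_on SE2) \<mu> (\<lambda>t. L2_inner haar_SO2 (ind_rep char_e1 t (\<lambda>_. 1)) (plane_wave (- y)))"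
    using plane_wave_L2 unfolding has_weak_integral_def by blast
  then show ?thesis
    by (simp add: L2_inner_def ind_rep_1[abs_def] cnj_plane_wave bessel_def plane_wave_add)
qed

text \<open>By Fubini the hypothesis says that \<open>U(\<mu>)1\<close> is orthogonal to all plane waves.\<close>

lemma bessel_imp_rep_op:
  assumes \<mu>: "complex_measure (borel_on SE2) \<mu>"
    and b: "\<And>y. cm_integral (borel_on SE2) \<mu> (\<lambda>t. bessel (fst t + y)) = 0" and S: "S \<in> SO2"
  shows "rep_op 1 \<mu> (\<lambda>_. 1) S = 0"
proof (rule plane_waves_total[OF continuous_on_rep_op_1[OF \<mu>] _ S])
  fix y
  interpret prob_space haar_SO2 by (rule prob_space_haar_SO2)
  let ?k = "\<lambda>t S. rep_kernel 1 (\<lambda>_. 1) t S * plane_wave y S"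
  have k: "?k t S = plane_wave (fst t + y) S" for t S by (simp add: rep_kernel_1 plane_wave_add)
  have "continuous_on UNIV (\<lambda>p :: ((real^2) \<times> (real^2^2)) \<times> (real^2^2). plane_wave (fst (fst p) + y) (snd p))"
    by (intro continuous_intros)
  from measurable_continuous_pair[OF sets_SE2 sets_haar_SO2 this]
  have m: "(\<lambda>(t, S). ?k t S) \<in> borel_measurable (borel_on SE2 \<Otimes>\<^sub>M haar_SO2)"
    by (simp add: k split_beta')
  have "(\<integral>S. rep_op 1 \<mu> (\<lambda>_. 1) S * plane_wave y S \<partial>haar_SO2) =
      (\<integral>S. cm_integral (borel_on SE2) \<mu> (\<lambda>t. ?k t S) \<partial>haar_SO2)"
  proof (rule Bochner_Integration.integral_cong[OF refl])
    fix S assume "S \<in> space haar_SO2"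
    then have S: "S \<in> SO2" by simp
    show "rep_op 1 \<mu> (\<lambda>_. 1) S * plane_wave y S = cm_integral (borel_on SE2) \<mu> (\<lambda>t. ?k t S)"
      using sigma_functional_cmult[OF sigma_functional_cm_integral[OF \<mu>]
          rep_kernel_bounded_measurable[OF bounded_measurable_1 S], of "plane_wave y S" 1]
      by (simp add: rep_op_def mult.commute)
  qed
  also have "\<dots> = cm_integral (borel_on SE2) \<mu> (\<lambda>t. \<integral>S. ?k t S \<partial>haar_SO2)"
    by (rule cm_integral_swap[OF \<mu> sigma_finite_measure_axioms m, where w="\<lambda>_. 1", symmetric])
      (simp_all add: k)
  also have "\<dots> = 0" using b[of y] by (simp add: k bessel_def)
  finally show "(\<integral>S. rep_op 1 \<mu> (\<lambda>_. 1) S * plane_wave y S \<partial>haar_SO2) = 0" .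
qed

lemma rep_op_imp_annihilator:
  assumes \<mu>: "complex_measure (borel_on SE2) \<mu>" and 0: "\<And>S. S \<in> SO2 \<Longrightarrow> rep_op 1 \<mu> (\<lambda>_. 1) S = 0"
  shows "\<mu> \<in> J1"
  unfolding J_U_def annihilator_ideal_def has_weak_integral_def
proof (intro CollectI conjI ballI)
  interpret prob_space haar_SO2 by (rule prob_space_haar_SO2)
  show "\<mu> \<in> meas_alg SE2" using \<mu> by (simp add: meas_alg_SE2)
  show "(\<lambda>_. 0) \<in> L2 haar_SO2" by (simp add: L2_def)
  fix \<zeta> assume \<zeta>: "\<zeta> \<in> L2 haar_SO2"
  then have m\<zeta>: "\<zeta> \<in> borel_measurable haar_SO2" by (simp add: L2_def)
  let ?k = "\<lambda>t S. rep_kernel 1 (\<lambda>_. 1) t S * cnj (\<zeta> S)"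
  have m: "(\<lambda>(t, S). ?k t S) \<in> borel_measurable (borel_on SE2 \<Otimes>\<^sub>M haar_SO2)"
  proof -
    have "(\<lambda>(t, S). rep_kernel 1 (\<lambda>_. 1) t S) \<in> borel_measurable (borel_on SE2 \<Otimes>\<^sub>M haar_SO2)"
      by (rule rep_kernel_measurable) simp
    moreover have "(\<lambda>p. cnj (\<zeta> (snd p))) \<in> borel_measurable (borel_on SE2 \<Otimes>\<^sub>M haar_SO2)"
      by (rule measurable_compose[OF measurable_compose[OF measurable_snd m\<zeta>] borel_measurable_continuous_onI[of cnj]])
        (intro continuous_intros)
    ultimately show ?thesis unfolding split_beta' by (rule borel_measurable_times)
  qed
  have "cm_integral (borel_on SE2) \<mu> (\<lambda>t. \<integral>S. ?k t S \<partial>haar_SO2) =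
      (\<integral>S. cm_integral (borel_on SE2) \<mu> (\<lambda>t. ?k t S) \<partial>haar_SO2)"
    by (rule cm_integral_swap[OF \<mu> sigma_finite_measure_axioms m L2_integrable[OF \<zeta>]])
      (simp add: norm_mult rep_kernel_1)
  also have "\<dots> = (\<integral>S. 0 \<partial>haar_SO2)"
  proof (rule Bochner_Integration.integral_cong[OF refl])
    fix S assume "S \<in> space haar_SO2"
    then have S: "S \<in> SO2" by simp
    show "cm_integral (borel_on SE2) \<mu> (\<lambda>t. ?k t S) = 0"
      using sigma_functional_cmult[OF sigma_functional_cm_integral[OF \<mu>]
          rep_kernel_bounded_measurable[OF bounded_measurable_1 S], of "cnj (\<zeta> S)" 1] 0[OF S]
      by (simp add: rep_op_def mult.commute)
  qed
  finally show "L2_inner haar_SO2 (\<lambda>_. 0) \<zeta> =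
      cm_integral (borel_on SE2) \<mu> (\<lambda>t. L2_inner haar_SO2 (ind_rep char_e1 t (\<lambda>_. 1)) \<zeta>)"
    by (simp add: L2_inner_def ind_rep_1[abs_def] rep_kernel_1)
qed

lemma J1_complex_measure: "\<mu> \<in> J1 \<Longrightarrow> complex_measure (borel_on SE2) \<mu>"
  by (simp add: J_U_def annihilator_ideal_def meas_alg_SE2)

lemma J1_iff_rep_op:
  "\<mu> \<in> J1 \<longleftrightarrow> complex_measure (borel_on SE2) \<mu> \<and> (\<forall>S\<in>SO2. rep_op 1 \<mu> (\<lambda>_. 1) S = 0)"
proof
  assume "\<mu> \<in> J1"
  then show "complex_measure (borel_on SE2) \<mu> \<and> (\<forall>S\<in>SO2. rep_op 1 \<mu> (\<lambda>_. 1) S = 0)"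
    using J1_complex_measure bessel_imp_rep_op[OF _ annihilator_imp_bessel] by simp
qed (simp add: rep_op_imp_annihilator)

text \<open>In this form membership in \<open>J1\<close> is visibly a weak* closed condition, because \<open>bessel\<close> is in \<open>C\<^sub>0\<close>.\<close>

lemma J1_iff_bessel:
  "\<mu> \<in> J1 \<longleftrightarrow> complex_measure (borel_on SE2) \<mu> \<and>
    (\<forall>y. cm_integral (borel_on SE2) \<mu> (\<lambda>t. bessel (fst t + y)) = 0)"
proof
  assume "complex_measure (borel_on SE2) \<mu> \<and> (\<forall>y. cm_integral (borel_on SE2) \<mu> (\<lambda>t. bessel (fst t + y)) = 0)"
  then show "\<mu> \<in> J1"
    using bessel_imp_rep_op[of \<mu>] rep_op_imp_annihilator[of \<mu>] by simp
qed (simp add: J1_complex_measure annihilator_imp_bessel)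

lemma left_ideal_J1: "left_ideal SE2 J1"
  unfolding left_ideal_def meas_alg_SE2
proof (intro conjI ballI allI)
  show "J1 \<subseteq> {\<mu>. complex_measure (borel_on SE2) \<mu>}"
    using J1_complex_measure by blast
  show "(\<lambda>_. 0) \<in> J1"
  proof -
    have L: "sigma_functional (borel_on SE2) (\<lambda>f. 0)" by (rule sigma_functional_zero)
    have "measure_of_functional (borel_on SE2) (\<lambda>f. 0) = (\<lambda>_. 0)"
      by (rule ext) (simp add: measure_of_functional_def)
    then show ?thesis
      unfolding J1_iff_rep_op
      using complex_measure_measure_of_functional[OF L] rep_op_measure_of_functional[OF L bounded_measurable_1]
      by simp
  qed
  show "(\<lambda>E. \<mu> E + \<nu> E) \<in> J1" if "\<mu> \<in> J1" "\<nu> \<in> J1" for \<mu> \<nu>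
    using that complex_measure_lincomb[of \<mu> \<nu> 1 1] rep_op_lincomb[of \<mu> \<nu> "\<lambda>_. 1" _ 1 1 1]
    by (simp add: J1_iff_rep_op)
  show "(\<lambda>E. c * \<mu> E) \<in> J1" if "\<mu> \<in> J1" for \<mu> c
    using that complex_measure_lincomb[of \<mu> \<mu> c 0] rep_op_lincomb[of \<mu> \<mu> "\<lambda>_. 1" _ 1 c 0]
    by (simp add: J1_iff_rep_op)
  show "conv SE2 \<nu> \<mu> \<in> J1" if \<nu>: "\<nu> \<in> {\<mu>. complex_measure (borel_on SE2) \<mu>}" and \<mu>: "\<mu> \<in> J1" for \<nu> \<mu>
    unfolding J1_iff_rep_op
  proof (intro conjI ballI)
    have \<nu>': "complex_measure (borel_on SE2) \<nu>" using \<nu> by simp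
    have \<mu>': "complex_measure (borel_on SE2) \<mu>" using \<mu> by (rule J1_complex_measure)
    show "complex_measure (borel_on SE2) (conv SE2 \<nu> \<mu>)"
      by (rule complex_measure_conv_SE2[OF \<nu>' \<mu>'])
    fix S assume S: "S \<in> SO2"
    have "rep_op 1 (conv SE2 \<nu> \<mu>) (\<lambda>_. 1) S = rep_op 1 \<nu> (rep_op 1 \<mu> (\<lambda>_. 1)) S"
      by (rule rep_op_conv[OF \<nu>' \<mu>' bounded_measurable_1 S])
    also have "\<dots> = rep_op 1 \<nu> (\<lambda>_. 0) S"
      using \<mu> unfolding J1_iff_rep_op
      by (intro rep_op_cong[OF \<nu>' rep_op_bounded_measurable[OF \<mu>' bounded_measurable_1] _ S]) simp
    also have "\<dots> = 0"
      by (simp add: rep_op_def rep_kernel_def sigma_functional_0[OF sigma_functional_cm_integral[OF \<nu>']])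
    finally show "rep_op 1 (conv SE2 \<nu> \<mu>) (\<lambda>_. 1) S = 0" .
  qed
qed

subsection \<open>Weak* closedness\<close>

lemma continuous_on_bessel: "continuous_on UNIV bessel"
  unfolding continuous_on_sequentially o_def using tendsto_bessel by blast

lemma bessel_C0: "(\<lambda>t. bessel (fst t + y)) \<in> C0 SE2"
  unfolding C0_def
proof (intro CollectI conjI allI impI)
  show "continuous_on (carrier SE2) (\<lambda>t. bessel (fst t + y))"
    by (rule continuous_on_compose2[OF continuous_on_bessel]) (intro continuous_intros, simp)
  fix \<epsilon> :: real assume "\<epsilon> > 0"
  then obtain K where K: "\<And>z. norm z > K \<Longrightarrow> cmod (bessel z) < \<epsilon>"
    using bessel_decay by blast
  let ?K = "cball (0::real^2) (K + norm y) \<times> SO2"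
  have "cmod (bessel (fst t + y)) < \<epsilon>" if "t \<in> carrier SE2 - ?K" for t
  proof -
    have "norm (fst t) > K + norm y" using that by (auto simp: carrier_SE2 mem_cball_0)
    then have "norm (fst t + y) > K"
      using norm_triangle_sub[of "fst t" "- y"] by simp
    then show ?thesis by (rule K)
  qed
  moreover have "compact ?K" by (rule compact_Times[OF compact_cball compact_SO2])
  moreover have "?K \<subseteq> carrier SE2" by (auto simp: carrier_SE2)
  ultimately show "\<exists>K. compact K \<and> K \<subseteq> carrier SE2 \<and> (\<forall>x\<in>carrier SE2 - K. cmod (bessel (fst x + y)) < \<epsilon>)"
    by blast
qed

lemma continuous_map_weak_star:
  assumes "f \<in> C0 G"
  shows "continuous_map (weak_star G) euclidean (\<lambda>\<mu>. cm_integral (borel_on G) \<mu> f)"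
proof -
  have "continuous_map (product_topology (\<lambda>_. euclidean) (C0 G)) euclidean (\<lambda>x. x f)"
    by (rule continuous_map_product_projection[OF assms])
  from continuous_map_pullback[OF this, of "meas_alg G" "\<lambda>\<mu>. \<lambda>f\<in>C0 G. cm_integral (borel_on G) \<mu> f"]
  show ?thesis using assms by (simp add: weak_star_def o_def)
qed

lemma topspace_weak_star: "topspace (weak_star G) = meas_alg G"
  by (auto simp: weak_star_def topspace_pullback_topology)

lemma weak_star_closed_J1: "closedin (weak_star SE2) J1"
proof -
  let ?C = "\<lambda>y. {\<mu> \<in> topspace (weak_star SE2). cm_integral (borel_on SE2) \<mu> (\<lambda>t. bessel (fst t + y)) \<in> {0}}"
  have "closedin (weak_star SE2) (?C y)" for y
    by (rule closedin_continuous_map_preimage[OF continuous_map_weak_star[OF bessel_C0]]) simp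
  then have "closedin (weak_star SE2) (\<Inter>(range ?C))"
    by (intro closedin_Inter) auto
  also have "\<Inter>(range ?C) = J1"
    by (auto simp: J1_iff_bessel topspace_weak_star meas_alg_SE2)
  finally show ?thesis .
qed

subsection \<open>Maximality\<close>

lemma measurable_haar_SE2:
  assumes "continuous_on UNIV T" "\<And>R. R \<in> SO2 \<Longrightarrow> T R \<in> UNIV \<times> SO2"
  shows "T \<in> haar_SO2 \<rightarrow>\<^sub>M borel_on SE2"
proof -
  have "T \<in> restrict_space borel SO2 \<rightarrow>\<^sub>M restrict_space borel (UNIV \<times> SO2)"
    using assms
    by (intro measurable_restrict_space2 measurable_restrict_space1 borel_measurable_continuous_onI)
      (auto simp: space_restrict_space)
  then show ?thesis
    unfolding measurable_cong_sets[OF sets_haar_SO2 refl] borel_on_SE2 .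
qed

lemma sigma_functional_haar:
  assumes "T \<in> haar_SO2 \<rightarrow>\<^sub>M borel_on SE2"
  shows "sigma_functional (borel_on SE2) (\<lambda>f. \<integral>R. f (T R) \<partial>haar_SO2)"
proof -
  interpret prob_space haar_SO2 by (rule prob_space_haar_SO2)
  show ?thesis
    using sigma_functional_weighted_integral[OF integrable_const[of "1::complex"] assms] by simp
qed

text \<open>
  Averaging over \<open>SO(2)\<close> after multiplication by a plane wave is a rank-one operator onto the constants.
\<close>

lemma haar_average:
  fixes f :: "real^2^2 \<Rightarrow> complex"
  assumes f: "continuous_on SO2 f" and S: "S \<in> SO2"
  shows "(\<integral>R. plane_wave (R *v y) S * f (transpose R ** S) \<partial>haar_SO2) = (\<integral>T. plane_wave y T * f T \<partial>haar_SO2)"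
  unfolding plane_wave_mult_right[symmetric]
  by (rule haar_inversion_invariant[of "\<lambda>T. plane_wave y T * f T", OF _ S])
    (intro continuous_on_mult continuous_on_plane_wave_right f)

text \<open>
  The measure \<open>\<nu>\<close> is Haar measure on \<open>SO(2)\<close> convolved with the unit mass at the translation by \<open>y\<close>,
  normalised, where \<open>e\<^sub>y\<close> is a plane wave that is not orthogonal to the conjugate of \<open>U(\<mu>)1\<close>.
\<close>

lemma exists_inverting_measure:
  assumes \<mu>: "complex_measure (borel_on SE2) \<mu>" and "\<mu> \<notin> J1"
  shows "\<exists>\<nu>. complex_measure (borel_on SE2) \<nu> \<and>
    (\<forall>S\<in>SO2. rep_op 1 \<nu> (rep_op 1 \<mu> (\<lambda>_. 1)) S = 1)"
proof -
  let ?g = "rep_op 1 \<mu> (\<lambda>_. 1)"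
  have g: "continuous_on SO2 ?g" by (rule continuous_on_rep_op_1[OF \<mu>])
  have gb: "?g \<in> bounded_measurable haar_SO2" by (rule rep_op_bounded_measurable[OF \<mu> bounded_measurable_1])
  obtain S where "S \<in> SO2" "?g S \<noteq> 0" using assms by (auto simp: J1_iff_rep_op)
  then obtain y where y: "(\<integral>T. ?g T * plane_wave y T \<partial>haar_SO2) \<noteq> 0"
    using plane_waves_total[OF g] by blast
  define c where "c = (\<integral>T. plane_wave y T * ?g T \<partial>haar_SO2)"
  have "c \<noteq> 0" using y by (simp add: c_def mult.commute)
  let ?L = "\<lambda>f. inverse c * (\<integral>R. f (R *v y, R) \<partial>haar_SO2)"
  have "continuous_on UNIV (\<lambda>R::real^2^2. (R *v y, R))" by (intro continuous_intros)
  then have "(\<lambda>R. (R *v y, R)) \<in> haar_SO2 \<rightarrow>\<^sub>M borel_on SE2"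
    by (rule measurable_haar_SE2) simp
  then have L: "sigma_functional (borel_on SE2) ?L"
    by (intro sigma_functional_scale sigma_functional_haar)
  have "rep_op 1 (measure_of_functional (borel_on SE2) ?L) ?g S = 1" if S: "S \<in> SO2" for S
    unfolding rep_op_measure_of_functional[OF L gb S]
    using haar_average[OF g S, of y] \<open>c \<noteq> 0\<close> by (simp add: rep_kernel_def c_def[symmetric])
  then show ?thesis
    using complex_measure_measure_of_functional[OF L] by blast
qed

lemma dirac_unit_not_in_J1: "measure_of_functional (borel_on SE2) (\<lambda>f. f (0, mat 1)) \<in> meas_alg SE2 - J1"
proof -
  have L: "sigma_functional (borel_on SE2) (\<lambda>f. f (0, mat 1))"
    by (rule sigma_functional_eval) (simp add: carrier_SE2)
  show ?thesis
    using complex_measure_measure_of_functional[OF L]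
      rep_op_measure_of_functional[OF L bounded_measurable_1 SO2_mat_1]
    by (auto simp: J1_iff_rep_op meas_alg_SE2 rep_kernel_1 intro!: bexI[of _ "mat 1"])
qed

text \<open>
  If \<open>I\<close> contains \<open>J1\<close> and some further \<open>\<mu>\<close>, then it contains some \<open>\<rho> = \<nu> * \<mu>\<close> with \<open>U(\<rho>)1 = 1\<close>. Every
  measure \<open>\<kappa>\<close> is the sum of \<open>\<kappa> - \<kappa> * \<rho>\<close>, which annihilates \<open>1\<close>, and of \<open>\<kappa> * \<rho>\<close>, which is in \<open>I\<close>.
\<close>

lemma maximal_left_ideal_J1: "maximal_left_ideal SE2 J1"
  unfolding maximal_left_ideal_def
proof (intro conjI allI impI)
  show "left_ideal SE2 J1" by (rule left_ideal_J1)
  show "J1 \<noteq> meas_alg SE2" using dirac_unit_not_in_J1 by blast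
  fix I assume I: "left_ideal SE2 I" "I \<noteq> meas_alg SE2" "J1 \<subseteq> I"
  have I_meas: "I \<subseteq> meas_alg SE2"
    and I_add: "\<And>\<mu> \<nu>. \<mu> \<in> I \<Longrightarrow> \<nu> \<in> I \<Longrightarrow> (\<lambda>E. \<mu> E + \<nu> E) \<in> I"
    and I_conv: "\<And>\<mu> \<nu>. \<nu> \<in> meas_alg SE2 \<Longrightarrow> \<mu> \<in> I \<Longrightarrow> conv SE2 \<nu> \<mu> \<in> I"
    using I(1) unfolding left_ideal_def by blast+
  show "I = J1"
  proof (rule ccontr)
    assume "I \<noteq> J1"
    then obtain \<mu> where "\<mu> \<in> I" "\<mu> \<notin> J1" using I(3) by blast
    then have \<mu>: "complex_measure (borel_on SE2) \<mu>" using I_meas by (auto simp: meas_alg_SE2)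
    obtain \<nu> where \<nu>: "complex_measure (borel_on SE2) \<nu>"
        and inv: "\<And>S. S \<in> SO2 \<Longrightarrow> rep_op 1 \<nu> (rep_op 1 \<mu> (\<lambda>_. 1)) S = 1"
      using exists_inverting_measure[OF \<mu> \<open>\<mu> \<notin> J1\<close>] by blast
    let ?\<rho> = "conv SE2 \<nu> \<mu>"
    have \<rho>: "complex_measure (borel_on SE2) ?\<rho>" by (rule complex_measure_conv_SE2[OF \<nu> \<mu>])
    have "?\<rho> \<in> I" using \<open>\<mu> \<in> I\<close> \<nu> by (intro I_conv) (simp add: meas_alg_SE2)
    have \<rho>1: "rep_op 1 ?\<rho> (\<lambda>_. 1) S = 1" if "S \<in> SO2" for S
      using rep_op_conv[OF \<nu> \<mu> bounded_measurable_1 that] inv[OF that] by simp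
    have "\<kappa> \<in> I" if "\<kappa> \<in> meas_alg SE2" for \<kappa>
    proof -
      have \<kappa>: "complex_measure (borel_on SE2) \<kappa>" using that by (simp add: meas_alg_SE2)
      have \<kappa>\<rho>: "complex_measure (borel_on SE2) (conv SE2 \<kappa> ?\<rho>)" by (rule complex_measure_conv_SE2[OF \<kappa> \<rho>])
      have "rep_op 1 (conv SE2 \<kappa> ?\<rho>) (\<lambda>_. 1) S = rep_op 1 \<kappa> (\<lambda>_. 1) S" if S: "S \<in> SO2" for S
        unfolding rep_op_conv[OF \<kappa> \<rho> bounded_measurable_1 S]
        by (rule rep_op_cong[OF \<kappa> rep_op_bounded_measurable[OF \<rho> bounded_measurable_1] \<rho>1 S])
      then have "(\<lambda>E. 1 * \<kappa> E + (-1) * conv SE2 \<kappa> ?\<rho> E) \<in> J1"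
        using complex_measure_lincomb[OF \<kappa> \<kappa>\<rho>, of 1 "-1"] rep_op_lincomb[OF \<kappa> \<kappa>\<rho> bounded_measurable_1, of _ 1 1 "-1"]
        unfolding J1_iff_rep_op by simp
      then have "(\<lambda>E. 1 * \<kappa> E + (-1) * conv SE2 \<kappa> ?\<rho> E) \<in> I" using I(3) by blast
      from I_add[OF this I_conv[OF that \<open>?\<rho> \<in> I\<close>]] show ?thesis by simp
    qed
    then show False using I(2) I_meas by blast
  qed
qed

subsection \<open>No projection generates the annihilator\<close>

text \<open>
  Iterating the dilation would carry the decay at infinity to every nonzero point, against continuity
  at \<open>0\<close>, where the value is \<open>1\<close>.
\<close>

lemma bessel_not_dilation_invariant:
  assumes "r > 1"
  shows "\<exists>v. bessel (r *\<^sub>R v) \<noteq> bessel v"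
proof (rule ccontr)
  assume "\<not> ?thesis"
  then have inv: "bessel (r *\<^sub>R v) = bessel v" for v by simp
  have pow: "bessel (r ^ n *\<^sub>R v) = bessel v" for n v
  proof (induction n)
    case (Suc n)
    then show ?case using inv[of "r ^ n *\<^sub>R v"] by simp
  qed simp
  have zero: "bessel v = 0" if "v \<noteq> 0" for v
  proof (rule ccontr)
    assume "bessel v \<noteq> 0"
    then obtain K where K: "\<And>z. norm z > K \<Longrightarrow> cmod (bessel z) < cmod (bessel v)"
      using bessel_decay[of "cmod (bessel v)"] by auto
    obtain n where "K / norm v < r ^ n" using real_arch_pow[OF assms] by blast
    then have "K < norm (r ^ n *\<^sub>R v)"
      using that assms by (simp add: pos_divide_less_eq)
    then show False using K[of "r ^ n *\<^sub>R v"] by (simp add: pow)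
  qed
  have "(\<lambda>n. inverse (real (Suc n)) *\<^sub>R axis 1 1 :: real^2) \<longlonglongrightarrow> 0 *\<^sub>R axis 1 1"
    by (intro tendsto_scaleR LIMSEQ_inverse_real_of_nat tendsto_const)
  then have "(\<lambda>n. bessel (inverse (real (Suc n)) *\<^sub>R axis 1 1)) \<longlonglongrightarrow> bessel (0 *\<^sub>R axis 1 1)"
    by (rule tendsto_bessel)
  moreover have "bessel (inverse (real (Suc n)) *\<^sub>R axis 1 1) = 0" for n
    by (rule zero) (simp add: axis_eq_0_iff)
  ultimately show False by (simp add: LIMSEQ_const_iff)
qed

text \<open>
  The uniform measure on the circle through \<open>v\<close>, minus \<open>J\<^sub>0(\<bar>v\<bar>)\<close> times the unit. By rotation
  invariance it acts as a scalar in every \<open>U\<^sub>r\<close>, and this scalar is \<open>0\<close> for \<open>r = 1\<close>.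
\<close>

lemma exists_scalar_measure:
  "\<exists>\<mu>. complex_measure (borel_on SE2) \<mu> \<and>
    (\<forall>r. \<forall>g\<in>bounded_measurable haar_SO2. \<forall>S\<in>SO2.
      rep_op r \<mu> g S = (bessel (r *\<^sub>R v) - bessel v) * g S)"
proof -
  let ?L = "\<lambda>f. (\<integral>R. f (R *v v, mat 1) \<partial>haar_SO2) + (- bessel v) * f (0, mat 1)"
  have "continuous_on UNIV (\<lambda>R::real^2^2. (R *v v, mat 1 :: real^2^2))" by (intro continuous_intros)
  then have "(\<lambda>R. (R *v v, mat 1)) \<in> haar_SO2 \<rightarrow>\<^sub>M borel_on SE2"
    by (rule measurable_haar_SE2) simp
  then have L: "sigma_functional (borel_on SE2) ?L"
    by (intro sigma_functional_plus sigma_functional_scale sigma_functional_haar sigma_functional_eval)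
      (simp_all add: carrier_SE2)
  have "rep_op r (measure_of_functional (borel_on SE2) ?L) g S = (bessel (r *\<^sub>R v) - bessel v) * g S"
    if g: "g \<in> bounded_measurable haar_SO2" and S: "S \<in> SO2" for r g S
  proof -
    have "(\<integral>R. plane_wave (R *v (r *\<^sub>R v)) S \<partial>haar_SO2) = bessel (r *\<^sub>R v)"
      using haar_average[OF continuous_on_const[of SO2 1] S, of "r *\<^sub>R v"] by (simp add: bessel_def)
    then show ?thesis
      unfolding rep_op_measure_of_functional[OF L g S]
      by (simp add: rep_kernel_def matrix_vector_mult_scaleR transpose_mat left_diff_distrib)
  qed
  then show ?thesis using complex_measure_measure_of_functional[OF L] by blast
qed

text \<open>
  Applied to the scalar measures \<open>\<mu> = \<nu> * q\<close>, idempotence of \<open>q\<close> gives \<open>c U\<^sub>r(q)1 = c 1\<close> with \<open>c \<noteq> 0\<close>. So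
  \<open>r \<mapsto> U\<^sub>r(q)1\<close> would jump from \<open>0\<close> to \<open>1\<close> at \<open>r = 1\<close>.
\<close>

lemma not_generated_by_projection_J1: "\<not> generated_by_projection SE2 J1"
proof
  assume "generated_by_projection SE2 J1"
  then obtain q where q: "q \<in> meas_alg SE2" "conv SE2 q q = q" and J: "J1 = (\<lambda>\<nu>. conv SE2 \<nu> q) ` meas_alg SE2"
    unfolding generated_by_projection_def cm_projection_def by blast
  have qc: "complex_measure (borel_on SE2) q" using q(1) by (simp add: meas_alg_SE2)
  have "q \<in> J1" unfolding J using q by (metis image_eqI)
  then have q0: "rep_op 1 q (\<lambda>_. 1) (mat 1) = 0" using SO2_mat_1 unfolding J1_iff_rep_op by blast
  have one: "rep_op r q (\<lambda>_. 1) S = 1" if r: "r > 1" and S: "S \<in> SO2" for r S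
  proof -
    let ?h = "rep_op r q (\<lambda>_. 1)"
    have h: "?h \<in> bounded_measurable haar_SO2" by (rule rep_op_bounded_measurable[OF qc bounded_measurable_1])
    obtain v where v: "bessel (r *\<^sub>R v) \<noteq> bessel v" using bessel_not_dilation_invariant[OF r] by blast
    obtain \<mu> where \<mu>: "complex_measure (borel_on SE2) \<mu>"
        and scalar: "\<And>r g S. g \<in> bounded_measurable haar_SO2 \<Longrightarrow> S \<in> SO2 \<Longrightarrow>
          rep_op r \<mu> g S = (bessel (r *\<^sub>R v) - bessel v) * g S"
      using exists_scalar_measure[of v] by blast
    have "\<mu> \<in> J1" unfolding J1_iff_rep_op using \<mu> scalar[OF bounded_measurable_1, of _ 1] by simp
    then obtain \<nu> where "\<nu> \<in> meas_alg SE2" and \<mu>\<nu>: "\<mu> = conv SE2 \<nu> q" unfolding J by blast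
    then have \<nu>: "complex_measure (borel_on SE2) \<nu>" by (simp add: meas_alg_SE2)
    have idem: "rep_op r q ?h S = ?h S" if "S \<in> SO2" for S
      using rep_op_conv[OF qc qc bounded_measurable_1 that, of r] q(2) by simp
    have "rep_op r \<mu> ?h S = rep_op r \<nu> (rep_op r q ?h) S"
      unfolding \<mu>\<nu> by (rule rep_op_conv[OF \<nu> qc h S])
    also have "\<dots> = rep_op r \<nu> ?h S"
      by (rule rep_op_cong[OF \<nu> rep_op_bounded_measurable[OF qc h] idem S])
    also have "\<dots> = rep_op r \<mu> (\<lambda>_. 1) S"
      unfolding \<mu>\<nu> by (rule rep_op_conv[OF \<nu> qc bounded_measurable_1 S, symmetric])
    finally show ?thesis
      using v unfolding scalar[OF h S] scalar[OF bounded_measurable_1 S] by simp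
  qed
  have "(\<lambda>n. 1 + inverse (real (Suc n))) \<longlonglongrightarrow> 1 + 0"
    by (intro tendsto_add tendsto_const LIMSEQ_inverse_real_of_nat)
  then have "(\<lambda>n. rep_op (1 + inverse (real (Suc n))) q (\<lambda>_. 1) (mat 1)) \<longlonglongrightarrow> rep_op (1 + 0) q (\<lambda>_. 1) (mat 1)"
    by (rule tendsto_rep_op[OF qc _ SO2_mat_1])
  then show False using q0 by (simp add: one LIMSEQ_const_iff)
qed

lemma one_L2: "(\<lambda>_. 1) \<in> L2 haar_SO2" and L2_norm_one: "L2_norm haar_SO2 (\<lambda>_. 1) = 1"
proof -
  interpret prob_space haar_SO2 by (rule prob_space_haar_SO2)
  show "(\<lambda>_. 1) \<in> L2 haar_SO2" "L2_norm haar_SO2 (\<lambda>_. 1) = 1"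
    by (simp_all add: L2_def L2_norm_def prob_space[unfolded space_haar_SO2])
qed

section \<open>Measures with compact support\<close>

lemma cmod_plane_wave_diff:
  assumes "S \<in> SO2"
  shows "cmod (plane_wave (r *\<^sub>R x) S - plane_wave x S) \<le> \<bar>r - 1\<bar> * (2 * norm x)"
proof -
  define a where "a = S $ 1 $ 1 * x $ 1 + S $ 2 $ 1 * x $ 2"
  obtain \<theta> where "0 \<le> \<theta>" "\<theta> < 2 * pi" "S = rot \<theta>" using assms by (rule SO2_cases)
  then have "\<bar>S $ 1 $ 1\<bar> \<le> 1" "\<bar>S $ 2 $ 1\<bar> \<le> 1" by auto
  then have "\<bar>S $ 1 $ 1 * x $ 1\<bar> \<le> 1 * norm x" "\<bar>S $ 2 $ 1 * x $ 2\<bar> \<le> 1 * norm x"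
    unfolding abs_mult by (intro mult_mono component_le_norm_cart; simp)+
  then have a: "\<bar>a\<bar> \<le> 2 * norm x" unfolding a_def by linarith
  have "plane_wave x S = iexp a" by (simp add: plane_wave_eq a_def)
  moreover have "plane_wave (r *\<^sub>R x) S = iexp a * iexp ((r - 1) * a)"
    unfolding plane_wave_eq exp_add[symmetric] by (simp add: a_def algebra_simps)
  ultimately have "cmod (plane_wave (r *\<^sub>R x) S - plane_wave x S) = cmod (iexp a * (iexp ((r - 1) * a) - 1))"
    by (simp only: right_diff_distrib mult_1_right)
  also have "\<dots> = cmod (iexp ((r - 1) * a) - 1)"
    unfolding norm_mult norm_exp_i_times by simp
  also have "\<dots> \<le> \<bar>(r - 1) * a\<bar>"
    using iexp_approx1[of "(r - 1) * a" 0] by simp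
  also have "\<dots> \<le> \<bar>r - 1\<bar> * (2 * norm x)"
    unfolding abs_mult using a by (intro mult_left_mono) auto
  finally show ?thesis .
qed

text \<open>
  On a compact support the integrand changes by at most a multiple of \<open>\<bar>r - 1\<bar>\<close> when the frequency
  \<open>1\<close> is replaced by \<open>r\<close>, and at frequency \<open>1\<close> the integral is \<open>0\<close>.
\<close>

lemma rep_op_1_lipschitz:
  assumes \<mu>: "\<mu> \<in> J1" and K: "compact (cm_support SE2 \<mu>)"
  shows "\<exists>C\<ge>0. \<forall>r. \<forall>S\<in>SO2. cmod (rep_op r \<mu> (\<lambda>_. 1) S) \<le> C * \<bar>r - 1\<bar>"
proof -
  let ?M = "borel_on SE2" and ?K = "cm_support SE2 \<mu>"
  have \<mu>c: "complex_measure ?M \<mu>" using \<mu> by (rule J1_complex_measure)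
  note sf = sigma_functional_cm_integral[OF \<mu>c]
  obtain A where A: "A > 0" "\<And>t. t \<in> ?K \<Longrightarrow> norm (fst t) \<le> A"
    using compact_imp_bounded[OF compact_continuous_image[OF continuous_on_fst[OF continuous_on_id] K]]
    unfolding bounded_pos by auto
  obtain C where "C \<ge> 0" and C: "\<forall>f\<in>borel_measurable ?M. \<forall>B.
      (\<forall>x\<in>space ?M. cmod (f x) \<le> B) \<longrightarrow> cmod (cm_integral ?M \<mu> f) \<le> C * B"
    using cm_integral_bound[OF \<mu>c] by blast
  have "cmod (rep_op r \<mu> (\<lambda>_. 1) S) \<le> (C * (2 * A)) * \<bar>r - 1\<bar>" if S: "S \<in> SO2" for r S
  proof -
    let ?f = "\<lambda>t. rep_kernel r (\<lambda>_. 1) t S - rep_kernel 1 (\<lambda>_. 1) t S"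
    note kb = rep_kernel_bounded_measurable[OF bounded_measurable_1 S]
    have f: "?f \<in> bounded_measurable ?M" by (rule bounded_measurable_diff[OF kb kb])
    have Km: "?K \<in> sets ?M"
      using borel_compact[OF K] by (auto simp: borel_on_def sets_restrict_space cm_support_def)
    have "rep_op 1 \<mu> (\<lambda>_. 1) S = 0" using \<mu> S unfolding J1_iff_rep_op by blast
    then have "rep_op r \<mu> (\<lambda>_. 1) S = rep_op r \<mu> (\<lambda>_. 1) S - rep_op 1 \<mu> (\<lambda>_. 1) S" by simp
    also have "\<dots> = cm_integral ?M \<mu> ?f"
      unfolding rep_op_def by (rule sigma_functional_diff[OF sf kb kb, symmetric])
    also have "\<dots> = cm_integral ?M \<mu> (\<lambda>t. indicator ?K t * ?f t)"
      by (rule cm_integral_restrict_support[OF \<mu>c K f])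
    also have "cmod \<dots> \<le> C * (\<bar>r - 1\<bar> * (2 * A))"
    proof (rule C[rule_format])
      show "(\<lambda>t. indicator ?K t * ?f t) \<in> borel_measurable ?M"
        by (rule bounded_measurable_measurable[OF bounded_measurable_mult[OF bounded_measurable_indicator[OF Km] f]])
      fix t
      have "cmod (?f t) \<le> \<bar>r - 1\<bar> * (2 * A)" if "t \<in> ?K"
      proof -
        have "cmod (?f t) \<le> \<bar>r - 1\<bar> * (2 * norm (fst t))"
          using cmod_plane_wave_diff[OF S] by (simp add: rep_kernel_1)
        also have "\<dots> \<le> \<bar>r - 1\<bar> * (2 * A)" using A(2)[OF that] by (intro mult_left_mono) auto
        finally show ?thesis .
      qed
      then show "cmod (indicator ?K t * ?f t) \<le> \<bar>r - 1\<bar> * (2 * A)"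
        using A(1) by (cases "t \<in> ?K") simp_all
    qed
    finally show ?thesis by (simp add: mult_ac)
  qed
  moreover have "C * (2 * A) \<ge> 0" using \<open>C \<ge> 0\<close> A(1) by simp
  ultimately show ?thesis by blast
qed

text \<open>
  The operators \<open>U\<^sub>r(\<nu>)\<close> are bounded in the supremum norm uniformly in \<open>r\<close>, so left multiplication
  preserves the bound. A bound in the supremum norm is what makes a single point of the circle
  sufficient to detect a violation.
\<close>

lemma generated_lipschitz:
  assumes gen: "generated_by_measures SE2 J1 m \<mu>" and K: "\<And>i. i < m \<Longrightarrow> compact (cm_support SE2 (\<mu> i))"
    and \<kappa>: "\<kappa> \<in> J1"
  shows "\<exists>C. \<forall>r. cmod (rep_op r \<kappa> (\<lambda>_. 1) (mat 1)) \<le> C * \<bar>r - 1\<bar>"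
proof -
  have \<mu>: "\<mu> i \<in> J1" if "i < m" for i
    using gen that unfolding generated_by_measures_def by blast
  obtain \<nu> where \<nu>: "\<forall>i<m. \<nu> i \<in> meas_alg SE2" and \<kappa>_eq: "\<kappa> = (\<lambda>E. \<Sum>i<m. conv SE2 (\<nu> i) (\<mu> i) E)"
    using gen \<kappa> unfolding generated_by_measures_def by blast
  have \<nu>c: "complex_measure (borel_on SE2) (\<nu> i)" if "i < m" for i
    using \<nu> that by (simp add: meas_alg_SE2)
  have \<mu>c: "complex_measure (borel_on SE2) (\<mu> i)" if "i < m" for i
    using \<mu>[OF that] by (rule J1_complex_measure)
  have "\<exists>D. \<forall>r. cmod (rep_op r (conv SE2 (\<nu> i) (\<mu> i)) (\<lambda>_. 1) (mat 1)) \<le> D * \<bar>r - 1\<bar>" if i: "i < m" for i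
  proof -
    obtain C where C: "\<forall>r. \<forall>S\<in>SO2. cmod (rep_op r (\<mu> i) (\<lambda>_. 1) S) \<le> C * \<bar>r - 1\<bar>"
      using rep_op_1_lipschitz[OF \<mu>[OF i] K[OF i]] by blast
    obtain D where D: "\<forall>r. \<forall>g\<in>bounded_measurable haar_SO2. \<forall>B. (\<forall>S\<in>SO2. cmod (g S) \<le> B) \<longrightarrow>
        (\<forall>S\<in>SO2. cmod (rep_op r (\<nu> i) g S) \<le> D * B)"
      using rep_op_bound[OF \<nu>c[OF i]] by blast
    have "cmod (rep_op r (conv SE2 (\<nu> i) (\<mu> i)) (\<lambda>_. 1) (mat 1)) \<le> (D * C) * \<bar>r - 1\<bar>" for r
      unfolding rep_op_conv[OF \<nu>c[OF i] \<mu>c[OF i] bounded_measurable_1 SO2_mat_1] mult.assoc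
      by (rule D[rule_format, OF rep_op_bounded_measurable[OF \<mu>c[OF i] bounded_measurable_1] _ SO2_mat_1])
        (rule C[rule_format])
    then show ?thesis by blast
  qed
  then obtain D where D: "\<And>i r. i < m \<Longrightarrow>
      cmod (rep_op r (conv SE2 (\<nu> i) (\<mu> i)) (\<lambda>_. 1) (mat 1)) \<le> D i * \<bar>r - 1\<bar>"
    by metis
  have "cmod (rep_op r \<kappa> (\<lambda>_. 1) (mat 1)) \<le> (\<Sum>i<m. D i) * \<bar>r - 1\<bar>" for r
  proof -
    have "rep_op r \<kappa> (\<lambda>_. 1) (mat 1) = (\<Sum>i<m. rep_op r (conv SE2 (\<nu> i) (\<mu> i)) (\<lambda>_. 1) (mat 1))"
    proof -
      have "rep_op r (\<lambda>E. \<Sum>i<m. 1 * conv SE2 (\<nu> i) (\<mu> i) E) (\<lambda>_. 1) (mat 1) =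
          (\<Sum>i<m. 1 * rep_op r (conv SE2 (\<nu> i) (\<mu> i)) (\<lambda>_. 1) (mat 1))"
        by (rule rep_op_sum[OF _ bounded_measurable_1 SO2_mat_1])
          (simp add: complex_measure_conv_SE2 \<nu>c \<mu>c)
      then show ?thesis by (simp add: \<kappa>_eq)
    qed
    also have "cmod \<dots> \<le> (\<Sum>i<m. D i * \<bar>r - 1\<bar>)"
      by (rule sum_norm_le) (simp add: D)
    finally show ?thesis by (simp add: sum_distrib_right)
  qed
  then show ?thesis by blast
qed

section \<open>Gaussian moments\<close>

lemma integral_derivative_0:
  fixes F f :: "real \<Rightarrow> complex"
  assumes F: "\<And>x. (F has_vector_derivative f x) (at x)" and f: "\<And>x. isCont f x"
    and int: "integrable lborel f" and lim: "(F \<longlongrightarrow> 0) at_top" "(F \<longlongrightarrow> 0) at_bot"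
  shows "integral\<^sup>L lborel f = 0"
proof -
  have "(LBINT x=-\<infinity>..\<infinity>. f x) = 0 - 0"
  proof (rule interval_integral_FTC_integrable)
    show "set_integrable lborel (einterval (-\<infinity>) \<infinity>) f"
      using int by (simp add: set_integrable_def)
    show "((F \<circ> real_of_ereal) \<longlongrightarrow> 0) (at_right (-\<infinity>))" "((F \<circ> real_of_ereal) \<longlongrightarrow> 0) (at_left \<infinity>)"
      using lim by (simp_all add: ereal_tendsto_simps)
  qed (use F f in auto)
  then show ?thesis
    by (simp add: interval_lebesgue_integral_def set_lebesgue_integral_def)
qed

lemma std_normal_decay:
  "((\<lambda>x. std_normal_density x * \<bar>x\<bar> ^ k) \<longlongrightarrow> 0) at_top"
  "((\<lambda>x. std_normal_density x * \<bar>x\<bar> ^ k) \<longlongrightarrow> 0) at_bot"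
proof -
  show top: "((\<lambda>x. std_normal_density x * \<bar>x\<bar> ^ k) \<longlongrightarrow> 0) at_top"
  proof (rule tendsto_sandwich[OF _ _ tendsto_const tendsto_power_div_exp_0])
    show "\<forall>\<^sub>F x in at_top. 0 \<le> std_normal_density x * \<bar>x\<bar> ^ k" by simp
    show "\<forall>\<^sub>F x in at_top. std_normal_density x * \<bar>x\<bar> ^ k \<le> x ^ k / exp x"
      using eventually_ge_at_top[of 2]
    proof eventually_elim
      case (elim x)
      have "1 \<le> sqrt (2 * pi)" using pi_gt3 by simp
      then have "exp (- x\<^sup>2 / 2) / sqrt (2 * pi) \<le> exp (- x\<^sup>2 / 2) / 1"
        by (intro divide_left_mono) simp_all
      then have "std_normal_density x \<le> exp (- x\<^sup>2 / 2)"
        unfolding std_normal_density_def by simp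
      also have "\<dots> \<le> exp (- x)"
        using elim mult_right_mono[of 2 x x] by (simp add: power2_eq_square)
      finally show ?case
        using elim by (simp add: exp_minus divide_inverse mult.commute mult_left_mono)
    qed
  qed
  have "((\<lambda>x. std_normal_density (- x) * \<bar>- x\<bar> ^ k) \<longlongrightarrow> 0) at_bot"
    by (rule filterlim_compose[OF top filterlim_uminus_at_top_at_bot])
  then show "((\<lambda>x. std_normal_density x * \<bar>x\<bar> ^ k) \<longlongrightarrow> 0) at_bot"
    by (simp add: std_normal_density_def)
qed

definition gauss_moment :: "nat \<Rightarrow> real \<Rightarrow> complex" where
  "gauss_moment k v = (\<integral>x. of_real (x ^ k) * iexp (v * x) \<partial>std_normal_distribution)"

lemma integrable_gauss_moment:
  "integrable std_normal_distribution (\<lambda>x. complex_of_real (x ^ k) * iexp (v * x))"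
proof (rule Bochner_Integration.integrable_bound)
  show "integrable std_normal_distribution (\<lambda>x. x ^ k)" by (rule integrable_std_normal_distribution_moment)
  show "AE x in std_normal_distribution. cmod (complex_of_real (x ^ k) * iexp (v * x)) \<le> norm (x ^ k)"
    by (simp add: norm_mult norm_power power_abs)
qed simp

lemma gauss_moment_lborel:
  "gauss_moment k v = (\<integral>x. of_real (std_normal_density x) * (of_real (x ^ k) * iexp (v * x)) \<partial>lborel)"
  "integrable lborel (\<lambda>x. complex_of_real (std_normal_density x) * (of_real (x ^ k) * iexp (v * x)))"
proof -
  show "gauss_moment k v = (\<integral>x. of_real (std_normal_density x) * (of_real (x ^ k) * iexp (v * x)) \<partial>lborel)"
    unfolding gauss_moment_def by (subst integral_density) (simp_all add: scaleR_conv_of_real)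
  show "integrable lborel (\<lambda>x. complex_of_real (std_normal_density x) * (of_real (x ^ k) * iexp (v * x)))"
    using integrable_gauss_moment[of k v]
    by (subst (asm) integrable_density) (simp_all add: scaleR_conv_of_real)
qed

lemma gauss_moment_0: "gauss_moment 0 v = of_real (exp (- v\<^sup>2 / 2))"
  using fun_cong[OF char_std_normal_distribution, of v] by (simp add: gauss_moment_def char_def)

text \<open>
  Integration of the derivative of \<open>\<phi>(x) x\<^sup>k exp(\<i> v x)\<close>, where the Gaussian density satisfies
  \<open>\<phi>'(x) = - x \<phi>(x)\<close>. For \<open>k = 0\<close> the truncated index \<open>k - 1\<close> occurs with coefficient \<open>0\<close>.
\<close>

lemma gauss_moment_Suc:
  "gauss_moment (Suc k) v = \<i> * v * gauss_moment k v + of_nat k * gauss_moment (k - 1) v"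
proof -
  let ?\<phi> = "\<lambda>x. complex_of_real (std_normal_density x)"
  let ?m = "\<lambda>k x. ?\<phi> x * (of_real (x ^ k) * iexp (v * x))"
  let ?F = "\<lambda>x. ?m k x"
  let ?f = "\<lambda>x. \<i> * v * ?m k x + of_nat k * ?m (k - 1) x - ?m (Suc k) x"
  have dphi: "(std_normal_density has_real_derivative - (x * std_normal_density x)) (at x)" for x
  proof -
    define c where "c = 1 / sqrt (2 * pi)"
    have "std_normal_density = (\<lambda>x. c * exp (- x\<^sup>2 / 2))"
      by (simp add: std_normal_density_def c_def fun_eq_iff)
    then show ?thesis by (auto intro!: derivative_eq_intros)
  qed
  have "(?F has_vector_derivative ?f x) (at x)" for x
  proof -
    have 1: "((\<lambda>x. complex_of_real (std_normal_density x * x ^ k)) has_vector_derivative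
        of_real (- (x * std_normal_density x) * x ^ k + std_normal_density x * (of_nat k * x ^ (k - 1)))) (at x)"
      by (rule has_vector_derivative_of_real) (auto intro!: derivative_eq_intros dphi)
    have "((\<lambda>x. of_real (v * x)) has_vector_derivative complex_of_real v) (at x)"
      by (rule has_vector_derivative_of_real) (auto intro!: derivative_eq_intros)
    then have "((\<lambda>x. \<i> * of_real (v * x)) has_vector_derivative \<i> * complex_of_real v) (at x)"
      by (rule has_vector_derivative_mult_right)
    then have "((exp \<circ> (\<lambda>x. \<i> * of_real (v * x))) has_vector_derivative
        \<i> * complex_of_real v * exp (\<i> * of_real (v * x))) (at x)"
      by (rule field_vector_diff_chain_at) (rule DERIV_exp)
    then have 2: "(iexp \<circ> (\<lambda>x. v * x) has_vector_derivative \<i> * complex_of_real v * iexp (v * x)) (at x)"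
      by (simp add: o_def)
    from has_vector_derivative_mult[OF 1 2]
    show ?thesis by (simp add: o_def algebra_simps)
  qed
  moreover have "isCont ?f x" for x
    unfolding std_normal_density_def by (intro continuous_intros) auto
  moreover have "integrable lborel ?f"
    by (intro Bochner_Integration.integrable_diff Bochner_Integration.integrable_add integrable_mult_right
        gauss_moment_lborel(2))
  moreover have "(?F \<longlongrightarrow> 0) at_top" "(?F \<longlongrightarrow> 0) at_bot"
    using std_normal_decay[of k]
    by (subst tendsto_norm_zero_iff[symmetric], simp add: norm_mult norm_power)+
  ultimately have "integral\<^sup>L lborel ?f = 0"
    by (rule integral_derivative_0)
  also have "integral\<^sup>L lborel ?f = \<i> * v * gauss_moment k v + of_nat k * gauss_moment (k - 1) v - gauss_moment (Suc k) v"
    unfolding gauss_moment_lborel(1)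
    by (simp only: Bochner_Integration.integral_diff Bochner_Integration.integral_add integral_mult_right_zero
        Bochner_Integration.integrable_add integrable_mult_right gauss_moment_lborel(2))
  finally show ?thesis by simp
qed

lemma gauss_moment_1: "gauss_moment 1 v = \<i> * v * of_real (exp (- v\<^sup>2 / 2))"
  using gauss_moment_Suc[of 0 v] by (simp add: gauss_moment_0)

lemma gauss_moment_2: "gauss_moment 2 v = (1 - (complex_of_real v)\<^sup>2) * complex_of_real (exp (- v\<^sup>2 / 2))"
  using gauss_moment_Suc[of 1 v]
  by (simp add: gauss_moment_0 gauss_moment_1[simplified] numeral_2_eq_2 power2_eq_square algebra_simps)

lemma
  fixes f :: "'a \<Rightarrow> 'c::{real_normed_field,banach,second_countable_topology}"
  assumes M1: "sigma_finite_measure M1" and M2: "sigma_finite_measure M2"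
    and f: "integrable M1 f" and g: "integrable M2 g"
  shows integrable_pair_mult: "integrable (M1 \<Otimes>\<^sub>M M2) (\<lambda>z. f (fst z) * g (snd z))"
    and integral_pair_mult: "(\<integral>z. f (fst z) * g (snd z) \<partial>(M1 \<Otimes>\<^sub>M M2)) = integral\<^sup>L M1 f * integral\<^sup>L M2 g"
proof -
  interpret M1: sigma_finite_measure M1 by (rule M1)
  interpret M2: sigma_finite_measure M2 by (rule M2)
  interpret pair_sigma_finite M1 M2 ..
  have [measurable]: "f \<in> borel_measurable M1" "g \<in> borel_measurable M2" using f g by auto
  show int: "integrable (M1 \<Otimes>\<^sub>M M2) (\<lambda>z. f (fst z) * g (snd z))"
  proof (rule Fubini_integrable)
    show "integrable M1 (\<lambda>x. \<integral>y. norm (f (fst (x, y)) * g (snd (x, y))) \<partial>M2)"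
      using f by (simp add: norm_mult)
    show "AE x in M1. integrable M2 (\<lambda>y. f (fst (x, y)) * g (snd (x, y)))"
      using g by simp
  qed measurable
  show "(\<integral>z. f (fst z) * g (snd z) \<partial>(M1 \<Otimes>\<^sub>M M2)) = integral\<^sup>L M1 f * integral\<^sup>L M2 g"
    unfolding integral_fst'[OF int, symmetric] by simp
qed

section \<open>An element of the ideal that is rough at the unit circle\<close>

text \<open>
  The measure is the image of a weighted probability measure. A random index \<open>k\<close> has probability
  \<open>2\<^bsup>-k-1\<^esup>\<close> and selects the scale \<open>\<tau> = 4\<^sup>k\<close>; a pair of independent Gaussians \<open>(x, y)\<close> gives the point
  \<open>(\<tau> x, \<tau>\<^bsup>1/2\<^esup> y)\<close> of the plane.
\<close>

abbreviation rough_space :: "(nat \<times> real \<times> real) measure" where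
  "rough_space \<equiv> measure_pmf (geometric_pmf (1/2)) \<Otimes>\<^sub>M (std_normal_distribution \<Otimes>\<^sub>M std_normal_distribution)"

definition rough_point :: "nat \<times> real \<times> real \<Rightarrow> (real^2) \<times> (real^2^2)" where
  "rough_point = (\<lambda>(k, x, y). (vector [4 ^ k * x, 2 ^ k * y], mat 1))"

text \<open>
  The Gaussian averages of \<open>- 2\<i> x\<close>, \<open>1 - x\<^sup>2\<close> and \<open>1 - y\<^sup>2\<close> against \<open>exp(\<i> (v x + w y))\<close> are \<open>2v\<close>, \<open>v\<^sup>2\<close> and
  \<open>w\<^sup>2\<close> times \<open>exp(-(v\<^sup>2 + w\<^sup>2) / 2)\<close>. With \<open>v = \<tau>(u\<^sub>1 - 1)\<close> and \<open>w = \<tau>\<^bsup>1/2\<^esup> u\<^sub>2\<close> the combination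
  \<open>2v + v\<^sup>2 / \<tau> + w\<^sup>2\<close> equals \<open>\<tau>(\<bar>u\<bar>\<^sup>2 - 1)\<close>, which vanishes on the unit circle.
\<close>

definition rough_poly :: "nat \<Rightarrow> real \<times> real \<Rightarrow> complex" where
  "rough_poly k = (\<lambda>(x, y). - 2 * \<i> * of_real x + of_real ((1 - x\<^sup>2) / 4 ^ k) + of_real (1 - y\<^sup>2))"

text \<open>The exponential factor shifts the transform so that it is centred at \<open>(1, 0)\<close>.\<close>

definition rough_weight :: "nat \<times> real \<times> real \<Rightarrow> complex" where
  "rough_weight = (\<lambda>(k, x, y). rough_poly k (x, y) * iexp (- (4 ^ k * x)))"

lemma sigma_finite_std_normal: "sigma_finite_measure std_normal_distribution"
proof -
  interpret real_distribution std_normal_distribution by (rule real_dist_normal_dist)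
  show ?thesis by unfold_locales
qed

lemma sigma_finite_normal_pair: "sigma_finite_measure (std_normal_distribution \<Otimes>\<^sub>M std_normal_distribution)"
  by (rule sigma_finite_pair_measure[OF sigma_finite_std_normal sigma_finite_std_normal])

lemma sigma_finite_geometric: "sigma_finite_measure (measure_pmf (geometric_pmf (1/2)))"
  by (rule prob_space_imp_sigma_finite[OF prob_space_measure_pmf])

lemma measurable_rough_point: "rough_point \<in> rough_space \<rightarrow>\<^sub>M borel_on SE2"
proof -
  have vec: "(vector [a, b] :: real^2) = (\<chi> i. if i = 1 then a else b)" for a b
    by (simp add: vec_eq_iff forall_2 vector_2)
  have comp: "continuous_on UNIV (\<lambda>p::real \<times> real. if i = 1 then fst p else snd p)" for i :: 2
    by (cases "i = 1") (simp_all add: continuous_on_fst continuous_on_snd continuous_on_id)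
  have "continuous_on UNIV (\<lambda>p::real \<times> real. (vector [fst p, snd p] :: real^2, mat 1 :: real^2^2))"
    unfolding vec by (intro continuous_on_Pair continuous_on_vec_lambda comp continuous_on_const)
  then have c: "(\<lambda>p::real \<times> real. (vector [fst p, snd p] :: real^2, mat 1 :: real^2^2)) \<in> borel_measurable borel"
    by (rule borel_measurable_continuous_onI)
  have [measurable]: "(\<lambda>k. c ^ k) \<in> borel_measurable (measure_pmf p)" for c :: real and p
    by simp
  have "(\<lambda>z. (4 ^ fst z * fst (snd z), 2 ^ fst z * snd (snd z))) \<in> rough_space \<rightarrow>\<^sub>M (borel \<Otimes>\<^sub>M borel :: (real \<times> real) measure)"
    by measurable
  then have "(\<lambda>z. (4 ^ fst z * fst (snd z), 2 ^ fst z * snd (snd z))) \<in> rough_space \<rightarrow>\<^sub>M (borel :: (real \<times> real) measure)"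
    by (simp only: borel_prod)
  from measurable_compose[OF this c]
  have "rough_point \<in> rough_space \<rightarrow>\<^sub>M borel"
    by (simp add: rough_point_def split_beta')
  then show ?thesis
    unfolding borel_on_SE2 by (intro measurable_restrict_space2) (auto simp: rough_point_def)
qed

lemma measurable_rough_weight: "rough_weight \<in> borel_measurable rough_space"
proof -
  have [measurable]: "(\<lambda>k. c ^ k) \<in> borel_measurable (measure_pmf p)" for c :: real and p
    by simp
  show ?thesis unfolding rough_weight_def rough_poly_def split_beta' prod.case fst_conv snd_conv by measurable
qed

text \<open>
  The bound does not depend on \<open>k\<close>. This is where the different scalings of \<open>x\<close> and \<open>y\<close> pay off.
\<close>

lemma integrable_rough_weight: "integrable rough_space rough_weight"
proof -
  let ?N = "std_normal_distribution"
  interpret N: real_distribution ?N by (rule real_dist_normal_dist)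
  let ?a = "\<lambda>x::real. 2 * \<bar>x\<bar> + (1 + x\<^sup>2)" and ?b = "\<lambda>y::real. 1 + y\<^sup>2"
  have one: "integrable ?N (\<lambda>_. 1::real)" by simp
  have b: "integrable ?N ?b"
    using integrable_std_normal_distribution_moment[of 2] by simp
  have a: "integrable ?N ?a"
    using integrable_std_normal_distribution_moment[of 1] b by simp
  have "integrable (?N \<Otimes>\<^sub>M ?N) (\<lambda>z. ?a (fst z) * 1 + 1 * ?b (snd z))"
    by (rule Bochner_Integration.integrable_add[OF
          integrable_pair_mult[OF sigma_finite_std_normal sigma_finite_std_normal a one]
          integrable_pair_mult[OF sigma_finite_std_normal sigma_finite_std_normal one b]])
  then have dom: "integrable rough_space (\<lambda>z. 1 * (?a (fst (snd z)) * 1 + 1 * ?b (snd (snd z))))"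
    by (rule integrable_pair_mult[OF sigma_finite_geometric sigma_finite_normal_pair measure_pmf.integrable_const])
  show ?thesis
  proof (rule Bochner_Integration.integrable_bound[OF dom measurable_rough_weight], rule AE_I2)
    fix z :: "nat \<times> real \<times> real"
    obtain k x y where z: "z = (k, x, y)" by (cases z) auto
    have "cmod (rough_weight z) = cmod (rough_poly k (x, y))"
      unfolding z rough_weight_def prod.case norm_mult norm_exp_i_times by simp
    also have "\<dots> \<le> cmod (- 2 * \<i> * of_real x) + cmod (of_real ((1 - x\<^sup>2) / 4 ^ k)) + cmod (of_real (1 - y\<^sup>2))"
      unfolding rough_poly_def prod.case by (intro norm_triangle_le add_mono norm_triangle_ineq order_refl)
    also have "\<dots> \<le> 2 * \<bar>x\<bar> + (1 + x\<^sup>2) + (1 + y\<^sup>2)"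
    proof (intro add_mono)
      have "\<bar>1 - x\<^sup>2\<bar> / 4 ^ k \<le> \<bar>1 - x\<^sup>2\<bar> / 1" by (intro divide_left_mono) simp_all
      also have "\<dots> \<le> 1 + x\<^sup>2" by (simp add: abs_le_iff)
      finally show "cmod (of_real ((1 - x\<^sup>2) / 4 ^ k)) \<le> 1 + x\<^sup>2"
        unfolding norm_of_real abs_divide by simp
      show "cmod (of_real (1 - y\<^sup>2)) \<le> 1 + y\<^sup>2"
        unfolding norm_of_real by (simp add: abs_le_iff)
    qed (simp add: norm_mult)
    finally show "cmod (rough_weight z) \<le> norm (1 * (?a (fst (snd z)) * 1 + 1 * ?b (snd (snd z))))"
      by (simp add: z)
  qed
qed

lemma rough_integral:
  "(\<integral>z. rough_poly k z * (iexp (v * fst z) * iexp (w * snd z)) \<partial>(std_normal_distribution \<Otimes>\<^sub>M std_normal_distribution)) =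
    of_real ((2 * v + v\<^sup>2 / 4 ^ k + w\<^sup>2) * exp (- (v\<^sup>2 + w\<^sup>2) / 2))"
proof -
  let ?N = "std_normal_distribution"
  let ?m = "\<lambda>j v x. complex_of_real (x ^ j) * iexp (v * x)"
  let ?p = "\<lambda>i j z. ?m i v (fst z) * ?m j w (snd z)"
  note sf = sigma_finite_std_normal
  have int: "integrable (?N \<Otimes>\<^sub>M ?N) (?p i j)" for i j
    by (rule integrable_pair_mult[OF sf sf integrable_gauss_moment integrable_gauss_moment])
  have val: "integral\<^sup>L (?N \<Otimes>\<^sub>M ?N) (?p i j) = gauss_moment i v * gauss_moment j w" for i j
    unfolding gauss_moment_def
    by (rule integral_pair_mult[OF sf sf integrable_gauss_moment integrable_gauss_moment])
  have eq: "rough_poly k z * (iexp (v * fst z) * iexp (w * snd z)) =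
      (- 2 * \<i>) * ?p 1 0 z + inverse (4 ^ k) * (?p 0 0 z - ?p 2 0 z) + (?p 0 0 z - ?p 0 2 z)" for z
  proof -
    have "(- 2 * \<i> * X + (1 - X2) * c + (1 - Y2)) * (a * b) =
        (- 2 * \<i>) * ((X * a) * (1 * b)) + c * ((1 * a) * (1 * b) - (X2 * a) * (1 * b)) +
        ((1 * a) * (1 * b) - (1 * a) * (Y2 * b))" for X X2 Y2 a b c :: complex
      by (simp add: algebra_simps)
    then show ?thesis
      unfolding rough_poly_def case_prod_unfold fst_conv snd_conv prod.collapse divide_inverse
        of_real_mult of_real_diff of_real_1 of_real_inverse of_real_power of_real_numeral power_0 power_one_right .
  qed
  have i1: "integrable (?N \<Otimes>\<^sub>M ?N) (\<lambda>z. (- 2 * \<i>) * ?p 1 0 z)"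
    by (intro integrable_mult_right int)
  have i2: "integrable (?N \<Otimes>\<^sub>M ?N) (\<lambda>z. inverse (4 ^ k) * (?p 0 0 z - ?p 2 0 z))"
    by (intro integrable_mult_right Bochner_Integration.integrable_diff int)
  have "(\<integral>z. rough_poly k z * (iexp (v * fst z) * iexp (w * snd z)) \<partial>(?N \<Otimes>\<^sub>M ?N)) =
      (- 2 * \<i>) * (gauss_moment 1 v * gauss_moment 0 w) +
      inverse (4 ^ k) * (gauss_moment 0 v * gauss_moment 0 w - gauss_moment 2 v * gauss_moment 0 w) +
      (gauss_moment 0 v * gauss_moment 0 w - gauss_moment 0 v * gauss_moment 2 w)"
    unfolding eq
      Bochner_Integration.integral_add[OF Bochner_Integration.integrable_add[OF i1 i2] Bochner_Integration.integrable_diff[OF int int]]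
      Bochner_Integration.integral_add[OF i1 i2] integral_mult_right_zero
      Bochner_Integration.integral_diff[OF int int] val ..
  also have "\<dots> = of_real (2 * v + v\<^sup>2 * inverse (4 ^ k) + w\<^sup>2) * (complex_of_real (exp (- v\<^sup>2 / 2)) * complex_of_real (exp (- w\<^sup>2 / 2)))"
  proof -
    have "(- 2 * \<i>) * (\<i> * V * E * F) + c * (E * F - (1 - V2) * E * F) + (E * F - E * ((1 - W2) * F)) =
        (2 * V + V2 * c + W2) * (E * F)" for V V2 W2 c E F :: complex
      by (simp add: algebra_simps)
    then show ?thesis
      unfolding gauss_moment_0 gauss_moment_1 gauss_moment_2 of_real_add of_real_mult of_real_power
        of_real_inverse of_real_numeral .
  qed
  also have "complex_of_real (exp (- v\<^sup>2 / 2)) * complex_of_real (exp (- w\<^sup>2 / 2)) = complex_of_real (exp (- (v\<^sup>2 + w\<^sup>2) / 2))"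
    unfolding of_real_mult[symmetric] exp_add[symmetric] by (simp add: add_divide_distrib)
  finally show ?thesis unfolding of_real_mult[symmetric] divide_inverse[of "v\<^sup>2" "4 ^ k"] .
qed

definition rough_measure :: "((real^2) \<times> (real^2^2)) set \<Rightarrow> complex" where
  "rough_measure = measure_of_functional (borel_on SE2) (\<lambda>f. \<integral>z. rough_weight z * f (rough_point z) \<partial>rough_space)"

text \<open>The contribution of the scale \<open>4\<^sup>k\<close> to \<open>U\<^sub>r(\<mu>)1\<close>, evaluated at \<open>S\<close>.\<close>

definition rough_profile :: "real \<Rightarrow> real^2^2 \<Rightarrow> nat \<Rightarrow> real" where
  "rough_profile r S k = 4 ^ k * (r\<^sup>2 - 1) *
     exp (- ((4 ^ k * (r * S $ 1 $ 1 - 1))\<^sup>2 + (2 ^ k * r * S $ 2 $ 1)\<^sup>2) / 2)"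

lemma sigma_functional_rough:
  "sigma_functional (borel_on SE2) (\<lambda>f. \<integral>z. rough_weight z * f (rough_point z) \<partial>rough_space)"
  by (rule sigma_functional_weighted_integral[OF integrable_rough_weight measurable_rough_point])

lemma complex_measure_rough: "complex_measure (borel_on SE2) rough_measure"
  unfolding rough_measure_def by (rule complex_measure_measure_of_functional[OF sigma_functional_rough])

lemma
  assumes S: "S \<in> SO2"
  shows rep_op_rough: "rep_op r rough_measure (\<lambda>_. 1) S =
      of_real (\<integral>k. rough_profile r S k \<partial>measure_pmf (geometric_pmf (1/2)))"
    and integrable_rough_profile: "integrable (measure_pmf (geometric_pmf (1/2))) (rough_profile r S)"
proof -
  let ?N = "std_normal_distribution" and ?G = "measure_pmf (geometric_pmf (1/2))"
  let ?I = "\<lambda>z. rough_weight z * rep_kernel r (\<lambda>_. 1) (rough_point z) S"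
  interpret G: sigma_finite_measure ?G by (rule sigma_finite_geometric)
  interpret NN: sigma_finite_measure "?N \<Otimes>\<^sub>M ?N" by (rule sigma_finite_normal_pair)
  interpret pair_sigma_finite ?G "?N \<Otimes>\<^sub>M ?N" ..
  have m: "(\<lambda>z. rep_kernel r (\<lambda>_. 1) (rough_point z) S) \<in> borel_measurable rough_space"
    by (rule measurable_compose[OF measurable_rough_point
          bounded_measurable_measurable[OF rep_kernel_bounded_measurable[OF bounded_measurable_1 S]]])
  have int: "integrable rough_space ?I"
  proof (rule Bochner_Integration.integrable_bound[OF integrable_rough_weight])
    show "?I \<in> borel_measurable rough_space"
      by (rule borel_measurable_times[OF measurable_rough_weight m])
    show "AE z in rough_space. cmod (?I z) \<le> cmod (rough_weight z)"
      by (rule AE_I2) (simp add: norm_mult rep_kernel_1)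
  qed
  have inner: "(\<integral>z. ?I (k, z) \<partial>(?N \<Otimes>\<^sub>M ?N)) = of_real (rough_profile r S k)" for k
  proof -
    let ?v = "4 ^ k * (r * S $ 1 $ 1 - 1)" and ?w = "2 ^ k * r * S $ 2 $ 1"
    have "?I (k, z) = rough_poly k z * (iexp (?v * fst z) * iexp (?w * snd z))" for z
    proof -
      obtain x y where z: "z = (x, y)" by (cases z)
      have "plane_wave (r *\<^sub>R vector [4 ^ k * x, 2 ^ k * y]) S =
          iexp (S $ 1 $ 1 * (r * (4 ^ k * x)) + S $ 2 $ 1 * (r * (2 ^ k * y)))"
        by (simp add: plane_wave_eq vector_2)
      moreover have "iexp (- (4 ^ k * x)) * \<dots> = iexp (?v * x) * iexp (?w * y)"
        unfolding exp_add[symmetric] by (simp add: algebra_simps)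
      ultimately show ?thesis
        unfolding z by (simp only: rough_weight_def rough_point_def rep_kernel_1 prod.case fst_conv snd_conv mult.assoc)
    qed
    then have "(\<integral>z. ?I (k, z) \<partial>(?N \<Otimes>\<^sub>M ?N)) = of_real ((2 * ?v + ?v\<^sup>2 / 4 ^ k + ?w\<^sup>2) * exp (- (?v\<^sup>2 + ?w\<^sup>2) / 2))"
      by (simp only: rough_integral)
    also have "2 * ?v + ?v\<^sup>2 / 4 ^ k + ?w\<^sup>2 = 4 ^ k * (r\<^sup>2 - 1)"
    proof -
      obtain \<theta> where "0 \<le> \<theta>" "\<theta> < 2 * pi" "S = rot \<theta>" using S by (rule SO2_cases)
      then have c: "(S $ 2 $ 1)\<^sup>2 = 1 - (S $ 1 $ 1)\<^sup>2" by (simp add: sin_squared_eq)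
      have "?v\<^sup>2 / 4 ^ k = 4 ^ k * (r * S $ 1 $ 1 - 1)\<^sup>2" by (simp add: power2_eq_square)
      moreover have "?w\<^sup>2 = 4 ^ k * (r\<^sup>2 * (1 - (S $ 1 $ 1)\<^sup>2))"
      proof -
        have "(2::real) ^ k * 2 ^ k = 4 ^ k" by (simp flip: power_mult_distrib)
        moreover have "?w\<^sup>2 = (2 ^ k * 2 ^ k) * (r\<^sup>2 * (S $ 2 $ 1)\<^sup>2)"
          by (simp add: power2_eq_square mult_ac)
        ultimately show ?thesis by (simp only: c)
      qed
      ultimately show ?thesis by (simp add: power2_eq_square algebra_simps)
    qed
    finally show ?thesis by (simp only: rough_profile_def)
  qed
  have "rep_op r rough_measure (\<lambda>_. 1) S = integral\<^sup>L rough_space ?I"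
    unfolding rough_measure_def
    by (rule rep_op_measure_of_functional[OF sigma_functional_rough bounded_measurable_1 S])
  also have "\<dots> = (\<integral>k. complex_of_real (rough_profile r S k) \<partial>?G)"
    unfolding integral_fst'[OF int, symmetric] inner ..
  finally show "rep_op r rough_measure (\<lambda>_. 1) S = of_real (\<integral>k. rough_profile r S k \<partial>?G)"
    by (simp only: integral_complex_of_real)
  have "integrable ?G (\<lambda>k. complex_of_real (rough_profile r S k))"
    using integrable_fst'[OF int] unfolding inner .
  then show "integrable ?G (rough_profile r S)"
    by (simp only: complex_of_real_integrable_eq)
qed

lemma rough_measure_in_J1: "rough_measure \<in> J1"
  unfolding J1_iff_rep_op using complex_measure_rough by (simp add: rep_op_rough rough_profile_def)

text \<open>
  All scales contribute nonnegatively for \<open>r > 1\<close>, and the scale \<open>4\<^sup>j\<close> alone contributes at least its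
  probability at distance \<open>4\<^bsup>-j\<^esup>\<close> from the circle.
\<close>

lemma rough_lower_bound:
  "(1/2) ^ Suc j \<le> cmod (rep_op (1 + 1 / 4 ^ j) rough_measure (\<lambda>_. 1) (mat 1))"
proof -
  let ?r = "1 + 1 / 4 ^ j :: real" and ?G = "measure_pmf (geometric_pmf (1/2))"
  let ?p = "rough_profile ?r (mat 1)"
  have nn: "0 \<le> ?p k" for k
    unfolding rough_profile_def by (intro mult_nonneg_nonneg) (simp_all add: power2_eq_square algebra_simps)
  have pj: "1 \<le> ?p j"
  proof -
    have "4 ^ j * (?r\<^sup>2 - 1) = 2 + 1 / 4 ^ j" by (simp add: power2_eq_square field_simps)
    then have p: "?p j = (2 + 1 / 4 ^ j) * exp (- (1/2))"
      unfolding rough_profile_def by (simp add: mat_def)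
    have "1/2 \<le> exp (- (1/2) :: real)" using exp_ge_add_one_self[of "- (1/2) :: real"] by simp
    then have "2 * (1/2) \<le> (2 + 1 / 4 ^ j) * exp (- (1/2) :: real)" by (intro mult_mono) simp_all
    then show ?thesis unfolding p by simp
  qed
  have "(1/2) ^ Suc j = measure ?G {j}"
    by (simp add: measure_pmf_single)
  also have "\<dots> = (\<integral>k. indicator {j} k \<partial>?G)"
    by simp
  also have "\<dots> \<le> (\<integral>k. ?p k \<partial>?G)"
  proof (rule integral_mono[OF _ integrable_rough_profile[OF SO2_mat_1]])
    show "integrable ?G (indicator {j} :: nat \<Rightarrow> real)" by (simp add: measure_pmf.emeasure_eq_measure)
    show "indicator {j} k \<le> ?p k" for k using pj nn[of k] by (cases "k = j") simp_all
  qed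
  also have "\<dots> \<le> cmod (rep_op ?r rough_measure (\<lambda>_. 1) (mat 1))"
    unfolding rep_op_rough[OF SO2_mat_1] norm_of_real by simp
  finally show ?thesis .
qed

lemma not_generated_by_compact_J1:
  assumes K: "\<forall>i<m. compact (cm_support SE2 (\<mu> i))"
  shows "\<not> generated_by_measures SE2 J1 m \<mu>"
proof
  assume gen: "generated_by_measures SE2 J1 m \<mu>"
  obtain C where C: "\<And>r. cmod (rep_op r rough_measure (\<lambda>_. 1) (mat 1)) \<le> C * \<bar>r - 1\<bar>"
    using generated_lipschitz[OF gen _ rough_measure_in_J1] K by blast
  obtain j where j: "2 * C < 2 ^ j" using real_arch_pow[of 2 "2 * C"] by auto
  have "(1/2) ^ Suc j \<le> C * \<bar>(1 + 1 / 4 ^ j) - 1\<bar>"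
    using rough_lower_bound[of j] C[of "1 + 1 / 4 ^ j"] by (rule order_trans)
  then have "(1/2) ^ Suc j * 4 ^ j \<le> C" by (simp add: field_simps)
  moreover have "(1/2) ^ Suc j * 4 ^ j = (2 ^ j / 2 :: real)"
    by (simp add: power_mult_distrib[symmetric])
  ultimately show False using j by simp
qed

theorem theorem1p4:
  shows "(\<exists>\<xi> \<in> L2 haar_SO2. L2_norm haar_SO2 \<xi> = 1 \<and>
            closedin (weak_star SE2) (J_U \<xi>) \<and>
            maximal_left_ideal SE2 (J_U \<xi>) \<and>
            \<not> generated_by_projection SE2 (J_U \<xi>)) \<and>
         (left_ideal SE2 (J_U (\<lambda>_. 1)) \<and>
          closedin (weak_star SE2) (J_U (\<lambda>_. 1)) \<and>
          \<not> (\<exists>m \<mu>. (\<forall>i<m. compact (cm_support SE2 (\<mu> i))) \<and>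
                    generated_by_measures SE2 (J_U (\<lambda>_. 1)) m \<mu>))"
proof (intro conjI bexI[of _ "\<lambda>_. 1"])
  show "\<not> (\<exists>m \<mu>. (\<forall>i<m. compact (cm_support SE2 (\<mu> i))) \<and> generated_by_measures SE2 J1 m \<mu>)"
    using not_generated_by_compact_J1 by blast
qed (rule L2_norm_one weak_star_closed_J1 maximal_left_ideal_J1 not_generated_by_projection_J1
    one_L2 left_ideal_J1)+

end
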